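(* Let $(E,g)$ be a real analytic Riemannian manifold and $p\in E$. Let $\mathcal{O}_p$ be the local ring of real analytic function germs at $p$, $\mathfrak{m}$ its maximal ideal, and $\mathcal{I}_k=\mathfrak{m}^k$. For every natural number $k\ge 2$ there is an open and dense subset $\mathcal{A}\subset\mathcal{I}_k$ such that, for every potential $U$ whose germ at $p$ belongs to $\mathcal{A}$ and every real analytic magnetic potential $\mu$ (a one-form defined near $p$) verifying the weak magnetism hypothesis with respect to $U$, the point $p$ is totally unstable for the Lagrangian system $L(x,v)=\tfrac12 g_x(v,v)+\mu_x(v)-U(x)$.
   Context: **System.** Let $n=\dim E$. Let $U$ be a real analytic function and $\mu$ a real analytic one-form on a neighbourhood $A$ of $p$. The Euler–Lagrange flow of $L(x,v)=\tfrac12 g_x(v,v)+\mu_x(v)-U(x)$ on $TA$ is given by $\dot x=v$, $\nabla_{\dot x}v=-\mathrm{grad}_g U(x)-\mathcal{R}_x(\iota_v d\mu(x))$, where $\nabla$ is the Levi-Civita connection of $g$ and $\mathcal{R}_x:T_x^*E\to T_xE$ is Riesz duality. The energy $H(x,v)=\tfrac12 g_x(v,v)+U(x)$ is constant along orbits. A point $z$ is subcritical if $H(z)<0$. **Weak magnetism hypothesis.** $d-l/2\ge 1$, where $l$ and $d$ are the degrees of the first non-zero jets at $p$ of $U$ and $\mu$ respectively (for $\mu$: the smallest degree of a non-zero homogeneous term in the Taylor expansions at $p$ of its coefficients in a local chart centered at $p$). If the germ of $\mu$ is zero (purely mechanical case) the hypothesis is considered satisfied. (For the zero germ $U$ there are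 no subcritical points.) **Total instability.** $p$ is totally unstable if there is a neighbourhood $B\subset A$ of $p$ such that for every $z\in TB$ with $H(z)<0$, the positive orbit of $z$ is not contained in $TB$. **Topology on germs.** Take an analytic chart centered at $p$, so that $\mathcal{O}_p$ is the ring of real analytic germs at $0\in\mathbb{R}^n$, identified with convergent real power series. Via $\mathbb{R}^n\subset\mathbb{C}^n$, $\mathcal{O}_p$ is contained in the ring of holomorphic germs $\varinjlim_{A\ni p}H(A)$, where $A$ ranges over neighbourhoods of $p$ in $\mathbb{C}^n$ and $H(A)$ is the space of holomorphic functions on $A$ with the compact-open topology; the direct limit has the direct limit topology, $\mathcal{O}_p$ has the induced topology, and $\mathcal{I}_k$ the relative topology. (Concretely, $[f_j]\to[f]$ if there is a neighbourhood $A$ of $p$ in $\mathbb{C}^n$ on which the holomorphic extensions of all $f_j$ and of $f$ are defined and converge locally uniformly.) *)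

theory Defs
  imports "HOL-Analysis.Analysis" "HOL-Algebra.Ideal_Product"
begin

section \<open>Analytic functions of several variables\<close>

text \<open>
  Stated for an arbitrary normed field, so that the same definition gives real analytic functions
  (over the reals) and holomorphic functions of several variables (over the complex numbers).
  A multi-index is a function \<open>\<alpha> :: 'n \<Rightarrow> nat\<close>.
\<close>

definition has_power_series ::
  "('k::real_normed_field ^ 'n \<Rightarrow> 'k) \<Rightarrow> (('n \<Rightarrow> nat) \<Rightarrow> 'k) \<Rightarrow> 'k ^ 'n \<Rightarrow> bool" where
  "has_power_series f a y \<longleftrightarrow>
     (\<exists>r>0. \<forall>h. norm h < r \<longrightarrow>
        ((\<lambda>\<alpha>. a \<alpha> * (\<Prod>i\<in>UNIV. h $ i ^ \<alpha> i)) has_sum f (y + h)) UNIV)"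

definition analytic_at :: "('k::real_normed_field ^ 'n \<Rightarrow> 'k) \<Rightarrow> 'k ^ 'n \<Rightarrow> bool" where
  "analytic_at f y \<longleftrightarrow> (\<exists>a. has_power_series f a y)"

definition mdeg :: "('n::finite \<Rightarrow> nat) \<Rightarrow> nat" where
  "mdeg \<alpha> = (\<Sum>i\<in>UNIV. \<alpha> i)"

text \<open>
  \<open>first_jet_degree F y l\<close>: \<open>l\<close> is the smallest degree of a non-zero homogeneous term in the Taylor
  expansions at \<open>y\<close> of the functions \<open>F j\<close>. No such \<open>l\<close> exists if all the expansions vanish.
\<close>

definition first_jet_degree :: "('j \<Rightarrow> real ^ 'n \<Rightarrow> real) \<Rightarrow> real ^ 'n \<Rightarrow> nat \<Rightarrow> bool" where
  "first_jet_degree F y l \<longleftrightarrow>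
     (\<exists>a. (\<forall>j. has_power_series (F j) (a j) y) \<and>
          (\<exists>j \<alpha>. mdeg \<alpha> = l \<and> a j \<alpha> \<noteq> 0) \<and>
          (\<forall>j \<alpha>. mdeg \<alpha> < l \<longrightarrow> a j \<alpha> = 0))"

definition partial :: "'n \<Rightarrow> (real ^ 'n \<Rightarrow> real) \<Rightarrow> real ^ 'n \<Rightarrow> real" where
  "partial i f y = frechet_derivative f (at y) (axis i 1)"


section \<open>Real analytic manifolds\<close>

text \<open>A chart is its domain together with its coordinate map (irrelevant outside the domain).\<close>

type_synonym ('a, 'n) chart = "'a set \<times> ('a \<Rightarrow> real ^ 'n)"

definition chart_inv :: "('a, 'n) chart \<Rightarrow> real ^ 'n \<Rightarrow> 'a" where
  "chart_inv c = inv_into (fst c) (snd c)"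

definition is_chart :: "('a::topological_space, 'n::finite) chart \<Rightarrow> bool" where
  "is_chart c \<longleftrightarrow> open (fst c) \<and> open (snd c ` fst c) \<and>
     homeomorphism (fst c) (snd c ` fst c) (snd c) (chart_inv c)"

definition transition :: "('a, 'n) chart \<Rightarrow> ('a, 'n) chart \<Rightarrow> real ^ 'n \<Rightarrow> real ^ 'n" where
  "transition c d = snd d \<circ> chart_inv c"

definition analytic_atlas :: "('a::topological_space, 'n::finite) chart set \<Rightarrow> bool" where
  "analytic_atlas \<C> \<longleftrightarrow>
     (\<forall>c\<in>\<C>. is_chart c) \<and> (\<Union>c\<in>\<C>. fst c) = UNIV \<and>
     (\<forall>c\<in>\<C>. \<forall>d\<in>\<C>. \<forall>x \<in> fst c \<inter> fst d. \<forall>i.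
        analytic_at (\<lambda>y. transition c d y $ i) (snd c x))"

text \<open>A real analytic structure is a maximal analytic atlas.\<close>

definition analytic_structure :: "('a::topological_space, 'n::finite) chart set \<Rightarrow> bool" where
  "analytic_structure \<C> \<longleftrightarrow>
     analytic_atlas \<C> \<and> (\<forall>\<D>. analytic_atlas \<D> \<and> \<C> \<subseteq> \<D> \<longrightarrow> \<D> = \<C>)"

definition charts_at :: "('a, 'n) chart set \<Rightarrow> 'a \<Rightarrow> ('a, 'n) chart set" where
  "charts_at \<C> x = {c \<in> \<C>. x \<in> fst c}"

definition analytic_fun_at ::
  "('a, 'n::finite) chart set \<Rightarrow> ('a \<Rightarrow> real) \<Rightarrow> 'a \<Rightarrow> bool" where
  "analytic_fun_at \<C> f x \<longleftrightarrow> (\<forall>c\<in>charts_at \<C> x. analytic_at (f \<circ> chart_inv c) (snd c x))"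


subsection \<open>Tangent vectors, metrics and one-forms\<close>

text \<open>
  A tangent vector at \<open>x\<close> is the family of its components \<open>v c\<close> with respect to all charts \<open>c\<close>
  around \<open>x\<close>, related by the derivatives of the transition maps (and \<open>0\<close> by convention for the
  other charts). The vector space operations are the componentwise ones.
\<close>

type_synonym ('a, 'n) tvec = "('a, 'n) chart \<Rightarrow> real ^ 'n"

definition tangent_space :: "('a, 'n::finite) chart set \<Rightarrow> 'a \<Rightarrow> ('a, 'n) tvec set" where
  "tangent_space \<C> x =
     {v. (\<forall>c. c \<notin> charts_at \<C> x \<longrightarrow> v c = 0) \<and>
         (\<forall>c\<in>charts_at \<C> x. \<forall>d\<in>charts_at \<C> x.
            v d = frechet_derivative (transition c d) (at (snd c x)) (v c))}"

definition tangent_bundle ::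
  "('a, 'n::finite) chart set \<Rightarrow> 'a set \<Rightarrow> ('a \<times> ('a, 'n) tvec) set" where
  "tangent_bundle \<C> B = (SIGMA x:B. tangent_space \<C> x)"

text \<open>The coordinate vector \<open>\<partial>/\<partial>y\<^sub>i\<close> of the chart \<open>c\<close> at the point \<open>x\<close>.\<close>

definition coord_vec ::
  "('a, 'n::finite) chart set \<Rightarrow> ('a, 'n) chart \<Rightarrow> 'n \<Rightarrow> 'a \<Rightarrow> ('a, 'n) tvec" where
  "coord_vec \<C> c i x =
     (\<lambda>d. if d \<in> charts_at \<C> x
          then frechet_derivative (transition c d) (at (snd c x)) (axis i 1) else 0)"

definition linear_form ::
  "('a, 'n::finite) chart set \<Rightarrow> 'a \<Rightarrow> (('a, 'n) tvec \<Rightarrow> real) \<Rightarrow> bool" where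
  "linear_form \<C> x \<phi> \<longleftrightarrow>
     (\<forall>u\<in>tangent_space \<C> x. \<forall>v\<in>tangent_space \<C> x. \<forall>a b.
        \<phi> (\<lambda>c. a *\<^sub>R u c + b *\<^sub>R v c) = a * \<phi> u + b * \<phi> v)"

definition form_comp ::
  "('a, 'n::finite) chart set \<Rightarrow> ('a \<Rightarrow> ('a, 'n) tvec \<Rightarrow> real) \<Rightarrow> ('a, 'n) chart \<Rightarrow>
     'n \<Rightarrow> real ^ 'n \<Rightarrow> real" where
  "form_comp \<C> \<mu> c i y = \<mu> (chart_inv c y) (coord_vec \<C> c i (chart_inv c y))"

definition analytic_one_form ::
  "('a, 'n::finite) chart set \<Rightarrow> 'a set \<Rightarrow> ('a \<Rightarrow> ('a, 'n) tvec \<Rightarrow> real) \<Rightarrow> bool" where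
  "analytic_one_form \<C> A \<mu> \<longleftrightarrow>
     (\<forall>x\<in>A. linear_form \<C> x (\<mu> x) \<and>
        (\<forall>c\<in>charts_at \<C> x. \<forall>i. analytic_at (form_comp \<C> \<mu> c i) (snd c x)))"

definition metric_comp ::
  "('a, 'n::finite) chart set \<Rightarrow> ('a \<Rightarrow> ('a, 'n) tvec \<Rightarrow> ('a, 'n) tvec \<Rightarrow> real) \<Rightarrow>
     ('a, 'n) chart \<Rightarrow> 'n \<Rightarrow> 'n \<Rightarrow> real ^ 'n \<Rightarrow> real" where
  "metric_comp \<C> g c i j y =
     g (chart_inv c y) (coord_vec \<C> c i (chart_inv c y)) (coord_vec \<C> c j (chart_inv c y))"

definition analytic_riemannian_metric ::
  "('a, 'n::finite) chart set \<Rightarrow> ('a \<Rightarrow> ('a, 'n) tvec \<Rightarrow> ('a, 'n) tvec \<Rightarrow> real) \<Rightarrow> bool" where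
  "analytic_riemannian_metric \<C> g \<longleftrightarrow>
     (\<forall>x. (\<forall>u\<in>tangent_space \<C> x. linear_form \<C> x (g x u)) \<and>
          (\<forall>u\<in>tangent_space \<C> x. \<forall>v\<in>tangent_space \<C> x. g x u v = g x v u) \<and>
          (\<forall>v\<in>tangent_space \<C> x. v \<noteq> (\<lambda>_. 0) \<longrightarrow> g x v v > 0) \<and>
          (\<forall>c\<in>charts_at \<C> x. \<forall>i j. analytic_at (metric_comp \<C> g c i j) (snd c x)))"


section \<open>The Euler--Lagrange flow\<close>

definition gram ::
  "('a, 'n::finite) chart set \<Rightarrow> ('a \<Rightarrow> ('a, 'n) tvec \<Rightarrow> ('a, 'n) tvec \<Rightarrow> real) \<Rightarrow>
     ('a, 'n) chart \<Rightarrow> real ^ 'n \<Rightarrow> real ^ 'n ^ 'n" where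
  "gram \<C> g c y = (\<chi> i j. metric_comp \<C> g c i j y)"

text \<open>Riesz duality in components, i.e. raising of the index.\<close>

definition riesz ::
  "('a, 'n::finite) chart set \<Rightarrow> ('a \<Rightarrow> ('a, 'n) tvec \<Rightarrow> ('a, 'n) tvec \<Rightarrow> real) \<Rightarrow>
     ('a, 'n) chart \<Rightarrow> real ^ 'n \<Rightarrow> real ^ 'n \<Rightarrow> real ^ 'n" where
  "riesz \<C> g c y \<omega> = matrix_inv (gram \<C> g c y) *v \<omega>"

text \<open>Christoffel symbols (upper index \<open>i\<close>) of the Levi-Civita connection.\<close>

definition christoffel ::
  "('a, 'n::finite) chart set \<Rightarrow> ('a \<Rightarrow> ('a, 'n) tvec \<Rightarrow> ('a, 'n) tvec \<Rightarrow> real) \<Rightarrow>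
     ('a, 'n) chart \<Rightarrow> 'n \<Rightarrow> 'n \<Rightarrow> 'n \<Rightarrow> real ^ 'n \<Rightarrow> real" where
  "christoffel \<C> g c i j k y =
     (1 / 2) * (\<Sum>l\<in>UNIV. matrix_inv (gram \<C> g c y) $ i $ l *
        (partial j (metric_comp \<C> g c l k) y + partial k (metric_comp \<C> g c j l) y
           - partial l (metric_comp \<C> g c j k) y))"

text \<open>
  The components of \<open>\<nabla>\<^bsub>x'\<^esub> v\<close> at \<open>y\<close> for a vector field \<open>v\<close> along a curve \<open>x\<close>, where \<open>w\<close>, \<open>v\<close>, \<open>v'\<close>
  are the components of the velocity of the curve, of the field, and the derivative of the latter.
\<close>

definition cov_deriv ::
  "('a, 'n::finite) chart set \<Rightarrow> ('a \<Rightarrow> ('a, 'n) tvec \<Rightarrow> ('a, 'n) tvec \<Rightarrow> real) \<Rightarrow>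
     ('a, 'n) chart \<Rightarrow> real ^ 'n \<Rightarrow> real ^ 'n \<Rightarrow> real ^ 'n \<Rightarrow> real ^ 'n \<Rightarrow> real ^ 'n" where
  "cov_deriv \<C> g c y w v v' =
     (\<chi> i. v' $ i + (\<Sum>j\<in>UNIV. \<Sum>k\<in>UNIV. christoffel \<C> g c i j k y * w $ j * v $ k))"

definition grad ::
  "('a, 'n::finite) chart set \<Rightarrow> ('a \<Rightarrow> ('a, 'n) tvec \<Rightarrow> ('a, 'n) tvec \<Rightarrow> real) \<Rightarrow>
     ('a \<Rightarrow> real) \<Rightarrow> ('a, 'n) chart \<Rightarrow> real ^ 'n \<Rightarrow> real ^ 'n" where
  "grad \<C> g U c y = riesz \<C> g c y (\<chi> i. partial i (U \<circ> chart_inv c) y)"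

text \<open>The components of the contraction \<open>\<iota>\<^sub>v d\<mu> = d\<mu>(v, \<cdot>)\<close>.\<close>

definition contract_d ::
  "('a, 'n::finite) chart set \<Rightarrow> ('a \<Rightarrow> ('a, 'n) tvec \<Rightarrow> real) \<Rightarrow> ('a, 'n) chart \<Rightarrow>
     real ^ 'n \<Rightarrow> real ^ 'n \<Rightarrow> real ^ 'n" where
  "contract_d \<C> \<mu> c y v =
     (\<chi> j. \<Sum>k\<in>UNIV. v $ k *
        (partial k (form_comp \<C> \<mu> c j) y - partial j (form_comp \<C> \<mu> c k) y))"

text \<open>
  \<open>(x, v)\<close> is an integral curve on \<open>[0, T]\<close> of the Euler--Lagrange vector field on \<open>TA\<close>. The
  equations are tensorial, so it is immaterial in which chart around \<open>x t\<close> they are expressed.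
\<close>

definition el_solution ::
  "('a::topological_space, 'n::finite) chart set \<Rightarrow>
     ('a \<Rightarrow> ('a, 'n) tvec \<Rightarrow> ('a, 'n) tvec \<Rightarrow> real) \<Rightarrow> 'a set \<Rightarrow> ('a \<Rightarrow> real) \<Rightarrow>
     ('a \<Rightarrow> ('a, 'n) tvec \<Rightarrow> real) \<Rightarrow> real \<Rightarrow> (real \<Rightarrow> 'a) \<Rightarrow> (real \<Rightarrow> ('a, 'n) tvec) \<Rightarrow> bool" where
  "el_solution \<C> g A U \<mu> T x v \<longleftrightarrow>
     continuous_on {0..T} x \<and>
     (\<forall>t\<in>{0..T}. (x t, v t) \<in> tangent_bundle \<C> A) \<and>
     (\<forall>t\<in>{0..T}. \<exists>c\<in>charts_at \<C> (x t). \<exists>v'.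
        ((\<lambda>s. snd c (x s)) has_vector_derivative v t c) (at t within {0..T}) \<and>
        ((\<lambda>s. v s c) has_vector_derivative v') (at t within {0..T}) \<and>
        cov_deriv \<C> g c (snd c (x t)) (v t c) (v t c) v' =
          - grad \<C> g U c (snd c (x t))
          - riesz \<C> g c (snd c (x t)) (contract_d \<C> \<mu> c (snd c (x t)) (v t c)))"

text \<open>
  All states reached from \<open>z\<close> in non-negative time; by uniqueness of integral curves this is the
  positive half of the maximal integral curve through \<open>z\<close>.
\<close>

definition positive_orbit ::
  "('a::topological_space, 'n::finite) chart set \<Rightarrow>
     ('a \<Rightarrow> ('a, 'n) tvec \<Rightarrow> ('a, 'n) tvec \<Rightarrow> real) \<Rightarrow> 'a set \<Rightarrow> ('a \<Rightarrow> real) \<Rightarrow>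
     ('a \<Rightarrow> ('a, 'n) tvec \<Rightarrow> real) \<Rightarrow> 'a \<times> ('a, 'n) tvec \<Rightarrow> ('a \<times> ('a, 'n) tvec) set" where
  "positive_orbit \<C> g A U \<mu> z =
     {(x T, v T) |T x v. T \<ge> 0 \<and> el_solution \<C> g A U \<mu> T x v \<and> (x 0, v 0) = z}"

definition energy ::
  "('a \<Rightarrow> ('a, 'n) tvec \<Rightarrow> ('a, 'n) tvec \<Rightarrow> real) \<Rightarrow> ('a \<Rightarrow> real) \<Rightarrow> 'a \<times> ('a, 'n) tvec \<Rightarrow> real" where
  "energy g U z = (1 / 2) * g (fst z) (snd z) (snd z) + U (fst z)"

definition totally_unstable ::
  "('a::topological_space, 'n::finite) chart set \<Rightarrow>
     ('a \<Rightarrow> ('a, 'n) tvec \<Rightarrow> ('a, 'n) tvec \<Rightarrow> real) \<Rightarrow> 'a set \<Rightarrow> ('a \<Rightarrow> real) \<Rightarrow>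
     ('a \<Rightarrow> ('a, 'n) tvec \<Rightarrow> real) \<Rightarrow> 'a \<Rightarrow> bool" where
  "totally_unstable \<C> g A U \<mu> p \<longleftrightarrow>
     (\<exists>B. open B \<and> p \<in> B \<and> B \<subseteq> A \<and>
        (\<forall>z\<in>tangent_bundle \<C> B. energy g U z < 0 \<longrightarrow>
           \<not> positive_orbit \<C> g A U \<mu> z \<subseteq> tangent_bundle \<C> B))"

text \<open>
  If the germ of \<open>\<mu>\<close> (or of \<open>U\<close>) at \<open>p\<close> is zero, then \<open>d\<close> (or \<open>l\<close>) does not exist and the condition
  holds vacuously.
\<close>

definition weak_magnetism ::
  "('a, 'n::finite) chart set \<Rightarrow> ('a, 'n) chart \<Rightarrow> ('a \<Rightarrow> real) \<Rightarrow>
     ('a \<Rightarrow> ('a, 'n) tvec \<Rightarrow> real) \<Rightarrow> 'a \<Rightarrow> bool" where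
  "weak_magnetism \<C> c U \<mu> p \<longleftrightarrow>
     (\<forall>l d. first_jet_degree (\<lambda>_::unit. U \<circ> chart_inv c) (snd c p) l \<and>
            first_jet_degree (form_comp \<C> \<mu> c) (snd c p) d \<longrightarrow>
            real d - real l / 2 \<ge> 1)"


section \<open>Germs\<close>

definition germ :: "'a::topological_space \<Rightarrow> ('a \<Rightarrow> 'b) \<Rightarrow> ('a \<Rightarrow> 'b) set" where
  "germ p f = {h. \<forall>\<^sub>F y in nhds p. h y = f y}"

text \<open>The local ring \<open>\<O>\<^sub>p\<close> of germs at \<open>p\<close> of real analytic functions.\<close>

definition germ_ring ::
  "('a::topological_space, 'n::finite) chart set \<Rightarrow> 'a \<Rightarrow> ('a \<Rightarrow> real) set ring" where
  "germ_ring \<C> p =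
     \<lparr>carrier = germ p ` {f. analytic_fun_at \<C> f p},
      mult = (\<lambda>G H. \<Union>f\<in>G. \<Union>h\<in>H. germ p (\<lambda>x. f x * h x)),
      one = germ p (\<lambda>_. 1),
      zero = germ p (\<lambda>_. 0),
      add = (\<lambda>G H. \<Union>f\<in>G. \<Union>h\<in>H. germ p (\<lambda>x. f x + h x))\<rparr>"

fun ideal_power :: "('a, 'b) ring_scheme \<Rightarrow> 'a set \<Rightarrow> nat \<Rightarrow> 'a set" where
  "ideal_power R I 0 = carrier R"
| "ideal_power R I (Suc k) = ideal_prod R I (ideal_power R I k)"


subsection \<open>The topology on germs\<close>

text \<open>The space \<open>H(A)\<close> of holomorphic functions on \<open>A\<close>, with the compact-open topology.\<close>

definition hol_funs :: "(complex ^ 'n::finite) set \<Rightarrow> (complex ^ 'n \<Rightarrow> complex) set" where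
  "hol_funs A = {F \<in> extensional A. \<forall>z\<in>A. analytic_at F z}"

definition hol_topology :: "(complex ^ 'n::finite) set \<Rightarrow> (complex ^ 'n \<Rightarrow> complex) topology" where
  "hol_topology A =
     subtopology (topology_generated_by {{F. F ` K \<subseteq> V} |K V. compact K \<and> K \<subseteq> A \<and> open V})
       (hol_funs A)"

definition hol_germs :: "(complex ^ 'n::finite \<Rightarrow> complex) set set" where
  "hol_germs = germ 0 ` {F. analytic_at F 0}"

text \<open>
  The direct limit topology, i.e. the finest topology on the holomorphic germs at \<open>0\<close> making all the
  maps \<open>germ 0 : H(A) \<rightarrow> hol_germs\<close> continuous.
\<close>

definition direct_limit_open :: "(complex ^ 'n::finite \<Rightarrow> complex) set set \<Rightarrow> bool" where
  "direct_limit_open W \<longleftrightarrow> W \<subseteq> hol_germs \<and>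
     (\<forall>A. open A \<and> 0 \<in> A \<longrightarrow> openin (hol_topology A) {F \<in> hol_funs A. germ 0 F \<in> W})"

definition hol_germ_topology :: "(complex ^ 'n::finite \<Rightarrow> complex) set topology" where
  "hol_germ_topology = topology direct_limit_open"

lemma topspace_hol_topology:
  fixes A :: "(complex ^ 'n::finite) set"
  shows "topspace (hol_topology A) = hol_funs A"
proof -
  have "UNIV \<in> {{F :: complex ^ 'n \<Rightarrow> complex. F ` K \<subseteq> V} |K V. compact K \<and> K \<subseteq> A \<and> open V}"
    by (intro CollectI exI[of _ "{}"] exI[of _ UNIV]) auto
  then show ?thesis
    unfolding hol_topology_def topspace_subtopology topology_generated_by_topspace by blast
qed

lemma istopology_direct_limit_open:
  "istopology (direct_limit_open :: (complex ^ 'n::finite \<Rightarrow> complex) set set \<Rightarrow> bool)"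
  unfolding istopology_def
proof (intro conjI allI impI)
  fix S T :: "(complex ^ 'n \<Rightarrow> complex) set set"
  assume ST: "direct_limit_open S" "direct_limit_open T"
  have "{F \<in> hol_funs A. germ 0 F \<in> S \<inter> T} =
      {F \<in> hol_funs A. germ 0 F \<in> S} \<inter> {F \<in> hol_funs A. germ 0 F \<in> T}" for A :: "(complex ^ 'n) set"
    by auto
  with ST show "direct_limit_open (S \<inter> T)"
    unfolding direct_limit_open_def by auto
next
  fix \<K> :: "(complex ^ 'n \<Rightarrow> complex) set set set"
  assume K: "\<forall>S\<in>\<K>. direct_limit_open S"
  have "{F \<in> hol_funs A. germ 0 F \<in> \<Union>\<K>} = (\<Union>S\<in>\<K>. {F \<in> hol_funs A. germ 0 F \<in> S})" for A :: "(complex ^ 'n) set"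
    by auto
  with K show "direct_limit_open (\<Union>\<K>)"
    unfolding direct_limit_open_def by (auto intro!: openin_Union)
qed

lemma openin_hol_germ_topology: "openin hol_germ_topology W \<longleftrightarrow> direct_limit_open W"
  unfolding hol_germ_topology_def by (simp add: topology_inverse'[OF istopology_direct_limit_open])

text \<open>
  The embedding of \<open>\<O>\<^sub>p\<close> into the holomorphic germs at \<open>0\<close> given by a chart \<open>c\<close> centered at \<open>p\<close>:
  the germ of all holomorphic \<open>F\<close> extending the chart representation of the real germ.
\<close>

definition complexify ::
  "('a, 'n::finite) chart \<Rightarrow> ('a \<Rightarrow> real) set \<Rightarrow> (complex ^ 'n \<Rightarrow> complex) set" where
  "complexify c G =
     {F. analytic_at F 0 \<and>
         (\<exists>f\<in>G. \<forall>\<^sub>F y in nhds 0. F (\<chi> i. complex_of_real (y $ i)) = of_real (f (chart_inv c y)))}"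

definition germ_topology ::
  "('a::topological_space, 'n::finite) chart set \<Rightarrow> ('a, 'n) chart \<Rightarrow> 'a \<Rightarrow>
     ('a \<Rightarrow> real) set topology" where
  "germ_topology \<C> c p =
     pullback_topology (carrier (germ_ring \<C> p)) (complexify c) hol_germ_topology"

end

theory Submission
  imports Defs "HOL-Complex_Analysis.Complex_Analysis"
begin

no_notation fps_nth (infixl "$" 75)

text \<open>
  Let \<open>u\<close> be the potential in a chart centred at \<open>p\<close> and \<open>P\<close> its homogeneous part of degree \<open>k\<close>. The good
  germs are those for which \<open>grad P\<close> has no zero on \<open>\<real>\<^sup>n - {0}\<close>. For them consider, along a subcritical
  orbit \<open>(y, w)\<close> with metric momentum \<open>q = g(y) w\<close>, the function \<open>f = X(y) \<bullet> q\<close> with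
  \<open>X(y) = y - M \<bar>y\<bar>\<^bsup>3-k\<^esup> grad u(y)\<close>. The radial part of \<open>X\<close> contributes \<open>- y \<bullet> grad u = - k u + O(\<bar>y\<bar>\<^bsup>k+1\<^esup>)\<close>
  to \<open>f'\<close> by Euler's identity, and the correction contributes
  \<open>M \<bar>y\<bar>\<^bsup>3-k\<^esup> \<bar>grad u\<bar>\<^sup>2 \<ge> c M \<bar>y\<bar>\<^bsup>k+1\<^esup>\<close>, which absorbs this Taylor remainder and, by weak magnetism, the
  magnetic term; the terms quadratic in \<open>w\<close> are absorbed by the kinetic energy. Hence near \<open>p\<close> one has
  \<open>f' \<ge> - k u \<ge> - k H > 0\<close>, whereas energy conservation keeps \<open>f\<close> bounded as long as the orbit stays near
  \<open>p\<close>. So it leaves.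

  The good germs are open because the degree \<open>k\<close> part depends continuously on the germ, by Cauchy estimates
  on complex lines through the origin. They are dense because adding \<open>\<Sum>\<^sub>i v\<^sub>i x\<^sub>i\<^sup>k\<close> makes \<open>P\<close> good
  for almost every \<open>v\<close>: the critical equations are homogeneous, so one coordinate of a critical point may be
  normalised to 1, and the bad \<open>v\<close> form a differentiable image of hyperplanes.
\<close>

section \<open>Power series in several variables\<close>

text \<open>The obstacle is that a subcritical point only satisfies \<open>u < 0\<close>: near the
  zero cone of \<open>P\<close> the main term \<open>- k u\<close> may be far smaller than a Taylor
  remainder of size \<open>|y|^(k+1)\<close>, so the radial field alone yields no sign. By Euler's
  identity every critical point of \<open>P\<close> lies in that cone, and the good condition
  excludes them, which makes \<open>|grad u|^2\<close> at least of size \<open>|y|^(2k-2)\<close>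
  near the origin. The exponent \<open>3-k\<close> is the one that turns this into
  \<open>|y|^(k+1)\<close>, the order of the remainder. With the same exponent the correction has
  size \<open>|y|^2\<close> and its derivative size \<open>|y|\<close>, so \<open>X\<close> stays
  close to the radial field and the terms quadratic in \<open>w\<close> get small coefficients. The
  components of \<open>d mu\<close> are of order \<open>m\<close> with \<open>2 m \<ge> k\<close>,
  so \<open>|y| |w| |y|^m\<close> is at most \<open>|y| |w|^2 + |y|^(k+1)\<close>: one part for each
  of the two absorbing terms. The weight may be singular at the origin, but \<open>u\<close>
  vanishes there, so a subcritical orbit never meets it.\<close>

abbreviation mpow :: "'k::comm_semiring_1 ^ 'n::finite \<Rightarrow> ('n \<Rightarrow> nat) \<Rightarrow> 'k" where
  "mpow h \<alpha> \<equiv> (\<Prod>i\<in>UNIV. h $ i ^ \<alpha> i)"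

text \<open>Absolute convergence at the corner of the polydisc with all radii equal to
  \<open>\<rho>\<close>; it controls every \<open>h\<close> whose components have norm at most
  \<open>\<rho>\<close>, be they real or complex.\<close>

definition absconv :: "(('n::finite \<Rightarrow> nat) \<Rightarrow> 'k::real_normed_field) \<Rightarrow> real \<Rightarrow> bool" where
  "absconv a \<rho> \<longleftrightarrow> 0 < \<rho> \<and> (\<lambda>\<alpha>. norm (a \<alpha>) * \<rho> ^ mdeg \<alpha>) summable_on UNIV"

definition index_unit :: "'n \<Rightarrow> 'n \<Rightarrow> nat" where
  "index_unit i = (\<lambda>j. if j = i then 1 else 0)"

definition index_inc :: "'n \<Rightarrow> ('n \<Rightarrow> nat) \<Rightarrow> 'n \<Rightarrow> nat" where
  "index_inc i \<gamma> = \<gamma>(i := Suc (\<gamma> i))"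

lemma mdeg_zero [simp]: "mdeg (\<lambda>_. 0) = 0"
  by (simp add: mdeg_def)

lemma mdeg_unit [simp]: "mdeg (index_unit i) = 1"
  by (simp add: mdeg_def index_unit_def)

lemma mdeg_eq_0_iff: "mdeg \<alpha> = 0 \<longleftrightarrow> \<alpha> = (\<lambda>_. 0)"
  by (auto simp: mdeg_def)

lemma mdeg_inc [simp]: "mdeg (index_inc i \<gamma>) = Suc (mdeg \<gamma>)"
proof -
  have "mdeg (index_inc i \<gamma>) = (\<Sum>j\<in>UNIV. \<gamma> j + (if j = i then 1 else 0))"
    unfolding mdeg_def index_inc_def by (intro sum.cong) auto
  then show ?thesis by (simp add: sum.distrib mdeg_def)
qed

lemma inj_index_inc: "inj (index_inc i)"
proof (rule injI, rule ext)
  fix \<gamma> \<delta> :: "'a \<Rightarrow> nat" and j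
  assume "index_inc i \<gamma> = index_inc i \<delta>"
  from fun_cong[OF this, of j] show "\<gamma> j = \<delta> j"
    by (auto simp: index_inc_def split: if_splits)
qed

lemma range_index_inc: "range (index_inc i) = {\<alpha>. \<alpha> i \<noteq> 0}"
proof safe
  fix \<alpha> :: "'a \<Rightarrow> nat" assume "\<alpha> i > 0"
  then have "\<alpha> = index_inc i (\<alpha>(i := \<alpha> i - 1))"
    by (auto simp: index_inc_def fun_eq_iff)
  then show "\<alpha> \<in> range (index_inc i)" by blast
qed (auto simp: index_inc_def)

lemma finite_mdeg_le: "finite {\<alpha>::'n::finite \<Rightarrow> nat. mdeg \<alpha> \<le> k}"
proof (rule finite_subset)
  show "{\<alpha>::'n \<Rightarrow> nat. mdeg \<alpha> \<le> k} \<subseteq> PiE UNIV (\<lambda>_. {..k})"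
  proof safe
    fix \<alpha> :: "'n \<Rightarrow> nat" and i assume "mdeg \<alpha> \<le> k"
    moreover have "\<alpha> i \<le> mdeg \<alpha>"
      unfolding mdeg_def by (rule member_le_sum) auto
    ultimately show "\<alpha> i \<le> k" by simp
  qed auto
qed (auto intro: finite_PiE)

lemma finite_mdeg_eq: "finite {\<alpha>::'n::finite \<Rightarrow> nat. mdeg \<alpha> = k}"
  by (rule finite_subset[OF _ finite_mdeg_le[of k]]) auto

lemma mdeg_less_2:
  assumes "mdeg \<alpha> < 2" shows "\<alpha> = (\<lambda>_. 0) \<or> (\<exists>i. \<alpha> = index_unit i)"
proof (cases "mdeg \<alpha> = 0")
  case False
  then obtain i where i: "\<alpha> i \<noteq> 0" by (auto simp: mdeg_eq_0_iff fun_eq_iff)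
  then obtain \<gamma> where \<gamma>: "\<alpha> = index_inc i \<gamma>" using range_index_inc[of i] by blast
  with assms have "mdeg \<gamma> = 0" by simp
  then have "\<alpha> = index_unit i"
    by (auto simp: \<gamma> mdeg_eq_0_iff index_inc_def index_unit_def)
  then show ?thesis by blast
qed (simp add: mdeg_eq_0_iff)

lemma norm_mpow_le:
  fixes h :: "'k::real_normed_field ^ 'n::finite"
  assumes "\<And>i. norm (h $ i) \<le> \<rho>"
  shows "norm (mpow h \<alpha>) \<le> \<rho> ^ mdeg \<alpha>"
proof -
  have "norm (mpow h \<alpha>) = (\<Prod>i\<in>UNIV. norm (h $ i) ^ \<alpha> i)"
    by (simp add: prod_norm[symmetric] norm_power)
  also have "\<dots> \<le> (\<Prod>i\<in>UNIV. \<rho> ^ \<alpha> i)"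
    by (intro prod_mono conjI power_mono assms) auto
  also have "\<dots> = \<rho> ^ mdeg \<alpha>" by (simp add: mdeg_def power_sum)
  finally show ?thesis .
qed

lemma norm_mpow_le_norm:
  fixes h :: "'k::real_normed_field ^ 'n::finite"
  shows "norm (mpow h \<alpha>) \<le> norm h ^ mdeg \<alpha>"
  by (rule norm_mpow_le) (rule Finite_Cartesian_Product.norm_nth_le)

lemma mpow_scaleR:
  "mpow (\<chi> i. (t::'k::real_normed_field) * h $ i) \<alpha> = t ^ mdeg \<alpha> * mpow (h::'k ^ 'n::finite) \<alpha>"
  by (simp add: power_mult_distrib prod.distrib mdeg_def power_sum)

section \<open>Absolute convergence on polydiscs\<close>

lemma absconv_mono:
  assumes "absconv a \<rho>" "0 < \<rho>'" "\<rho>' \<le> \<rho>" shows "absconv a \<rho>'"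
proof -
  have "(\<lambda>\<alpha>. norm (a \<alpha>) * \<rho> ^ mdeg \<alpha>) summable_on UNIV"
    using assms(1) by (simp add: absconv_def)
  then have "(\<lambda>\<alpha>. norm (a \<alpha>) * \<rho>' ^ mdeg \<alpha>) summable_on UNIV"
    by (rule summable_on_comparison_test) (use assms in \<open>auto intro!: mult_left_mono power_mono\<close>)
  then show ?thesis using assms(2) by (simp add: absconv_def)
qed

lemma absconv_abs:
  assumes "absconv a \<rho>" "\<And>i. norm (h $ i) \<le> \<rho>"
  shows "(\<lambda>\<alpha>. norm (a \<alpha> * mpow h \<alpha>)) summable_on UNIV"
proof (rule summable_on_comparison_test)
  show "(\<lambda>\<alpha>. norm (a \<alpha>) * \<rho> ^ mdeg \<alpha>) summable_on UNIV"
    using assms(1) by (simp add: absconv_def)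
qed (auto simp: norm_mult intro!: mult_left_mono norm_mpow_le assms)

lemma absconv_summable:
  fixes a :: "('n::finite \<Rightarrow> nat) \<Rightarrow> 'k::{real_normed_field, euclidean_space}"
  assumes "absconv a \<rho>" "\<And>i. norm (h $ i) \<le> \<rho>"
  shows "(\<lambda>\<alpha>. a \<alpha> * mpow h \<alpha>) summable_on UNIV"
  by (rule abs_summable_summable) (rule absconv_abs[OF assms])

text \<open>In finite dimension unconditional summability is absolute: every coordinate is a real
  family, for which the two notions agree, and the norm is at most the sum of the absolute
  coordinates.\<close>

lemma summable_on_imp_abs_summable:
  fixes f :: "'a \<Rightarrow> 'b::euclidean_space"
  assumes "f summable_on A"
  shows "(\<lambda>x. norm (f x)) summable_on A"
proof (rule Infinite_Sum.abs_summable_on_comparison_test')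
  have *: "(\<lambda>x. \<bar>f x \<bullet> b\<bar>) summable_on A" for b
    using summable_on_bounded_linear[OF bounded_linear_inner_left assms, of b]
      summable_on_iff_abs_summable_on_real[of "\<lambda>x. f x \<bullet> b" A] by (simp add: o_def)
  have "finite B \<Longrightarrow> (\<lambda>x. \<Sum>b\<in>B. \<bar>f x \<bullet> b\<bar>) summable_on A" for B
    by (induction B rule: finite_induct) (auto intro!: summable_on_add *)
  then show "(\<lambda>x. \<Sum>b\<in>Basis. \<bar>f x \<bullet> b\<bar>) summable_on A" by simp
qed (rule norm_le_l1)

lemma has_power_seriesE:
  fixes f :: "'k::{real_normed_field, euclidean_space} ^ 'n::finite \<Rightarrow> 'k"
  assumes "has_power_series f a y"
  obtains \<rho> where "absconv a \<rho>"
    "\<And>h. norm h \<le> \<rho> \<Longrightarrow> ((\<lambda>\<alpha>. a \<alpha> * mpow h \<alpha>) has_sum f (y + h)) UNIV"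
proof -
  from assms obtain r where r: "r > 0"
    "\<And>h. norm h < r \<Longrightarrow> ((\<lambda>\<alpha>. a \<alpha> * mpow h \<alpha>) has_sum f (y + h)) UNIV"
    unfolding has_power_series_def by blast
  \<comment> \<open>The diagonal vector with all components \<open>t\<close> has norm at most
    \<open>r / 2\<close>, and absolute summability of the series at this vector is precisely
    \<open>absconv a t\<close>.\<close>
  define t where "t = r / (2 * real CARD('n))"
  have t: "t > 0" using r(1) by (simp add: t_def)
  let ?h = "(\<chi> i. of_real t) :: 'k ^ 'n"
  have "norm ?h \<le> (\<Sum>i\<in>UNIV. norm (?h $ i))" unfolding norm_vec_def by (rule L2_set_le_sum) auto
  also have "\<dots> = real CARD('n) * t" using t by simp
  also have "\<dots> = r / 2" by (simp add: t_def)
  finally have "norm ?h < r" using r(1) by simp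
  then have "(\<lambda>\<alpha>. a \<alpha> * mpow ?h \<alpha>) summable_on UNIV"
    using r(2) has_sum_imp_summable by blast
  then have "(\<lambda>\<alpha>. norm (a \<alpha> * mpow ?h \<alpha>)) summable_on UNIV"
    by (rule summable_on_imp_abs_summable)
  moreover have "norm (a \<alpha> * mpow ?h \<alpha>) = norm (a \<alpha>) * t ^ mdeg \<alpha>" for \<alpha>
    using t by (simp add: norm_mult prod_norm[symmetric] norm_power mdeg_def power_sum)
  ultimately have *: "absconv a t" using t by (simp add: absconv_def)
  have "absconv a (min t (r/2))" by (rule absconv_mono[OF *]) (use t r in auto)
  then show thesis by (rule that) (use r in auto)
qed

section \<open>Recentring a power series\<close>

definition shift_coeff :: "'k::comm_ring_1 ^ 'n::finite \<Rightarrow> ('n \<Rightarrow> nat) \<Rightarrow> ('n \<Rightarrow> nat) \<Rightarrow> 'k" where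
  "shift_coeff x \<alpha> \<beta> = (\<Prod>i\<in>UNIV. of_nat (\<alpha> i choose \<beta> i) * x $ i ^ (\<alpha> i - \<beta> i))"

lemma shift_coeff_eq_0:
  assumes "\<not> (\<forall>i. \<beta> i \<le> \<alpha> i)" shows "shift_coeff x \<alpha> \<beta> = 0"
proof -
  from assms obtain i where "\<alpha> i < \<beta> i" by (auto simp: not_le)
  then have "of_nat (\<alpha> i choose \<beta> i) * x $ i ^ (\<alpha> i - \<beta> i) = 0" by (simp add: binomial_eq_0)
  then show ?thesis unfolding shift_coeff_def by (intro prod_zero) auto
qed

lemma shift_coeff_nonzeroD: "shift_coeff x \<alpha> \<beta> \<noteq> 0 \<Longrightarrow> \<beta> i \<le> \<alpha> i"
  using shift_coeff_eq_0 by blast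

lemma norm_shift_coeff:
  fixes x :: "'k::real_normed_field ^ 'n::finite"
  shows "norm (shift_coeff x \<alpha> \<beta>) = shift_coeff (\<chi> i. norm (x $ i)) \<alpha> \<beta>"
  by (simp add: shift_coeff_def prod_norm[symmetric] norm_mult norm_power)

lemma mpow_binomial:
  fixes x y :: "'k::comm_ring_1 ^ 'n::finite"
  shows "mpow (x + y) \<alpha> =
    (\<Sum>\<beta>\<in>{\<beta>. \<forall>i. \<beta> i \<le> \<alpha> i}. shift_coeff x \<alpha> \<beta> * mpow y \<beta>)"
proof -
  have "mpow (x + y) \<alpha> =
      (\<Prod>i\<in>UNIV. \<Sum>k\<in>{..\<alpha> i}. of_nat (\<alpha> i choose k) * x $ i ^ (\<alpha> i - k) * y $ i ^ k)"
  proof (rule prod.cong)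
    fix i
    have "(x + y) $ i ^ \<alpha> i = (y $ i + x $ i) ^ \<alpha> i" by (simp add: add.commute)
    also have "\<dots> = (\<Sum>k\<in>{..\<alpha> i}. of_nat (\<alpha> i choose k) * x $ i ^ (\<alpha> i - k) * y $ i ^ k)"
      unfolding binomial_ring by (rule sum.cong) (simp_all add: mult_ac)
    finally show "(x + y) $ i ^ \<alpha> i = (\<Sum>k\<in>{..\<alpha> i}. of_nat (\<alpha> i choose k) * x $ i ^ (\<alpha> i - k) * y $ i ^ k)" .
  qed simp
  also have "\<dots> = (\<Sum>\<beta>\<in>PiE UNIV (\<lambda>i. {..\<alpha> i}).
      \<Prod>i\<in>UNIV. of_nat (\<alpha> i choose \<beta> i) * x $ i ^ (\<alpha> i - \<beta> i) * y $ i ^ \<beta> i)"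
    by (subst prod_sum_PiE) auto
  also have "PiE UNIV (\<lambda>i. {..\<alpha> i}) = {\<beta>. \<forall>i. \<beta> i \<le> \<alpha> i}" by auto
  finally show ?thesis by (simp add: prod.distrib shift_coeff_def)
qed

lemma finite_index_le: "finite {\<beta>::'n::finite \<Rightarrow> nat. \<forall>i. \<beta> i \<le> \<alpha> i}"
proof -
  have "{\<beta>::'n \<Rightarrow> nat. \<forall>i. \<beta> i \<le> \<alpha> i} = PiE UNIV (\<lambda>i. {..\<alpha> i})" by auto
  then show ?thesis by (auto intro: finite_PiE)
qed

definition recentered ::
  "(('n::finite \<Rightarrow> nat) \<Rightarrow> 'k::{real_normed_field, euclidean_space}) \<Rightarrow> 'k ^ 'n \<Rightarrow> ('n \<Rightarrow> nat) \<Rightarrow> 'k" where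
  "recentered a x \<beta> =
     (\<Sum>\<^sub>\<infinity>\<alpha>. a \<alpha> * shift_coeff x \<alpha> \<beta>)"

context
  fixes a :: "('n::finite \<Rightarrow> nat) \<Rightarrow> 'k::{real_normed_field, euclidean_space}"
    and \<rho> :: real
  assumes conv: "absconv a \<rho>"
begin

text \<open>After taking norms, the inner sum over \<open>\<beta>\<close> is the binomial expansion
  of the monomial at the vector with components \<open>norm (x $ i) + norm (h $ i)\<close>, which
  lies in the polydisc of convergence.\<close>

lemma recenter_pair_summable:
  assumes "\<And>i::'n. norm (x $ i) + norm (h $ i) \<le> \<rho>"
  shows "(\<lambda>(\<alpha>, \<beta>). a \<alpha> * shift_coeff x \<alpha> \<beta> * mpow h \<beta>)
     summable_on UNIV \<times> UNIV"
proof (rule abs_summable_summable, rule summable_on_SigmaI)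
  let ?x = "(\<chi> i. norm (x $ i)) :: real ^ 'n" and ?h = "(\<chi> i. norm (h $ i)) :: real ^ 'n"
  fix \<alpha> :: "'n \<Rightarrow> nat"
  show "((\<lambda>\<beta>. norm (case (\<alpha>, \<beta>) of (\<alpha>, \<beta>) \<Rightarrow>
      a \<alpha> * shift_coeff x \<alpha> \<beta> * mpow h \<beta>))
      has_sum norm (a \<alpha>) * mpow (?x + ?h) \<alpha>) UNIV"
    by (rule has_sum_finite_neutralI[OF finite_index_le[of \<alpha>]])
       (auto simp only: mpow_binomial sum_distrib_left mult.assoc norm_mult norm_shift_coeff
         prod_norm[symmetric] norm_power prod.case vec_lambda_beta,
         auto dest: shift_coeff_nonzeroD)
next
  let ?x = "(\<chi> i. norm (x $ i)) :: real ^ 'n" and ?h = "(\<chi> i. norm (h $ i)) :: real ^ 'n"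
  have "(\<lambda>\<alpha>. norm (norm (a \<alpha>) * mpow (?x + ?h) \<alpha>)) summable_on UNIV"
    by (rule absconv_abs[of _ \<rho>]) (use conv assms in \<open>auto simp: absconv_def\<close>)
  moreover have "norm (norm (a \<alpha>) * mpow (?x + ?h) \<alpha>) = norm (a \<alpha>) * mpow (?x + ?h) \<alpha>" for \<alpha>
    by (auto simp: prod_nonneg)
  ultimately show "(\<lambda>\<alpha>. norm (a \<alpha>) * mpow (?x + ?h) \<alpha>) summable_on UNIV" by simp
qed auto

lemma recentered_has_sum:
  assumes "norm x < \<rho>"
  shows "((\<lambda>\<alpha>. a \<alpha> * shift_coeff x \<alpha> \<beta>)
     has_sum recentered a x \<beta>) UNIV"
proof -
  \<comment> \<open>To isolate the column \<open>\<beta>\<close> of the double series, a test vector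
    without zero components is used; the factor \<open>mpow ?h \<beta>\<close> can then be divided
    out.\<close>
  define t where "t = \<rho> - norm x"
  have t: "t > 0" using assms by (simp add: t_def)
  let ?h = "(\<chi> i. of_real t) :: 'k ^ 'n"
  have "norm (x $ i) + norm (?h $ i) \<le> \<rho>" for i :: 'n
  proof -
    have "norm (?h $ i) = t" using t by simp
    then show ?thesis using Finite_Cartesian_Product.norm_nth_le[of x i] by (simp add: t_def)
  qed
  then have "(\<lambda>(\<alpha>, \<beta>). a \<alpha> * shift_coeff x \<alpha> \<beta> * mpow ?h \<beta>)
     summable_on UNIV \<times> UNIV" by (rule recenter_pair_summable)
  then have "(\<lambda>(\<beta>, \<alpha>). a \<alpha> * shift_coeff x \<alpha> \<beta> * mpow ?h \<beta>)
     summable_on UNIV \<times> UNIV" by (subst summable_on_swap) (simp add: case_prod_unfold)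
  note Infinite_Sum.abs_summable_on_Sigma_iff[THEN iffD1, OF summable_on_imp_abs_summable[OF this], THEN conjunct1]
  then have "(\<lambda>\<alpha>. norm (case (\<beta>, \<alpha>) of (\<beta>, \<alpha>) \<Rightarrow> a \<alpha> * shift_coeff x \<alpha> \<beta> * mpow ?h \<beta>)) summable_on UNIV"
    by (rule bspec) (rule UNIV_I)
  then have "(\<lambda>\<alpha>. norm (a \<alpha> * shift_coeff x \<alpha> \<beta> * mpow ?h \<beta>)) summable_on UNIV" by simp
  then have "(\<lambda>\<alpha>. a \<alpha> * shift_coeff x \<alpha> \<beta> * mpow ?h \<beta>) summable_on UNIV"
    by (rule abs_summable_summable)
  moreover have "mpow ?h \<beta> \<noteq> 0" using t by simp
  ultimately have "(\<lambda>\<alpha>. a \<alpha> * shift_coeff x \<alpha> \<beta>) summable_on UNIV"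
    by (subst (asm) summable_on_cmult_left') auto
  then show ?thesis unfolding recentered_def by (rule has_sum_infsum)
qed

text \<open>Fubini for the absolutely summable double series: summing over \<open>\<beta>\<close>
  first gives the old expansion at \<open>x + h\<close>, summing over \<open>\<alpha>\<close> first
  gives the new one around \<open>x\<close>.\<close>

lemma recenter:
  assumes "norm x + norm h < \<rho>"
  shows "((\<lambda>\<beta>. recentered a x \<beta> * mpow h \<beta>) has_sum (\<Sum>\<^sub>\<infinity>\<alpha>. a \<alpha> * mpow (x + h) \<alpha>)) UNIV"
proof -
  let ?F = "\<lambda>\<alpha> \<beta>. a \<alpha> * shift_coeff x \<alpha> \<beta> * mpow h \<beta>"
  have le: "norm (x $ i) + norm (h $ i) \<le> \<rho>" for i :: 'n
    using Finite_Cartesian_Product.norm_nth_le[of x i] Finite_Cartesian_Product.norm_nth_le[of h i] assms by linarith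
  then have "(\<lambda>(\<alpha>, \<beta>). ?F \<alpha> \<beta>) summable_on UNIV \<times> UNIV" by (rule recenter_pair_summable)
  then obtain S where S: "((\<lambda>(\<alpha>, \<beta>). ?F \<alpha> \<beta>) has_sum S) (UNIV \<times> UNIV)"
    by (auto simp: summable_on_def)
  have "((\<lambda>\<alpha>. a \<alpha> * mpow (x + h) \<alpha>) has_sum S) UNIV"
  proof (rule has_sum_SigmaD[OF S])
    fix \<alpha>
    show "((\<lambda>\<beta>. case (\<alpha>, \<beta>) of (\<alpha>, \<beta>) \<Rightarrow> ?F \<alpha> \<beta>) has_sum a \<alpha> * mpow (x + h) \<alpha>) UNIV"
      by (rule has_sum_finite_neutralI[OF finite_index_le[of \<alpha>]])
         (auto simp only: mpow_binomial sum_distrib_left mult.assoc prod.case,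
          auto dest: shift_coeff_nonzeroD)
  qed
  then have S_eq: "S = (\<Sum>\<^sub>\<infinity>\<alpha>. a \<alpha> * mpow (x + h) \<alpha>)" by (simp add: infsumI)
  have "((\<lambda>(\<beta>, \<alpha>). ?F \<alpha> \<beta>) has_sum S) (UNIV \<times> UNIV)"
    using S by (subst (asm) has_sum_swap) (simp add: case_prod_unfold)
  then have "((\<lambda>\<beta>. recentered a x \<beta> * mpow h \<beta>) has_sum S) UNIV"
  proof (rule has_sum_SigmaD)
    fix \<beta>
    have "norm x < \<rho>" using assms norm_ge_zero[of h] by linarith
    from has_sum_cmult_left[OF recentered_has_sum[OF this, of \<beta>], of "mpow h \<beta>"]
    show "((\<lambda>\<alpha>. case (\<beta>, \<alpha>) of (\<beta>, \<alpha>) \<Rightarrow> ?F \<alpha> \<beta>) has_sum recentered a x \<beta> * mpow h \<beta>) UNIV"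
      by simp
  qed
  then show ?thesis by (simp add: S_eq)
qed

text \<open>Only multi-indices with positive \<open>i\<close>-th exponent contribute, and these form
  the range of \<open>index_inc i\<close>. Reindexing by it produces the termwise differentiated
  series.\<close>

lemma recentered_unit:
  assumes "norm x < \<rho>"
  shows "((\<lambda>\<gamma>. of_nat (Suc (\<gamma> i)) * a (index_inc i \<gamma>) * mpow x \<gamma>)
     has_sum recentered a x (index_unit i)) UNIV"
proof -
  let ?F = "\<lambda>\<alpha>. a \<alpha> * shift_coeff x \<alpha> (index_unit i)"
  have "(?F has_sum recentered a x (index_unit i)) UNIV"
    by (rule recentered_has_sum[OF assms])
  also have "?this \<longleftrightarrow> (?F has_sum recentered a x (index_unit i)) (range (index_inc i))"
  proof (rule has_sum_cong_neutral)
    fix \<alpha> assume "\<alpha> \<in> UNIV - range (index_inc i)"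
    then have "\<not> (\<forall>j. index_unit i j \<le> \<alpha> j)"
      by (auto simp: range_index_inc index_unit_def)
    then show "?F \<alpha> = 0" by (simp add: shift_coeff_eq_0 del: not_all)
  qed auto
  also have "\<dots> \<longleftrightarrow> (?F \<circ> index_inc i has_sum recentered a x (index_unit i)) UNIV"
    by (rule has_sum_reindex) (rule inj_index_inc)
  also have "?F \<circ> index_inc i = (\<lambda>\<gamma>. of_nat (Suc (\<gamma> i)) * a (index_inc i \<gamma>) * mpow x \<gamma>)"
  proof
    fix \<gamma>
    have "shift_coeff x (index_inc i \<gamma>) (index_unit i)
        = (\<Prod>j\<in>UNIV. (if j = i then of_nat (Suc (\<gamma> i)) else 1) * x $ j ^ \<gamma> j)"
      unfolding shift_coeff_def by (rule prod.cong) (auto simp: index_inc_def index_unit_def)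
    also have "\<dots> = of_nat (Suc (\<gamma> i)) * mpow x \<gamma>"
      by (simp add: prod.distrib)
    finally show "(?F \<circ> index_inc i) \<gamma> = of_nat (Suc (\<gamma> i)) * a (index_inc i \<gamma>) * mpow x \<gamma>"
      by (simp add: mult_ac)
  qed
  finally show ?thesis .
qed

end

section \<open>Sums, local character and order of vanishing\<close>

lemma has_power_series_add:
  assumes "has_power_series f a y" "has_power_series g b y"
  shows "has_power_series (\<lambda>x. f x + g x) (\<lambda>\<alpha>. a \<alpha> + b \<alpha>) y"
proof -
  from assms obtain r s where "r > 0" "s > 0"
    "\<And>h. norm h < r \<Longrightarrow> ((\<lambda>\<alpha>. a \<alpha> * mpow h \<alpha>) has_sum f (y + h)) UNIV"
    "\<And>h. norm h < s \<Longrightarrow> ((\<lambda>\<alpha>. b \<alpha> * mpow h \<alpha>) has_sum g (y + h)) UNIV"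
    unfolding has_power_series_def by blast
  then show ?thesis unfolding has_power_series_def
    by (intro exI[of _ "min r s"]) (auto simp: distrib_right intro!: has_sum_add)
qed

lemma has_power_series_cmult:
  assumes "has_power_series f a y"
  shows "has_power_series (\<lambda>x. c * f x) (\<lambda>\<alpha>. c * a \<alpha>) y"
proof -
  from assms obtain r where "r > 0"
    "\<And>h. norm h < r \<Longrightarrow> ((\<lambda>\<alpha>. a \<alpha> * mpow h \<alpha>) has_sum f (y + h)) UNIV"
    unfolding has_power_series_def by blast
  then show ?thesis unfolding has_power_series_def
    by (intro exI[of _ r]) (auto simp: mult.assoc intro!: has_sum_cmult_right)
qed

lemma has_power_series_diff:
  assumes "has_power_series f a y" "has_power_series g b y"
  shows "has_power_series (\<lambda>x. f x - g x) (\<lambda>\<alpha>. a \<alpha> - b \<alpha>) y"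
  using has_power_series_add[OF assms(1) has_power_series_cmult[OF assms(2), of "-1"]] by simp

lemma has_power_series_cong:
  fixes f g :: "'k::real_normed_field ^ 'n::finite \<Rightarrow> 'k"
  assumes "eventually (\<lambda>x. f x = g x) (nhds y)"
  shows "has_power_series f a y \<longleftrightarrow> has_power_series g a y"
proof -
  have *: "has_power_series g a y" if "has_power_series f a y" "eventually (\<lambda>x. f x = g x) (nhds y)" for f g :: "'k ^ 'n \<Rightarrow> 'k"
  proof -
    from that(1) obtain r where r: "r > 0"
      "\<And>h. norm h < r \<Longrightarrow> ((\<lambda>\<alpha>. a \<alpha> * mpow h \<alpha>) has_sum f (y + h)) UNIV"
      unfolding has_power_series_def by blast
    from that(2) obtain d where d: "d > 0" "\<And>x. dist x y < d \<Longrightarrow> f x = g x"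
      by (auto simp: eventually_nhds_metric)
    have eq: "f (y + h) = g (y + h)" if "norm h < d" for h
      using that by (intro d(2)) (simp add: dist_norm)
    then show ?thesis unfolding has_power_series_def
    proof (intro exI[of _ "min r d"] conjI allI impI)
      fix h :: "'k ^ 'n" assume "norm h < min r d"
      then show "((\<lambda>\<alpha>. a \<alpha> * mpow h \<alpha>) has_sum g (y + h)) UNIV"
        using r(2)[of h] eq[of h] by simp
    qed (use r(1) d(1) in simp)
  qed
  show ?thesis
    using *[of f g] *[of g f] assms by (auto simp: eq_commute)
qed

lemma analytic_at_cong_nhds:
  assumes "eventually (\<lambda>x. f x = g x) (nhds y)"
  shows "analytic_at f y \<longleftrightarrow> analytic_at g y"
  unfolding analytic_at_def using has_power_series_cong[OF assms] by simp

lemma has_power_series_finite: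
  assumes "finite S" "\<And>\<alpha>. \<alpha> \<notin> S \<Longrightarrow> a \<alpha> = 0"
  shows "has_power_series (\<lambda>x. \<Sum>\<alpha>\<in>S. a \<alpha> * mpow (x - y) \<alpha>) a y"
  unfolding has_power_series_def
  by (intro exI[of _ 1] conjI allI impI has_sum_finite_neutralI[OF assms(1)]) (auto simp: assms(2))

lemma has_power_series_value:
  fixes f :: "'k::real_normed_field ^ 'n::finite \<Rightarrow> 'k"
  assumes "has_power_series f a y"
  shows "f y = a (\<lambda>_. 0)"
proof -
  have "((\<lambda>\<alpha>. a \<alpha> * mpow 0 \<alpha>) has_sum f (y + 0)) UNIV"
    using assms unfolding has_power_series_def by (metis norm_zero)
  moreover have "((\<lambda>\<alpha>. a \<alpha> * mpow 0 \<alpha>) has_sum a (\<lambda>_. 0)) UNIV"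
  proof (rule has_sum_finite_neutralI[of "{\<lambda>_. 0}"])
    fix \<alpha> :: "'n \<Rightarrow> nat" assume "\<alpha> \<in> UNIV - {\<lambda>_. 0}"
    then obtain i where "\<alpha> i \<noteq> 0" by (auto simp: fun_eq_iff)
    then have "mpow (0 :: 'k ^ 'n) \<alpha> = 0" by (intro prod_zero) auto
    then show "a \<alpha> * mpow 0 \<alpha> = 0" by simp
  qed auto
  ultimately have "f (y + 0) = a (\<lambda>_. 0)" by (rule has_sum_unique)
  then show ?thesis by simp
qed

lemma has_power_series_recenter:
  fixes f :: "'k::{real_normed_field, euclidean_space} ^ 'n::finite \<Rightarrow> 'k"
  assumes "has_power_series f a y"
  obtains r where "r > 0"
    "\<And>x. norm x < r \<Longrightarrow> has_power_series f (recentered a x) (y + x)"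
    "\<And>x i. norm x < r \<Longrightarrow> ((\<lambda>\<gamma>. of_nat (Suc (\<gamma> i)) * a (index_inc i \<gamma>) * mpow x \<gamma>)
       has_sum recentered a x (index_unit i)) UNIV"
proof -
  from has_power_seriesE[OF assms] obtain \<rho> where \<rho>: "absconv a \<rho>"
    "\<And>h. norm h \<le> \<rho> \<Longrightarrow> ((\<lambda>\<alpha>. a \<alpha> * mpow h \<alpha>) has_sum f (y + h)) UNIV" by blast
  have "\<rho> > 0" using \<rho>(1) by (simp add: absconv_def)
  moreover have "has_power_series f (recentered a x) (y + x)" if x: "norm x < \<rho>" for x
    unfolding has_power_series_def
  proof (intro exI[of _ "\<rho> - norm x"] conjI allI impI)
    fix h :: "'k ^ 'n" assume h: "norm h < \<rho> - norm x"
    have "norm (x + h) \<le> \<rho>" using h norm_triangle_ineq[of x h] by linarith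
    from \<rho>(2)[OF this] have "(\<Sum>\<^sub>\<infinity>\<alpha>. a \<alpha> * mpow (x + h) \<alpha>) = f (y + x + h)"
      by (simp add: infsumI add.assoc)
    with recenter[OF \<rho>(1), of x h] h
    show "((\<lambda>\<alpha>. recentered a x \<alpha> * mpow h \<alpha>) has_sum f (y + x + h)) UNIV" by simp
  qed (use x in simp)
  ultimately show thesis by (rule that) (assumption, rule recentered_unit[OF \<rho>(1)])
qed

lemma analytic_at_eventually:
  fixes f :: "'k::{real_normed_field, euclidean_space} ^ 'n::finite \<Rightarrow> 'k"
  assumes "analytic_at f y"
  shows "eventually (\<lambda>x. analytic_at f x) (nhds y)"
proof -
  from assms obtain a where "has_power_series f a y" by (auto simp: analytic_at_def)
  from has_power_series_recenter[OF this] obtain r where r: "r > 0"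
    "\<And>x. norm x < r \<Longrightarrow> has_power_series f (recentered a x) (y + x)" by metis
  show ?thesis unfolding eventually_nhds_metric
  proof (intro exI[of _ r] conjI allI impI)
    fix x assume "dist x y < r"
    then show "analytic_at f x" using r(2)[of "x - y"] by (auto simp: dist_norm analytic_at_def)
  qed (rule r(1))
qed

text \<open>Each surviving term has degree at least \<open>m\<close>, so for
  \<open>norm h \<le> \<rho>\<close> it carries the factor \<open>(norm h / \<rho>) ^ m\<close>
  against the corresponding term of the majorant at \<open>\<rho>\<close>.\<close>

lemma power_series_order_bound:
  fixes f :: "'k::{real_normed_field, euclidean_space} ^ 'n::finite \<Rightarrow> 'k"
  assumes "has_power_series f a y" "\<And>\<alpha>. mdeg \<alpha> < m \<Longrightarrow> a \<alpha> = 0"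
  obtains C r where "C \<ge> 0" "r > 0" "\<And>h. norm h \<le> r \<Longrightarrow> norm (f (y + h)) \<le> C * norm h ^ m"
proof -
  from has_power_seriesE[OF assms(1)] obtain \<rho> where \<rho>: "absconv a \<rho>"
    "\<And>h. norm h \<le> \<rho> \<Longrightarrow> ((\<lambda>\<alpha>. a \<alpha> * mpow h \<alpha>) has_sum f (y + h)) UNIV" by blast
  have pos: "\<rho> > 0" using \<rho>(1) by (simp add: absconv_def)
  define S where "S = (\<Sum>\<^sub>\<infinity>\<alpha>. norm (a \<alpha>) * \<rho> ^ mdeg \<alpha>)"
  have S: "((\<lambda>\<alpha>. norm (a \<alpha>) * \<rho> ^ mdeg \<alpha>) has_sum S) UNIV"
    using \<rho>(1) by (simp add: absconv_def S_def)
  have bound: "norm (f (y + h)) \<le> S / \<rho> ^ m * norm h ^ m" if h: "norm h \<le> \<rho>" for h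
  proof -
    have "norm (a \<alpha> * mpow h \<alpha>) \<le> norm (a \<alpha>) * \<rho> ^ mdeg \<alpha> * (norm h / \<rho>) ^ m" for \<alpha>
    proof (cases "mdeg \<alpha> < m")
      case False
      then obtain l where l: "mdeg \<alpha> = m + l" by (auto simp: not_less le_iff_add)
      have "norm (mpow h \<alpha>) \<le> norm h ^ mdeg \<alpha>" by (rule norm_mpow_le_norm)
      also have "\<dots> = (norm h / \<rho>) ^ m * \<rho> ^ m * norm h ^ l"
        using pos by (simp add: l power_add power_divide)
      also have "\<dots> \<le> (norm h / \<rho>) ^ m * \<rho> ^ m * \<rho> ^ l"
        using h pos by (intro mult_left_mono power_mono) auto
      finally have "norm (mpow h \<alpha>) \<le> \<rho> ^ mdeg \<alpha> * (norm h / \<rho>) ^ m"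
        by (simp add: l power_add mult_ac)
      then show ?thesis by (simp add: norm_mult mult.assoc mult_left_mono)
    qed (use assms(2) in simp)
    then show ?thesis
      using norm_infsum_le[OF \<rho>(2)[OF h] has_sum_cmult_left[OF S, of "(norm h / \<rho>) ^ m"]]
      by (simp add: power_divide)
  qed
  show thesis
  proof (rule that[of "S / \<rho> ^ m" \<rho>])
    show "S / \<rho> ^ m \<ge> 0" using S pos by (auto intro!: divide_nonneg_nonneg has_sum_nonneg[OF S])
  qed (use pos bound in auto)
qed

section \<open>Termwise differentiation and uniqueness of the coefficients\<close>

lemma has_power_series_has_derivative:
  fixes f :: "'k::{real_normed_field, euclidean_space} ^ 'n::finite \<Rightarrow> 'k"
  assumes "has_power_series f a y"
  shows "(f has_derivative (\<lambda>h. \<Sum>i\<in>UNIV. a (index_unit i) * h $ i)) (at y)"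
proof -
  \<comment> \<open>\<open>S\<close> consists of the multi-indices of degree at most 1. Removing the
    affine part leaves a series of order 2, so \<open>power_series_order_bound\<close> gives a
    quadratic remainder.\<close>
  define S where "S = insert (\<lambda>_. 0) (range (index_unit :: 'n \<Rightarrow> _))"
  define b where "b \<alpha> = (if \<alpha> \<in> S then a \<alpha> else 0)" for \<alpha>
  have mp0: "mpow h (\<lambda>_. 0) = 1" for h :: "'k ^ 'n" by simp
  have mpu: "mpow h (index_unit i) = h $ i" for h :: "'k ^ 'n" and i
    by (simp add: index_unit_def if_distrib cong: if_cong)
  have inj: "inj (index_unit :: 'n \<Rightarrow> _)"
    by (rule injI) (metis index_unit_def zero_neq_one)
  have zero: "(\<lambda>_. 0) \<noteq> index_unit i" for i :: 'n
    by (metis index_unit_def zero_neq_one)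
  have lin: "(\<Sum>\<alpha>\<in>S. b \<alpha> * mpow h \<alpha>) = f y + (\<Sum>i\<in>UNIV. a (index_unit i) * h $ i)" for h :: "'k ^ 'n"
  proof -
    have "(\<Sum>\<alpha>\<in>S. b \<alpha> * mpow h \<alpha>) = b (\<lambda>_. 0) * mpow h (\<lambda>_. 0) + (\<Sum>\<alpha>\<in>range index_unit. b \<alpha> * mpow h \<alpha>)"
      unfolding S_def using zero by (intro sum.insert) auto
    also have "(\<Sum>\<alpha>\<in>range index_unit. b \<alpha> * mpow h \<alpha>) = (\<Sum>i\<in>UNIV. b (index_unit i) * mpow h (index_unit i))"
      by (simp add: sum.reindex[OF inj])
    also have "\<dots> = (\<Sum>i\<in>UNIV. a (index_unit i) * h $ i)"
      unfolding mpu by (simp add: b_def S_def)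
    also have "b (\<lambda>_. 0) * mpow h (\<lambda>_. 0) = f y"
      by (simp add: b_def S_def has_power_series_value[OF assms])
    finally show ?thesis .
  qed
  have ps: "has_power_series (\<lambda>x. f x - (\<Sum>\<alpha>\<in>S. b \<alpha> * mpow (x - y) \<alpha>)) (\<lambda>\<alpha>. a \<alpha> - b \<alpha>) y"
    by (intro has_power_series_diff assms has_power_series_finite) (auto simp: S_def b_def)
  have van: "a \<alpha> - b \<alpha> = 0" if "mdeg \<alpha> < 2" for \<alpha>
    using mdeg_less_2[OF that] by (auto simp: b_def S_def)
  obtain C r where C: "C \<ge> 0" "r > 0"
    "\<And>h. norm h \<le> r \<Longrightarrow> norm (f (y + h) - (\<Sum>\<alpha>\<in>S. b \<alpha> * mpow (y + h - y) \<alpha>)) \<le> C * norm h ^ 2"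
    using power_series_order_bound[OF ps van] by blast
  have bl: "bounded_linear (\<lambda>h::'k^'n. \<Sum>i\<in>UNIV. a (index_unit i) * h $ i)"
    by (intro bounded_linear_sum bounded_linear_mult_right[THEN bounded_linear_compose] bounded_linear_vec_nth)
  show ?thesis unfolding has_derivative_at_alt
  proof (intro conjI allI impI bl)
    fix e :: real assume e: "e > 0"
    define d where "d = min r (e / (C + 1))"
    have d: "d > 0" "d \<le> r" using C(1,2) e by (auto simp: d_def)
    have "C * d \<le> (C + 1) * d" using d(1) by simp
    also have "\<dots> \<le> (C + 1) * (e / (C + 1))"
      using C(1) by (intro mult_left_mono) (auto simp: d_def)
    also have "\<dots> = e" using C(1) by simp
    finally have d3: "C * d \<le> e" .
    show "\<exists>d>0. \<forall>z. norm (z - y) < d \<longrightarrow>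
        norm (f z - f y - (\<Sum>i\<in>UNIV. a (index_unit i) * (z - y) $ i)) \<le> e * norm (z - y)"
    proof (intro exI[of _ d] conjI allI impI d(1))
      fix z assume z: "norm (z - y) < d"
      then have "norm (f z - (f y + (\<Sum>i\<in>UNIV. a (index_unit i) * (z - y) $ i))) \<le> C * norm (z - y) ^ 2"
        using C(3)[of "z - y"] d lin[of "z - y"] by simp
      also have "\<dots> \<le> C * (d * norm (z - y))"
        using z C(1) by (intro mult_left_mono) (auto simp: power2_eq_square intro!: mult_right_mono)
      also have "\<dots> \<le> e * norm (z - y)"
        using mult_right_mono[OF d3, of "norm (z - y)"] by (simp add: mult.assoc)
      finally show "norm (f z - f y - (\<Sum>i\<in>UNIV. a (index_unit i) * (z - y) $ i)) \<le> e * norm (z - y)"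
        by (simp add: diff_diff_eq)
    qed
  qed
qed

lemma has_power_series_imp_partial:
  assumes "has_power_series f a y"
  shows "partial i f y = a (index_unit i)"
proof -
  note d = has_power_series_has_derivative[OF assms]
  have "partial i f y = (\<Sum>j\<in>UNIV. a (index_unit j) * axis i 1 $ j)"
    unfolding partial_def frechet_derivative_at[OF d, symmetric] ..
  also have "\<dots> = (\<Sum>j\<in>UNIV. if j = i then a (index_unit j) else 0)"
    by (rule sum.cong) (auto simp: axis_def)
  finally show ?thesis by simp
qed

lemma analytic_at_has_derivative:
  assumes "analytic_at f y"
  shows "(f has_derivative (\<lambda>h. \<Sum>i\<in>UNIV. partial i f y * h $ i)) (at y)"
proof -
  from assms obtain a where a: "has_power_series f a y" unfolding analytic_at_def by (rule exE)
  show ?thesis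
    unfolding has_power_series_imp_partial[OF a] by (rule has_power_series_has_derivative[OF a])
qed

text \<open>At each nearby point the derivative is a first-order coefficient of the series recentred
  there, and this coefficient is itself a convergent series in the displacement.\<close>

lemma has_power_series_partial:
  fixes f :: "real ^ 'n::finite \<Rightarrow> real"
  assumes "has_power_series f a y"
  shows "has_power_series (partial i f) (\<lambda>\<gamma>. real (Suc (\<gamma> i)) * a (index_inc i \<gamma>)) y"
proof -
  obtain r where r: "r > 0"
    "\<And>x. norm x < r \<Longrightarrow> has_power_series f (recentered a x) (y + x)"
    "\<And>x i. norm x < r \<Longrightarrow> ((\<lambda>\<gamma>. of_nat (Suc (\<gamma> i)) * a (index_inc i \<gamma>) * mpow x \<gamma>)
       has_sum recentered a x (index_unit i)) UNIV"
    using has_power_series_recenter[OF assms] by blast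
  show ?thesis unfolding has_power_series_def
  proof (intro exI[of _ r] conjI allI impI)
    fix h :: "real ^ 'n" assume h: "norm h < r"
    show "((\<lambda>\<gamma>. real (Suc (\<gamma> i)) * a (index_inc i \<gamma>) * mpow h \<gamma>) has_sum partial i f (y + h)) UNIV"
      using r(3)[OF h, of i] has_power_series_imp_partial[OF r(2)[OF h], of i] by simp
  qed (rule r(1))
qed

lemma analytic_at_partial:
  "analytic_at f y \<Longrightarrow> analytic_at (partial i f) y"
  unfolding analytic_at_def using has_power_series_partial by blast

text \<open>Induction on the degree: a coefficient of positive degree is, up to a non-zero factor, a
  coefficient of lower degree of some partial derivative, and that derivative also vanishes near
  \<open>y\<close>.\<close>

lemma power_series_zero:
  fixes f :: "real ^ 'n::finite \<Rightarrow> real"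
  assumes "has_power_series f a y" "eventually (\<lambda>x. f x = 0) (nhds y)"
  shows "a \<alpha> = 0"
  using assms
proof (induction "mdeg \<alpha>" arbitrary: f a \<alpha>)
  case 0
  then show ?case
    using has_power_series_value[OF 0(2)] eventually_nhds_x_imp_x[OF 0(3)] by (simp add: mdeg_eq_0_iff)
next
  case (Suc k)
  then have "\<alpha> \<noteq> (\<lambda>_. 0)" by auto
  then obtain i where "\<alpha> i \<noteq> 0" by (auto simp: fun_eq_iff)
  then obtain \<gamma> where \<gamma>: "\<alpha> = index_inc i \<gamma>" using range_index_inc[of i] by blast
  have z: "has_power_series (\<lambda>x. 0) (\<lambda>\<alpha>. 0) x" for x :: "real ^ 'n"
    using has_power_series_finite[of "{}" "\<lambda>_. 0" x] by simp
  from Suc.prems(2) have "eventually (\<lambda>x. eventually (\<lambda>x. f x = 0) (nhds x)) (nhds y)"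
    by (simp add: eventually_eventually)
  then have "eventually (\<lambda>x. partial i f x = 0) (nhds y)"
  proof (rule eventually_mono)
    fix x assume "eventually (\<lambda>x. f x = 0) (nhds x)"
    then have "has_power_series f (\<lambda>_. 0) x"
      using has_power_series_cong[of f "\<lambda>_. 0" x "\<lambda>_. 0"] z by simp
    then show "partial i f x = 0" by (simp add: has_power_series_imp_partial)
  qed
  with Suc.hyps(1)[OF _ has_power_series_partial[OF Suc.prems(1)], of \<gamma> i] Suc.hyps(2)
  have "real (Suc (\<gamma> i)) * a (index_inc i \<gamma>) = 0" by (simp add: \<gamma>)
  then show ?case by (simp add: \<gamma>)
qed

section \<open>Passage between real and complex variables\<close>

definition cvec :: "real ^ 'n \<Rightarrow> complex ^ 'n" where
  "cvec y = (\<chi> i. complex_of_real (y $ i))"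

lemma norm_cvec [simp]: "norm (cvec (y :: real ^ 'n::finite)) = norm y"
  by (simp add: cvec_def norm_vec_def)

lemma cvec_0 [simp]: "cvec 0 = 0"
  by (simp add: cvec_def vec_eq_iff)

lemma mpow_cvec: "mpow (cvec y) \<alpha> = complex_of_real (mpow y \<alpha>)"
  by (simp add: cvec_def)

lemma power_series_cvec:
  fixes F :: "complex ^ 'n::finite \<Rightarrow> complex"
  assumes "has_power_series F a 0"
  shows "has_power_series (\<lambda>y. Re (F (cvec y))) (\<lambda>\<alpha>. Re (a \<alpha>)) 0"
    and "has_power_series (\<lambda>y. Im (F (cvec y))) (\<lambda>\<alpha>. Im (a \<alpha>)) 0"
proof -
  from assms obtain r where r: "r > 0"
    "\<And>h. norm h < r \<Longrightarrow> ((\<lambda>\<alpha>. a \<alpha> * mpow h \<alpha>) has_sum F (0 + h)) UNIV"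
    unfolding has_power_series_def by blast
  have h: "((\<lambda>\<alpha>. a \<alpha> * complex_of_real (mpow h \<alpha>)) has_sum F (cvec h)) UNIV" if "norm h < r" for h
    using r(2)[of "cvec h"] that by (simp only: norm_cvec mpow_cvec add_0)
  show "has_power_series (\<lambda>y. Re (F (cvec y))) (\<lambda>\<alpha>. Re (a \<alpha>)) 0"
    "has_power_series (\<lambda>y. Im (F (cvec y))) (\<lambda>\<alpha>. Im (a \<alpha>)) 0"
    unfolding has_power_series_def using r(1) has_sum_Re[OF h] has_sum_Im[OF h]
    by (auto intro!: exI[of _ r] simp del: of_real_prod)
qed

text \<open>The real points determine a holomorphic germ: real and imaginary parts of the
  coefficients are the coefficients of two real series that vanish near the origin.\<close>

lemma complex_power_series_zero:
  fixes F :: "complex ^ 'n::finite \<Rightarrow> complex"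
  assumes "has_power_series F a 0" "eventually (\<lambda>y. F (cvec y) = 0) (nhds 0)"
  shows "a = (\<lambda>_. 0)"
proof
  fix \<alpha>
  have "Re (a \<alpha>) = 0"
    by (rule power_series_zero[OF power_series_cvec(1)[OF assms(1)]])
       (use assms(2) in \<open>auto elim: eventually_mono\<close>)
  moreover have "Im (a \<alpha>) = 0"
    by (rule power_series_zero[OF power_series_cvec(2)[OF assms(1)]])
       (use assms(2) in \<open>auto elim: eventually_mono\<close>)
  ultimately show "a \<alpha> = 0" by (simp add: complex_eq_iff)
qed

text \<open>The same coefficients are used with complex variables, since absolute convergence
  depends only on the norms of the components.\<close>

lemma power_series_complexification:
  fixes f :: "real ^ 'n::finite \<Rightarrow> real"
  assumes "has_power_series f a 0"
  obtains F where "has_power_series F (\<lambda>\<alpha>. complex_of_real (a \<alpha>)) 0"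
    "eventually (\<lambda>y. F (cvec y) = of_real (f y)) (nhds 0)"
proof -
  obtain \<rho> where \<rho>: "absconv a \<rho>"
    "\<And>h. norm h \<le> \<rho> \<Longrightarrow> ((\<lambda>\<alpha>. a \<alpha> * mpow h \<alpha>) has_sum f (0 + h)) UNIV"
    using has_power_seriesE[OF assms] by blast
  then have \<rho>': "absconv (\<lambda>\<alpha>. complex_of_real (a \<alpha>)) \<rho>" "\<rho> > 0" by (auto simp: absconv_def)
  define F :: "complex ^ 'n \<Rightarrow> complex" where "F z = (\<Sum>\<^sub>\<infinity>\<alpha>. of_real (a \<alpha>) * mpow z \<alpha>)" for z
  have sum: "((\<lambda>\<alpha>. of_real (a \<alpha>) * mpow z \<alpha>) has_sum F z) UNIV" if "norm z \<le> \<rho>" for z :: "complex ^ 'n"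
    unfolding F_def
    by (intro has_sum_infsum absconv_summable[OF \<rho>'(1)] order.trans[OF Finite_Cartesian_Product.norm_nth_le that])
  show thesis
  proof (rule that[of F])
    show "has_power_series F (\<lambda>\<alpha>. complex_of_real (a \<alpha>)) 0"
      unfolding has_power_series_def using \<rho>' sum by (intro exI[of _ \<rho>]) auto
    show "eventually (\<lambda>y. F (cvec y) = of_real (f y)) (nhds 0)"
      unfolding eventually_nhds_metric
    proof (intro exI[of _ \<rho>] conjI allI impI)
      fix y :: "real ^ 'n" assume "dist y 0 < \<rho>"
      then have y: "norm y \<le> \<rho>" by simp
      have "((\<lambda>\<alpha>. complex_of_real (a \<alpha> * mpow y \<alpha>)) has_sum of_real (f y)) UNIV"
        using \<rho>(2)[OF y] by (intro has_sum_of_real) simp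
      moreover have "((\<lambda>\<alpha>. complex_of_real (a \<alpha> * mpow y \<alpha>)) has_sum F (cvec y)) UNIV"
        using sum[of "cvec y"] y by (simp only: norm_cvec mpow_cvec of_real_mult)
      ultimately show "F (cvec y) = of_real (f y)" using has_sum_unique by blast
    qed (rule \<rho>'(2))
  qed
qed

section \<open>Products and reciprocals\<close>

definition cauchy_prod ::
  "(('n \<Rightarrow> nat) \<Rightarrow> 'k) \<Rightarrow> (('n \<Rightarrow> nat) \<Rightarrow> 'k) \<Rightarrow> ('n::finite \<Rightarrow> nat) \<Rightarrow> 'k::comm_ring_1" where
  "cauchy_prod a b \<alpha> = (\<Sum>\<beta>\<in>{\<beta>. \<forall>i. \<beta> i \<le> \<alpha> i}. a \<beta> * b (\<lambda>i. \<alpha> i - \<beta> i))"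

lemma mdeg_split:
  assumes "\<forall>i. \<beta> i \<le> \<alpha> i" shows "mdeg \<alpha> = mdeg \<beta> + mdeg (\<lambda>i. \<alpha> i - \<beta> i)"
  using assms by (simp add: mdeg_def sum.distrib[symmetric])

lemma mpow_split:
  assumes "\<forall>i. \<beta> i \<le> \<alpha> i" shows "mpow h \<alpha> = mpow h \<beta> * mpow h (\<lambda>i. \<alpha> i - \<beta> i)"
  using assms by (simp add: prod.distrib[symmetric] power_add[symmetric])

lemma bij_index_pairs:
  "bij_betw (\<lambda>(\<alpha>, \<beta>). (\<beta>, \<lambda>i. \<alpha> i - \<beta> i)) (SIGMA \<alpha>:UNIV. {\<beta>::'n \<Rightarrow> nat. \<forall>i. \<beta> i \<le> \<alpha> i}) UNIV"
  by (rule bij_betw_byWitness[where f' = "\<lambda>(\<beta>, \<gamma>). (\<lambda>i. \<beta> i + \<gamma> i, \<beta>)"]) (auto simp: fun_eq_iff)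

lemma cauchy_prod_has_sum:
  fixes a b :: "('n::finite \<Rightarrow> nat) \<Rightarrow> 'k::{real_normed_field, euclidean_space}"
  assumes "((\<lambda>\<alpha>. a \<alpha> * mpow h \<alpha>) has_sum A) UNIV" "((\<lambda>\<alpha>. b \<alpha> * mpow h \<alpha>) has_sum B) UNIV"
  shows "((\<lambda>\<alpha>. cauchy_prod a b \<alpha> * mpow h \<alpha>) has_sum A * B) UNIV"
proof -
  let ?F = "\<lambda>(\<beta>, \<gamma>). (a \<beta> * mpow h \<beta>) * (b \<gamma> * mpow h \<gamma>)"
  have abs: "(\<lambda>\<alpha>. norm (a \<alpha> * mpow h \<alpha>)) summable_on UNIV" "(\<lambda>\<alpha>. norm (b \<alpha> * mpow h \<alpha>)) summable_on UNIV"
    using assms by (auto intro!: summable_on_imp_abs_summable dest: has_sum_imp_summable)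
  have "(\<lambda>p. norm (?F p)) summable_on UNIV \<times> UNIV"
  proof (rule summable_on_SigmaI)
    fix \<beta>
    show "((\<lambda>\<gamma>. norm (?F (\<beta>, \<gamma>))) has_sum norm (a \<beta> * mpow h \<beta>) * (\<Sum>\<^sub>\<infinity>\<gamma>. norm (b \<gamma> * mpow h \<gamma>))) UNIV"
      using has_sum_cmult_right[OF has_sum_infsum[OF abs(2)], of "norm (a \<beta> * mpow h \<beta>)"]
      by (simp add: norm_mult)
  next
    show "(\<lambda>\<beta>. norm (a \<beta> * mpow h \<beta>) * (\<Sum>\<^sub>\<infinity>\<gamma>. norm (b \<gamma> * mpow h \<gamma>))) summable_on UNIV"
      by (rule summable_on_cmult_left[OF abs(1)])
  qed auto
  then have "?F summable_on UNIV \<times> UNIV" by (rule abs_summable_summable)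
  then have F: "(?F has_sum A * B) (UNIV \<times> UNIV)"
  proof (rule has_sum_SigmaI[rotated 2])
    show "((\<lambda>\<gamma>. ?F (\<beta>, \<gamma>)) has_sum (a \<beta> * mpow h \<beta>) * B) UNIV" for \<beta>
      using has_sum_cmult_right[OF assms(2), of "a \<beta> * mpow h \<beta>"] by simp
    show "((\<lambda>\<beta>. (a \<beta> * mpow h \<beta>) * B) has_sum A * B) UNIV"
      by (rule has_sum_cmult_left[OF assms(1)])
  qed
  then have "((\<lambda>p. ?F ((\<lambda>(\<alpha>, \<beta>). (\<beta>, \<lambda>i. \<alpha> i - \<beta> i)) p)) has_sum A * B)
      (SIGMA \<alpha>:UNIV. {\<beta>. \<forall>i. \<beta> i \<le> \<alpha> i})"
    by (subst has_sum_reindex_bij_betw[OF bij_index_pairs]) (simp only: UNIV_Times_UNIV)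
  then show ?thesis
  proof (rule has_sum_SigmaD)
    fix \<alpha> :: "'n \<Rightarrow> nat"
    show "((\<lambda>\<beta>. ?F ((\<lambda>(\<alpha>, \<beta>). (\<beta>, \<lambda>i. \<alpha> i - \<beta> i)) (\<alpha>, \<beta>))) has_sum cauchy_prod a b \<alpha> * mpow h \<alpha>)
        {\<beta>. \<forall>i. \<beta> i \<le> \<alpha> i}"
    proof (rule has_sum_finiteI[OF finite_index_le])
      show "cauchy_prod a b \<alpha> * mpow h \<alpha> = (\<Sum>\<beta>\<in>{\<beta>. \<forall>i. \<beta> i \<le> \<alpha> i}.
          ?F ((\<lambda>(\<alpha>, \<beta>). (\<beta>, \<lambda>i. \<alpha> i - \<beta> i)) (\<alpha>, \<beta>)))"
        unfolding cauchy_prod_def sum_distrib_right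
      proof (rule sum.cong[OF refl])
        fix \<beta> assume "\<beta> \<in> {\<beta>. \<forall>i. \<beta> i \<le> \<alpha> i}"
        then have "mpow h \<alpha> = mpow h \<beta> * mpow h (\<lambda>i. \<alpha> i - \<beta> i)" by (intro mpow_split) auto
        then show "a \<beta> * b (\<lambda>i. \<alpha> i - \<beta> i) * mpow h \<alpha> = ?F ((\<lambda>(\<alpha>, \<beta>). (\<beta>, \<lambda>i. \<alpha> i - \<beta> i)) (\<alpha>, \<beta>))"
          by (simp only: prod.case mult_ac)
      qed
    qed
  qed
qed

lemma has_power_series_mult:
  fixes f g :: "'k::{real_normed_field, euclidean_space} ^ 'n::finite \<Rightarrow> 'k"
  assumes "has_power_series f a y" "has_power_series g b y"
  shows "has_power_series (\<lambda>x. f x * g x) (cauchy_prod a b) y"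
proof -
  from assms obtain r s where "r > 0" "s > 0"
    "\<And>h. norm h < r \<Longrightarrow> ((\<lambda>\<alpha>. a \<alpha> * mpow h \<alpha>) has_sum f (y + h)) UNIV"
    "\<And>h. norm h < s \<Longrightarrow> ((\<lambda>\<alpha>. b \<alpha> * mpow h \<alpha>) has_sum g (y + h)) UNIV"
    unfolding has_power_series_def by blast
  then show ?thesis unfolding has_power_series_def
    by (intro exI[of _ "min r s"]) (auto intro!: cauchy_prod_has_sum)
qed

lemma cauchy_prod_order:
  assumes "\<And>\<alpha>. mdeg \<alpha> < m \<Longrightarrow> a \<alpha> = 0" "\<And>\<alpha>. mdeg \<alpha> < l \<Longrightarrow> b \<alpha> = 0" "mdeg \<alpha> < m + l"
  shows "cauchy_prod a b \<alpha> = 0"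
  unfolding cauchy_prod_def
proof (rule sum.neutral, rule ballI)
  fix \<beta> assume "\<beta> \<in> {\<beta>. \<forall>i. \<beta> i \<le> \<alpha> i}"
  then have "mdeg \<alpha> = mdeg \<beta> + mdeg (\<lambda>i. \<alpha> i - \<beta> i)" by (intro mdeg_split) simp
  with assms(3) have "mdeg \<beta> < m \<or> mdeg (\<lambda>i. \<alpha> i - \<beta> i) < l" by linarith
  then show "a \<beta> * b (\<lambda>i. \<alpha> i - \<beta> i) = 0" using assms(1,2) by auto
qed

text \<open>The coefficients of \<open>1 / (1 - c)\<close> for a series \<open>c\<close> without
  constant term, obtained from the equation \<open>b = 1 + c * b\<close> by recursion on the
  degree.\<close>

function geom_coeff :: "(('n::finite \<Rightarrow> nat) \<Rightarrow> real) \<Rightarrow> ('n \<Rightarrow> nat) \<Rightarrow> real" where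
  "geom_coeff c \<alpha> = (if \<alpha> = (\<lambda>_. 0) then 1
     else \<Sum>\<beta>\<in>{\<beta>. \<forall>i. \<beta> i \<le> \<alpha> i} - {\<lambda>_. 0}. c \<beta> * geom_coeff c (\<lambda>i. \<alpha> i - \<beta> i))"
  by pat_completeness auto
termination
proof (relation "Wellfounded.measure (\<lambda>(c, \<alpha>). mdeg \<alpha>)")
  fix c :: "('n::finite \<Rightarrow> nat) \<Rightarrow> real" and \<alpha> \<beta> :: "'n \<Rightarrow> nat"
  assume "\<beta> \<in> {\<beta>. \<forall>i. \<beta> i \<le> \<alpha> i} - {\<lambda>_. 0}"
  then have "mdeg \<alpha> = mdeg \<beta> + mdeg (\<lambda>i. \<alpha> i - \<beta> i)" "mdeg \<beta> \<noteq> 0"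
    by (auto intro!: mdeg_split simp: mdeg_eq_0_iff)
  then show "((c, \<lambda>i. \<alpha> i - \<beta> i), (c, \<alpha>)) \<in> Wellfounded.measure (\<lambda>(c, \<alpha>). mdeg \<alpha>)" by simp
qed simp

declare geom_coeff.simps [simp del]

lemma geom_coeff_rec:
  assumes "\<alpha> \<noteq> (\<lambda>_. 0)"
  shows "geom_coeff c \<alpha> = (\<Sum>\<beta>\<in>{\<beta>. \<forall>i. \<beta> i \<le> \<alpha> i} - {\<lambda>_. 0}. c \<beta> * geom_coeff c (\<lambda>i. \<alpha> i - \<beta> i))"
  using geom_coeff.simps[of c \<alpha>] by (simp only: assms if_False)

text \<open>Writing \<open>B N\<close> for the left-hand side, the equation
  \<open>b = 1 + c * b\<close> gives \<open>B (Suc N) \<le> 1 + S * B N\<close>, and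
  \<open>S \<le> 1/2\<close> keeps this below 2.\<close>

lemma geom_coeff_bound:
  assumes c: "((\<lambda>\<alpha>. norm (c \<alpha>) * \<rho> ^ mdeg \<alpha>) has_sum S) UNIV" "S \<le> 1/2" "\<rho> > 0"
  shows "(\<Sum>\<alpha>\<in>{\<alpha>::'n::finite \<Rightarrow> nat. mdeg \<alpha> \<le> N}. norm (geom_coeff c \<alpha>) * \<rho> ^ mdeg \<alpha>) \<le> 2"
proof (induction N)
  case 0
  have "{\<alpha>::'n \<Rightarrow> nat. mdeg \<alpha> \<le> 0} = {\<lambda>_. 0}" by (auto simp: mdeg_eq_0_iff)
  then show ?case by (simp add: geom_coeff.simps[of c "\<lambda>_. 0"])
next
  case (Suc N)
  let ?b = "\<lambda>\<alpha>. norm (geom_coeff c \<alpha>) * \<rho> ^ mdeg \<alpha>" and ?c = "\<lambda>\<alpha>. norm (c \<alpha>) * \<rho> ^ mdeg \<alpha>"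
  let ?M = "\<lambda>N. {\<alpha>::'n \<Rightarrow> nat. mdeg \<alpha> \<le> N}"
  let ?D = "\<lambda>\<alpha>. {\<beta>::'n \<Rightarrow> nat. \<forall>i. \<beta> i \<le> \<alpha> i} - {\<lambda>_. 0}"
  have le: "?b \<alpha> \<le> (\<Sum>\<beta>\<in>?D \<alpha>. ?c \<beta> * ?b (\<lambda>i. \<alpha> i - \<beta> i))" if "\<alpha> \<noteq> (\<lambda>_. 0)" for \<alpha>
  proof -
    have "?b \<alpha> \<le> (\<Sum>\<beta>\<in>?D \<alpha>. norm (c \<beta> * geom_coeff c (\<lambda>i. \<alpha> i - \<beta> i))) * \<rho> ^ mdeg \<alpha>"
      unfolding geom_coeff_rec[OF that] using c(3) by (intro mult_right_mono norm_sum) simp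
    also have "\<dots> = (\<Sum>\<beta>\<in>?D \<alpha>. ?c \<beta> * ?b (\<lambda>i. \<alpha> i - \<beta> i))"
      unfolding sum_distrib_right
    proof (rule sum.cong[OF refl])
      fix \<beta> assume "\<beta> \<in> ?D \<alpha>"
      then have "mdeg \<alpha> = mdeg \<beta> + mdeg (\<lambda>i. \<alpha> i - \<beta> i)" by (intro mdeg_split) auto
      then have "\<rho> ^ mdeg \<alpha> = \<rho> ^ mdeg \<beta> * \<rho> ^ mdeg (\<lambda>i. \<alpha> i - \<beta> i)" by (simp add: power_add)
      then show "norm (c \<beta> * geom_coeff c (\<lambda>i. \<alpha> i - \<beta> i)) * \<rho> ^ mdeg \<alpha> = ?c \<beta> * ?b (\<lambda>i. \<alpha> i - \<beta> i)"
        by (simp only: norm_mult mult_ac)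
    qed
    finally show ?thesis .
  qed
  have "(\<Sum>\<alpha>\<in>?M (Suc N). ?b \<alpha>) = ?b (\<lambda>_. 0) + (\<Sum>\<alpha>\<in>?M (Suc N) - {\<lambda>_. 0}. ?b \<alpha>)"
    by (rule sum.remove[OF finite_mdeg_le]) simp
  moreover have "?b (\<lambda>_. 0) = 1" by (simp add: geom_coeff.simps[of c "\<lambda>_. 0"])
  moreover have "(\<Sum>\<alpha>\<in>?M (Suc N) - {\<lambda>_. 0}. ?b \<alpha>) \<le> 1"
  proof -
  have "(\<Sum>\<alpha>\<in>?M (Suc N) - {\<lambda>_. 0}. ?b \<alpha>)
      \<le> (\<Sum>\<alpha>\<in>?M (Suc N) - {\<lambda>_. 0}. \<Sum>\<beta>\<in>?D \<alpha>. ?c \<beta> * ?b (\<lambda>i. \<alpha> i - \<beta> i))"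
    by (intro sum_mono le) auto
  also have "\<dots> = (\<Sum>(\<alpha>, \<beta>)\<in>(SIGMA \<alpha>:?M (Suc N) - {\<lambda>_. 0}. ?D \<alpha>). ?c \<beta> * ?b (\<lambda>i. \<alpha> i - \<beta> i))"
    by (rule sum.Sigma) (intro ballI finite_Diff finite_mdeg_le finite_index_le)+
  \<comment> \<open>The pair \<open>(\<alpha>, \<beta>)\<close> is matched with
    \<open>(\<beta>, \<alpha> - \<beta>)\<close>. As \<open>\<beta>\<close> is non-zero, the second
    index has degree at most \<open>N\<close>, where the induction hypothesis applies.\<close>
  also have "\<dots> \<le> (\<Sum>(\<beta>, \<gamma>)\<in>?M (Suc N) \<times> ?M N. ?c \<beta> * ?b \<gamma>)"
  proof (rule sum_le_included)
    show "\<forall>p\<in>(SIGMA \<alpha>:?M (Suc N) - {\<lambda>_. 0}. ?D \<alpha>). \<exists>q\<in>?M (Suc N) \<times> ?M N.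
        (\<lambda>(\<beta>, \<gamma>). (\<lambda>i. \<beta> i + \<gamma> i, \<beta>)) q = p \<and>
        (case p of (\<alpha>, \<beta>) \<Rightarrow> ?c \<beta> * ?b (\<lambda>i. \<alpha> i - \<beta> i)) \<le> (case q of (\<beta>, \<gamma>) \<Rightarrow> ?c \<beta> * ?b \<gamma>)"
    proof (rule ballI)
      fix p assume "p \<in> (SIGMA \<alpha>:?M (Suc N) - {\<lambda>_. 0}. ?D \<alpha>)"
      then obtain \<alpha> \<beta> where p: "p = (\<alpha>, \<beta>)"
        and *: "mdeg \<alpha> \<le> Suc N" "\<forall>i. \<beta> i \<le> \<alpha> i" "\<beta> \<noteq> (\<lambda>_. 0)" by auto
      then have "mdeg \<alpha> = mdeg \<beta> + mdeg (\<lambda>i. \<alpha> i - \<beta> i)" "mdeg \<beta> \<noteq> 0"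
        by (auto intro!: mdeg_split simp: mdeg_eq_0_iff)
      with * have m: "mdeg \<beta> \<le> Suc N" "mdeg (\<lambda>i. \<alpha> i - \<beta> i) \<le> N" by linarith+
      show "\<exists>q\<in>?M (Suc N) \<times> ?M N. (\<lambda>(\<beta>, \<gamma>). (\<lambda>i. \<beta> i + \<gamma> i, \<beta>)) q = p \<and>
        (case p of (\<alpha>, \<beta>) \<Rightarrow> ?c \<beta> * ?b (\<lambda>i. \<alpha> i - \<beta> i)) \<le> (case q of (\<beta>, \<gamma>) \<Rightarrow> ?c \<beta> * ?b \<gamma>)"
        unfolding p using m *(2) by (intro bexI[of _ "(\<beta>, \<lambda>i. \<alpha> i - \<beta> i)"]) auto
    qed
    show "finite (SIGMA \<alpha>:?M (Suc N) - {\<lambda>_. 0}. ?D \<alpha>)" "finite (?M (Suc N) \<times> ?M N)"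
      by (intro finite_SigmaI finite_Diff finite_mdeg_le finite_index_le)+
    show "\<forall>q\<in>?M (Suc N) \<times> ?M N. 0 \<le> (case q of (\<beta>, \<gamma>) \<Rightarrow> ?c \<beta> * ?b \<gamma>)"
      using c(3) by (auto intro!: mult_nonneg_nonneg)
  qed
  also have "\<dots> = (\<Sum>\<beta>\<in>?M (Suc N). ?c \<beta>) * (\<Sum>\<gamma>\<in>?M N. ?b \<gamma>)"
    by (simp add: sum_product sum.cartesian_product)
  also have "\<dots> \<le> (1/2) * 2"
  proof (rule mult_mono[OF _ Suc.IH])
    have "(\<Sum>\<beta>\<in>?M (Suc N). ?c \<beta>) \<le> S"
      by (rule finite_sum_le_has_sum[OF c(1) finite_mdeg_le]) (use c(3) in auto)
    with c(2) show "(\<Sum>\<beta>\<in>?M (Suc N). ?c \<beta>) \<le> 1/2" by simp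
  qed (use c(3) in \<open>auto intro!: sum_nonneg\<close>)
  finally show ?thesis by simp
  qed
  ultimately show ?case by simp
qed

lemma analytic_at_inverse:
  fixes f :: "real ^ 'n::finite \<Rightarrow> real"
  assumes "analytic_at f y" "f y \<noteq> 0"
  shows "analytic_at (\<lambda>x. inverse (f x)) y"
proof -
  obtain a where a: "has_power_series f a y" using assms(1) by (auto simp: analytic_at_def)
  obtain \<rho>0 where \<rho>0: "absconv a \<rho>0"
    "\<And>h. norm h \<le> \<rho>0 \<Longrightarrow> ((\<lambda>\<alpha>. a \<alpha> * mpow h \<alpha>) has_sum f (y + h)) UNIV"
    using has_power_seriesE[OF a] by blast
  define a0 where "a0 = a (\<lambda>_. 0)"
  have a0: "a0 \<noteq> 0" using assms(2) by (simp add: a0_def has_power_series_value[OF a])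
  \<comment> \<open>Normalised so that the series of \<open>f\<close> is \<open>a0\<close> times
    \<open>1 - c\<close>, with \<open>c\<close> free of a constant term.\<close>
  define c where "c \<alpha> = (if \<alpha> = (\<lambda>_. 0) then 0 else - a \<alpha> / a0)" for \<alpha>
  have pos: "\<rho>0 > 0" using \<rho>0(1) by (simp add: absconv_def)
  have "(\<lambda>\<alpha>. norm (a \<alpha>) * \<rho>0 ^ mdeg \<alpha> / \<bar>a0\<bar>) summable_on UNIV"
    using summable_on_cmult_left[of "\<lambda>\<alpha>. norm (a \<alpha>) * \<rho>0 ^ mdeg \<alpha>" UNIV "1 / \<bar>a0\<bar>"] \<rho>0(1)
    by (simp add: absconv_def)
  then have "(\<lambda>\<alpha>. norm (c \<alpha>) * \<rho>0 ^ mdeg \<alpha>) summable_on UNIV"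
    by (rule summable_on_comparison_test) (use pos in \<open>auto simp: c_def\<close>)
  then obtain S0 where S0: "((\<lambda>\<alpha>. norm (c \<alpha>) * \<rho>0 ^ mdeg \<alpha>) has_sum S0) UNIV"
    by (auto simp: summable_on_def)
  have S0_nonneg: "S0 \<ge> 0" by (rule has_sum_nonneg[OF S0]) (use pos in auto)
  \<comment> \<open>All terms of \<open>c\<close> have degree at least 1, so scaling the radius by
    \<open>t \<le> 1\<close> scales their sum by at most \<open>t\<close>. This \<open>t\<close>
    brings it down to 1/2, as \<open>geom_coeff_bound\<close> requires.\<close>
  define t where "t = 1 / (2 * S0 + 2)"
  have t: "t > 0" "t \<le> 1" "S0 * t \<le> 1/2" using S0_nonneg by (auto simp: t_def field_simps)
  define \<rho> where "\<rho> = \<rho>0 * t"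
  have \<rho>: "\<rho> > 0" "\<rho> \<le> \<rho>0" using pos t by (auto simp: \<rho>_def)
  have cle: "norm (c \<alpha>) * \<rho> ^ mdeg \<alpha> \<le> norm (c \<alpha>) * \<rho>0 ^ mdeg \<alpha> * t" for \<alpha>
  proof (cases "\<alpha> = (\<lambda>_. 0)")
    case False
    then have "mdeg \<alpha> \<noteq> 0" by (simp add: mdeg_eq_0_iff)
    then have "t ^ mdeg \<alpha> \<le> t ^ 1" using t by (intro power_decreasing) auto
    then have "norm (c \<alpha>) * \<rho>0 ^ mdeg \<alpha> * t ^ mdeg \<alpha> \<le> norm (c \<alpha>) * \<rho>0 ^ mdeg \<alpha> * t"
      using pos by (intro mult_left_mono) auto
    then show ?thesis by (simp add: \<rho>_def power_mult_distrib mult.assoc)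
  qed (simp add: c_def)
  have "(\<lambda>\<alpha>. norm (c \<alpha>) * \<rho> ^ mdeg \<alpha>) summable_on UNIV"
    using has_sum_imp_summable[OF has_sum_cmult_left[OF S0, of t]]
    by (rule summable_on_comparison_test) (use cle \<rho>(1) in auto)
  then obtain S where S: "((\<lambda>\<alpha>. norm (c \<alpha>) * \<rho> ^ mdeg \<alpha>) has_sum S) UNIV"
    by (auto simp: summable_on_def)
  have "S \<le> S0 * t" by (rule has_sum_mono[OF S has_sum_cmult_left[OF S0]]) (use cle in auto)
  with t(3) have "S \<le> 1/2" by simp
  note bound = geom_coeff_bound[OF S this \<rho>(1)]
  define b where "b = geom_coeff c"
  have "absconv b \<rho>"
    unfolding absconv_def
  proof (intro conjI \<rho>(1) nonneg_bdd_above_summable_on bdd_aboveI2[where M = 2])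
    fix F assume F: "F \<in> {F. F \<subseteq> UNIV \<and> finite (F :: ('n \<Rightarrow> nat) set)}"
    define N where "N = Max (insert 0 (mdeg ` F))"
    have "F \<subseteq> {\<alpha>. mdeg \<alpha> \<le> N}" using F by (auto simp: N_def)
    then have "(\<Sum>\<alpha>\<in>F. norm (b \<alpha>) * \<rho> ^ mdeg \<alpha>) \<le> (\<Sum>\<alpha>\<in>{\<alpha>. mdeg \<alpha> \<le> N}. norm (b \<alpha>) * \<rho> ^ mdeg \<alpha>)"
      by (intro sum_mono2 finite_mdeg_le) (use \<rho>(1) in auto)
    also have "\<dots> \<le> 2" using bound by (simp add: b_def)
    finally show "(\<Sum>\<alpha>\<in>F. norm (b \<alpha>) * \<rho> ^ mdeg \<alpha>) \<le> 2" .
  qed (use \<rho>(1) in auto)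
  note bsum = absconv_summable[OF this order.trans[OF Finite_Cartesian_Product.norm_nth_le]]
  \<comment> \<open>In positive degree the recursion of \<open>geom_coeff\<close> says exactly that
    the term with \<open>\<beta> = 0\<close> cancels the other terms of the Cauchy product.\<close>
  have prod: "cauchy_prod a b \<alpha> = (if \<alpha> = (\<lambda>_. 0) then a0 else 0)" for \<alpha>
  proof (cases "\<alpha> = (\<lambda>_. 0)")
    case True
    have "{\<beta>. \<forall>i::'n. \<beta> i \<le> (0::nat)} = {\<lambda>_. 0}" by auto
    then show ?thesis using True
      by (simp add: cauchy_prod_def b_def geom_coeff.simps[of c "\<lambda>_. 0"] a0_def)
  next
    case False
    have "cauchy_prod a b \<alpha> = a0 * b \<alpha> + (\<Sum>\<beta>\<in>{\<beta>. \<forall>i. \<beta> i \<le> \<alpha> i} - {\<lambda>_. 0}. a \<beta> * b (\<lambda>i. \<alpha> i - \<beta> i))"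
      unfolding cauchy_prod_def
      by (subst sum.remove[OF finite_index_le, of "\<lambda>_. 0"]) (auto simp: a0_def)
    also have "b \<alpha> = (\<Sum>\<beta>\<in>{\<beta>. \<forall>i. \<beta> i \<le> \<alpha> i} - {\<lambda>_. 0}. c \<beta> * b (\<lambda>i. \<alpha> i - \<beta> i))"
      unfolding b_def by (rule geom_coeff_rec[OF False])
    also have "a0 * \<dots> = - (\<Sum>\<beta>\<in>{\<beta>. \<forall>i. \<beta> i \<le> \<alpha> i} - {\<lambda>_. 0}. a \<beta> * b (\<lambda>i. \<alpha> i - \<beta> i))"
      unfolding sum_distrib_left sum_negf[symmetric] using a0 by (intro sum.cong) (auto simp: c_def)
    finally show ?thesis using False by simp
  qed
  have "has_power_series (\<lambda>x. inverse (f x)) (\<lambda>\<alpha>. inverse a0 * b \<alpha>) y"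
    unfolding has_power_series_def
  proof (intro exI[of _ \<rho>] conjI allI impI \<rho>(1))
    fix h :: "real ^ 'n" assume h: "norm h < \<rho>"
    define B where "B = (\<Sum>\<^sub>\<infinity>\<alpha>. b \<alpha> * mpow h \<alpha>)"
    have B: "((\<lambda>\<alpha>. b \<alpha> * mpow h \<alpha>) has_sum B) UNIV"
      unfolding B_def by (rule has_sum_infsum[OF bsum]) (use h in simp)
    have "((\<lambda>\<alpha>. cauchy_prod a b \<alpha> * mpow h \<alpha>) has_sum f (y + h) * B) UNIV"
      by (rule cauchy_prod_has_sum[OF \<rho>0(2) B]) (use h \<rho> in simp)
    moreover have "((\<lambda>\<alpha>. cauchy_prod a b \<alpha> * mpow h \<alpha>) has_sum a0) UNIV"
      by (rule has_sum_finite_neutralI[of "{\<lambda>_. 0}"]) (auto simp: prod)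
    ultimately have "f (y + h) * B = a0" by (rule has_sum_unique)
    with a0 have "inverse (f (y + h)) = inverse a0 * B" by (auto simp: field_simps)
    then show "((\<lambda>\<alpha>. inverse a0 * b \<alpha> * mpow h \<alpha>) has_sum inverse (f (y + h))) UNIV"
      using has_sum_cmult_right[OF B, of "inverse a0"] by (simp add: mult.assoc)
  qed
  then show ?thesis by (auto simp: analytic_at_def)
qed

section \<open>Closure properties of analytic functions\<close>

lemma analytic_at_const [intro]: "analytic_at (\<lambda>x. c) y"
proof -
  have "has_power_series (\<lambda>x. \<Sum>\<alpha>\<in>{\<lambda>_. 0}. c * mpow (x - y) \<alpha>) (\<lambda>\<alpha>. if \<alpha> = (\<lambda>_. 0) then c else 0) y"
    using has_power_series_finite[of "{\<lambda>_. 0}" "\<lambda>\<alpha>. if \<alpha> = (\<lambda>_. 0) then c else 0" y] by simp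
  then show ?thesis by (auto simp: analytic_at_def)
qed

lemma analytic_at_add: "analytic_at f y \<Longrightarrow> analytic_at g y \<Longrightarrow> analytic_at (\<lambda>x. f x + g x) y"
  unfolding analytic_at_def by (elim exE) (rule exI, rule has_power_series_add)

lemma analytic_at_mult:
  fixes f g :: "'k::{real_normed_field, euclidean_space} ^ 'n::finite \<Rightarrow> 'k"
  shows "analytic_at f y \<Longrightarrow> analytic_at g y \<Longrightarrow> analytic_at (\<lambda>x. f x * g x) y"
  unfolding analytic_at_def by (elim exE) (rule exI, rule has_power_series_mult)

lemma analytic_at_power:
  fixes f :: "'k::{real_normed_field, euclidean_space} ^ 'n::finite \<Rightarrow> 'k"
  shows "analytic_at f y \<Longrightarrow> analytic_at (\<lambda>x. f x ^ m) y"
  by (induction m) (auto intro: analytic_at_mult)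

lemma analytic_at_sum:
  assumes "finite S" "\<And>s. s \<in> S \<Longrightarrow> analytic_at (f s) y"
  shows "analytic_at (\<lambda>x. \<Sum>s\<in>S. f s x) y"
  using assms by (induction S rule: finite_induct) (auto intro: analytic_at_add)

lemma analytic_at_nth:
  "analytic_at (\<lambda>x :: 'k::{real_normed_field, euclidean_space} ^ 'n::finite. x $ i) y"
proof -
  have "has_power_series (\<lambda>x. \<Sum>\<alpha>\<in>{index_unit i}. 1 * mpow (x - y) \<alpha>) (\<lambda>\<alpha>. if \<alpha> = index_unit i then 1 else 0) y"
    using has_power_series_finite[of "{index_unit i}" "\<lambda>\<alpha>. if \<alpha> = index_unit i then 1 else 0" y] by simp
  then have "analytic_at (\<lambda>x. (\<Sum>\<alpha>\<in>{index_unit i}. 1 * mpow (x - y) \<alpha>) + y $ i) y"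
    by (intro analytic_at_add analytic_at_const) (unfold analytic_at_def, rule exI)
  moreover have "(\<Sum>\<alpha>\<in>{index_unit i}. 1 * mpow (x - y) \<alpha>) + y $ i = x $ i" for x
    by (simp add: index_unit_def if_distrib[of "power _"] cong: if_cong)
  ultimately show ?thesis by simp
qed

lemma analytic_at_isCont:
  fixes f :: "'k::{real_normed_field, euclidean_space} ^ 'n::finite \<Rightarrow> 'k"
  assumes "analytic_at f y" shows "isCont f y"
proof -
  obtain a where a: "has_power_series f a y" using assms by (auto simp: analytic_at_def)
  from has_derivative_continuous[OF has_power_series_has_derivative[OF a]] show ?thesis .
qed

section \<open>Homogeneous parts\<close>

definition hpart :: "(('n::finite \<Rightarrow> nat) \<Rightarrow> 'k) \<Rightarrow> nat \<Rightarrow> 'k ^ 'n \<Rightarrow> 'k::real_normed_field" where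
  "hpart a k x = (\<Sum>\<alpha>\<in>{\<alpha>. mdeg \<alpha> = k}. a \<alpha> * mpow x \<alpha>)"

lemma analytic_at_prod:
  fixes f :: "'s \<Rightarrow> 'k::{real_normed_field, euclidean_space} ^ 'n::finite \<Rightarrow> 'k"
  assumes "finite S" "\<And>s. s \<in> S \<Longrightarrow> analytic_at (f s) y"
  shows "analytic_at (\<lambda>x. \<Prod>s\<in>S. f s x) y"
  using assms by (induction S rule: finite_induct) (auto intro: analytic_at_mult)

lemma analytic_at_hpart:
  fixes a :: "('n::finite \<Rightarrow> nat) \<Rightarrow> 'k::{real_normed_field, euclidean_space}"
  shows "analytic_at (hpart a k) y"
proof -
  have "analytic_at (\<lambda>x. \<Sum>\<alpha>\<in>{\<alpha>. mdeg \<alpha> = k}. a \<alpha> * mpow x \<alpha>) y"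
    by (intro analytic_at_sum analytic_at_mult analytic_at_const analytic_at_prod analytic_at_power
        analytic_at_nth finite_mdeg_eq finite)
  then show ?thesis by (simp add: hpart_def[abs_def])
qed

lemma has_power_series_hpart:
  "has_power_series (hpart a k) (\<lambda>\<alpha>. if mdeg \<alpha> = k then a \<alpha> else 0) 0"
proof -
  have "has_power_series (\<lambda>x. \<Sum>\<alpha>\<in>{\<alpha>. mdeg \<alpha> = k}. (if mdeg \<alpha> = k then a \<alpha> else 0) * mpow (x - 0) \<alpha>)
      (\<lambda>\<alpha>. if mdeg \<alpha> = k then a \<alpha> else 0) 0"
    by (rule has_power_series_finite[OF finite_mdeg_eq]) simp
  also have "(\<lambda>x. \<Sum>\<alpha>\<in>{\<alpha>. mdeg \<alpha> = k}. (if mdeg \<alpha> = k then a \<alpha> else 0) * mpow (x - 0) \<alpha>) = hpart a k"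
    unfolding hpart_def by (intro ext sum.cong) auto
  finally show ?thesis .
qed

lemma hpart_scale: "hpart a k (\<chi> i. t * x $ i) = t ^ k * hpart a k x"
  unfolding hpart_def mpow_scaleR sum_distrib_left by (intro sum.cong) auto

lemma hpart_scaleR: "hpart a k (t *\<^sub>R x) = t ^ k * hpart a k (x :: real ^ 'n::finite)"
proof -
  have "t *\<^sub>R x = (\<chi> i. t * x $ i)" by (simp add: vec_eq_iff)
  then show ?thesis by (simp add: hpart_scale)
qed

lemma hpart_diff: "hpart (\<lambda>\<alpha>. a \<alpha> - b \<alpha>) k x = hpart a k x - hpart b k x"
  by (simp add: hpart_def left_diff_distrib sum_subtractf)

section \<open>Derivatives along curves and consequences of homogeneity\<close>

lemma analytic_curve_derivative:
  fixes f :: "real ^ 'n::finite \<Rightarrow> real"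
  assumes "analytic_at f (y t)" "(y has_vector_derivative w) (at t within S)"
  shows "((\<lambda>s. f (y s)) has_real_derivative (\<Sum>i\<in>UNIV. partial i f (y t) * w $ i)) (at t within S)"
proof -
  have "((\<lambda>s. f (y s)) has_derivative (\<lambda>h. \<Sum>i\<in>UNIV. partial i f (y t) * (h *\<^sub>R w) $ i)) (at t within S)"
    by (rule has_derivative_compose[OF assms(2)[unfolded has_vector_derivative_def]
          analytic_at_has_derivative[OF assms(1)]])
  also have "(\<lambda>h. \<Sum>i\<in>UNIV. partial i f (y t) * (h *\<^sub>R w) $ i) = (*) (\<Sum>i\<in>UNIV. partial i f (y t) * w $ i)"
    by (rule ext) (simp add: sum_distrib_left sum_distrib_right mult_ac)
  finally show ?thesis by (simp add: has_field_derivative_def)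
qed

lemma analytic_at_imp_differentiable:
  fixes f :: "real ^ 'n::finite \<Rightarrow> real"
  shows "analytic_at f y \<Longrightarrow> f differentiable (at y)"
  using analytic_at_has_derivative differentiable_def by blast

lemma partial_cong:
  fixes f g :: "real ^ 'n::finite \<Rightarrow> real"
  assumes "eventually (\<lambda>x. f x = g x) (nhds y)" "analytic_at f y"
  shows "partial i f y = partial i g y"
proof -
  obtain a where "has_power_series f a y" using assms(2) unfolding analytic_at_def by (rule exE)
  moreover from this have "has_power_series g a y" using has_power_series_cong[OF assms(1), of a] by simp
  ultimately show ?thesis by (simp add: has_power_series_imp_partial)
qed

lemma partial_diff:
  fixes f g :: "real ^ 'n::finite \<Rightarrow> real"
  assumes "analytic_at f y" "analytic_at g y"
  shows "partial i (\<lambda>x. f x - g x) y = partial i f y - partial i g y"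
proof -
  obtain a b where "has_power_series f a y" "has_power_series g b y"
    using assms unfolding analytic_at_def by (elim exE)
  then show ?thesis
    using has_power_series_imp_partial[OF has_power_series_diff] by (simp add: has_power_series_imp_partial)
qed

text \<open>Both sides are the derivative at \<open>t = 1\<close> of the homogeneity relation
  \<open>hpart_scaleR\<close>.\<close>

lemma euler_identity:
  fixes a :: "('n::finite \<Rightarrow> nat) \<Rightarrow> real"
  shows "(\<Sum>i\<in>UNIV. y $ i * partial i (hpart a k) y) = real k * hpart a k y"
proof -
  have "((\<lambda>t::real. t *\<^sub>R y) has_vector_derivative y) (at 1)"
    by (auto intro!: derivative_eq_intros)
  from analytic_curve_derivative[OF analytic_at_hpart this, of a k]
  have "((\<lambda>t. hpart a k (t *\<^sub>R y)) has_real_derivative (\<Sum>i\<in>UNIV. partial i (hpart a k) y * y $ i)) (at 1)"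
    by simp
  moreover have "((\<lambda>t. hpart a k (t *\<^sub>R y)) has_real_derivative real k * hpart a k y) (at 1)"
    unfolding hpart_scaleR by (auto intro!: derivative_eq_intros)
  ultimately have "(\<Sum>i\<in>UNIV. partial i (hpart a k) y * y $ i) = real k * hpart a k y"
    by (rule DERIV_unique)
  then show ?thesis by (simp add: mult.commute)
qed

text \<open>Differentiating the homogeneity relation along \<open>axis i 1\<close> leaves a factor
  \<open>t\<close> on both sides, which is then cancelled.\<close>

lemma partial_hpart_scaleR:
  fixes a :: "('n::finite \<Rightarrow> nat) \<Rightarrow> real"
  assumes "t \<noteq> 0"
  shows "partial i (hpart a (Suc k)) (t *\<^sub>R y) = t ^ k * partial i (hpart a (Suc k)) y"
proof -
  have d1: "((\<lambda>s. y + s *\<^sub>R axis i 1) has_vector_derivative axis i 1) (at 0)"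
    by (auto intro!: derivative_eq_intros)
  have "((\<lambda>s. t *\<^sub>R (y + s *\<^sub>R axis i 1)) has_vector_derivative t *\<^sub>R axis i 1) (at 0)"
    by (auto intro!: derivative_eq_intros)
  from analytic_curve_derivative[OF analytic_at_hpart this, of a "Suc k"]
  have "((\<lambda>s. hpart a (Suc k) (t *\<^sub>R (y + s *\<^sub>R axis i 1))) has_real_derivative
      t * partial i (hpart a (Suc k)) (t *\<^sub>R y)) (at 0)"
    by (simp add: axis_def if_distrib cong: if_cong) (simp add: mult.commute)
  moreover have "((\<lambda>s. hpart a (Suc k) (t *\<^sub>R (y + s *\<^sub>R axis i 1))) has_real_derivative
      t ^ Suc k * partial i (hpart a (Suc k)) y) (at 0)"
    unfolding hpart_scaleR
    using DERIV_cmult[OF analytic_curve_derivative[OF analytic_at_hpart d1, of a "Suc k"], of "t ^ Suc k"]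
    by (simp add: axis_def if_distrib cong: if_cong)
  ultimately have "t * partial i (hpart a (Suc k)) (t *\<^sub>R y) = t ^ Suc k * partial i (hpart a (Suc k)) y"
    by (rule DERIV_unique)
  with assms show ?thesis by simp
qed

section \<open>Differential equations with a Lipschitz right-hand side\<close>

context
  fixes F :: "'a::euclidean_space \<Rightarrow> 'a" and L :: real and z0 :: 'a
  assumes lip: "\<And>x y. norm (F x - F y) \<le> L * norm (x - y)" and L: "L > 0"
begin

private lemma cont_F: "continuous_on S F"
proof (rule continuous_on_subset[of UNIV])
  have "L-lipschitz_on UNIV F"
    using lip L by (auto simp: lipschitz_on_def dist_norm)
  then show "continuous_on UNIV F" by (rule lipschitz_on_continuous_on)
qed simp

primrec picard :: "nat \<Rightarrow> real \<Rightarrow> 'a" where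
  "picard 0 t = z0"
| "picard (Suc m) t = z0 + integral {0..t} (\<lambda>s. F (picard m s))"

private lemma picard_cont: "continuous_on {0..T} (picard m)"
proof (induction m)
  case (Suc m)
  have "(\<lambda>s. F (picard m s)) integrable_on {0..T}"
    by (intro integrable_continuous_real continuous_on_compose2[OF cont_F[of UNIV] Suc.IH]) auto
  then show ?case by (auto intro!: continuous_intros indefinite_integral_continuous_1)
qed simp

private lemma picard_integrable: "(\<lambda>s. F (picard m s)) integrable_on {0..T}"
  by (intro integrable_continuous_real continuous_on_compose2[OF cont_F[of UNIV] picard_cont]) auto

text \<open>Every Picard step integrates the previous bound once more, which builds up the terms of
  an exponential series.\<close>

private lemma picard_step:
  assumes "t \<ge> 0"
  shows "norm (picard (Suc m) t - picard m t) \<le> norm (F z0) * L ^ m * t ^ Suc m / fact (Suc m)"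
  using assms
proof (induction m arbitrary: t)
  case 0
  then show ?case by simp
next
  case (Suc m)
  let ?g = "\<lambda>s. norm (F z0) * L ^ Suc m * (s ^ Suc m / fact (Suc m))"
  have int: "(?g has_integral norm (F z0) * L ^ Suc m * (t ^ Suc (Suc m) / fact (Suc (Suc m)))) {0..t}"
  proof (rule has_integral_mult_right)
    have "((\<lambda>s. s ^ Suc m / fact (Suc m)) has_integral
        t ^ Suc (Suc m) / fact (Suc (Suc m)) - 0 ^ Suc (Suc m) / fact (Suc (Suc m))) {0..t}"
    proof (rule fundamental_theorem_of_calculus[OF Suc.prems])
      fix s :: real assume "s \<in> {0..t}"
      have "((\<lambda>s. s ^ Suc (Suc m) / fact (Suc (Suc m))) has_real_derivative
          (real (Suc (Suc m)) * s ^ Suc m) / fact (Suc (Suc m))) (at s within {0..t})"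
        using DERIV_cdivide[OF DERIV_pow[of "Suc (Suc m)" s "{0..t}"], of "fact (Suc (Suc m))"] by simp
      also have "(real (Suc (Suc m)) * s ^ Suc m) / fact (Suc (Suc m)) = s ^ Suc m / fact (Suc m)"
        by (simp add: fact_Suc[of "Suc m"] del: fact_Suc)
      finally show "((\<lambda>s. s ^ Suc (Suc m) / fact (Suc (Suc m))) has_vector_derivative s ^ Suc m / fact (Suc m))
          (at s within {0..t})"
        by (simp add: has_real_derivative_iff_has_vector_derivative)
    qed
    then show "((\<lambda>s. s ^ Suc m / fact (Suc m)) has_integral t ^ Suc (Suc m) / fact (Suc (Suc m))) {0..t}"
      by simp
  qed
  have "picard (Suc (Suc m)) t - picard (Suc m) t
      = integral {0..t} (\<lambda>s. F (picard (Suc m) s) - F (picard m s))"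
    by (subst integral_diff) (auto intro: picard_integrable simp del: picard.simps(2) simp: picard.simps(2)[of _ t])
  also have "norm \<dots> \<le> integral {0..t} ?g"
  proof (rule integral_norm_bound_integral)
    fix s assume s: "s \<in> {0..t}"
    have "norm (F (picard (Suc m) s) - F (picard m s)) \<le> L * norm (picard (Suc m) s - picard m s)"
      by (rule lip)
    also have "\<dots> \<le> L * (norm (F z0) * L ^ m * s ^ Suc m / fact (Suc m))"
      using s L by (intro mult_left_mono Suc.IH) auto
    finally show "norm (F (picard (Suc m) s) - F (picard m s)) \<le> ?g s" by (simp add: mult_ac)
  qed (use int in \<open>auto intro!: integrable_diff picard_integrable simp del: picard.simps\<close>)
  also have "\<dots> = norm (F z0) * L ^ Suc m * t ^ Suc (Suc m) / fact (Suc (Suc m))"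
    using integral_unique[OF int] by simp
  finally show ?case .
qed

text \<open>The exponential majorant converges for every \<open>T\<close>, so one limit function
  \<open>z\<close> solves the equation on all intervals \<open>{0..T}\<close>
  simultaneously.\<close>

lemma lipschitz_ode_solution:
  obtains z where "z 0 = z0" "\<And>T t. T \<ge> 0 \<Longrightarrow> t \<in> {0..T} \<Longrightarrow> (z has_vector_derivative F (z t)) (at t within {0..T})"
proof -
  define z where "z t = lim (\<lambda>m. picard m t)" for t
  have unif: "uniform_limit {0..T} picard z sequentially" if T: "T \<ge> 0" for T
  proof -
    have tele: "(\<Sum>m<n. picard (Suc m) t - picard m t) = picard n t - z0" for n t
      using sum_lessThan_telescope[of "\<lambda>m. picard m t" n] by simp
    define M where "M m = norm (F z0) / L * ((L * T) ^ Suc m / fact (Suc m))" for m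
    have "uniform_limit {0..T} (\<lambda>n t. \<Sum>m<n. picard (Suc m) t - picard m t)
        (\<lambda>t. suminf (\<lambda>m. picard (Suc m) t - picard m t)) sequentially"
    proof (rule Weierstrass_m_test)
      fix m t assume t: "t \<in> {0..T}"
      have "norm (picard (Suc m) t - picard m t) \<le> norm (F z0) * L ^ m * t ^ Suc m / fact (Suc m)"
        by (rule picard_step) (use t in simp)
      also have "\<dots> \<le> norm (F z0) * L ^ m * T ^ Suc m / fact (Suc m)"
        using t L by (intro divide_right_mono mult_left_mono power_mono) auto
      also have "\<dots> = M m" using L by (simp add: M_def power_mult_distrib field_simps del: fact_Suc)
      finally show "norm (picard (Suc m) t - picard m t) \<le> M m" .
    next
      have "summable (\<lambda>m. (L * T) ^ Suc m / fact (Suc m))"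
        using summable_ignore_initial_segment[OF summable_exp[of "L * T"], of 1]
        by (simp add: field_simps del: fact_Suc)
      then show "summable M" unfolding M_def by (rule summable_mult)
    qed
    then have "uniform_limit {0..T} (\<lambda>n t. picard n t - z0)
        (\<lambda>t. suminf (\<lambda>m. picard (Suc m) t - picard m t)) sequentially"
      unfolding tele .
    then have U: "uniform_limit {0..T} (\<lambda>n t. (picard n t - z0) + z0)
        (\<lambda>t. suminf (\<lambda>m. picard (Suc m) t - picard m t) + z0) sequentially"
      by (intro uniform_limit_intros)
    have zeq: "z t = suminf (\<lambda>m. picard (Suc m) t - picard m t) + z0" if "t \<in> {0..T}" for t
      unfolding z_def using tendsto_uniform_limitI[OF U that] by (simp add: limI)
    show ?thesis
      by (rule uniform_limit_cong'[THEN iffD1, rotated 2, OF U]) (simp_all add: zeq del: picard.simps)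
  qed
  have cont: "continuous_on {0..T} z" if "T \<ge> 0" for T
    by (rule uniform_limit_theorem[OF _ unif[OF that]]) (auto intro!: always_eventually picard_cont)
  have fix_eq: "z t = z0 + integral {0..t} (\<lambda>s. F (z s))" if t: "t \<ge> 0" for t
  proof (rule LIMSEQ_unique)
    show "(\<lambda>m. picard (Suc m) t) \<longlonglongrightarrow> z t"
      using tendsto_uniform_limitI[OF unif[OF t], of t] t by (intro LIMSEQ_Suc) auto
    have "uniform_limit {0..t} (\<lambda>m s. F (picard m s)) (\<lambda>s. F (z s)) sequentially"
    proof (rule uniform_limitI)
      fix e :: real assume e: "e > 0"
      then have "e / L > 0" using L by simp
      from uniform_limitD[OF unif[OF t] this]
      show "\<forall>\<^sub>F m in sequentially. \<forall>s\<in>{0..t}. dist (F (picard m s)) (F (z s)) < e"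
      proof (rule eventually_mono, intro ballI)
        fix m s assume "\<forall>s\<in>{0..t}. dist (picard m s) (z s) < e / L" "s \<in> {0..t}"
        then have "L * norm (picard m s - z s) < e" using L by (auto simp: dist_norm field_simps)
        with lip[of "picard m s" "z s"] show "dist (F (picard m s)) (F (z s)) < e"
          by (simp add: dist_norm)
      qed
    qed
    then obtain I J where IJ: "\<And>m. ((\<lambda>s. F (picard m s)) has_integral I m) {0..t}"
        "((\<lambda>s. F (z s)) has_integral J) {0..t}" "I \<longlonglongrightarrow> J"
      by (rule uniform_limit_integral) (auto intro!: continuous_on_compose2[OF cont_F[of UNIV] picard_cont])
    then have "(\<lambda>m. integral {0..t} (\<lambda>s. F (picard m s))) \<longlonglongrightarrow> integral {0..t} (\<lambda>s. F (z s))"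
      using integral_unique[OF IJ(1)] integral_unique[OF IJ(2)] by (simp only:)
    then show "(\<lambda>m. picard (Suc m) t) \<longlonglongrightarrow> z0 + integral {0..t} (\<lambda>s. F (z s))"
      by (auto intro!: tendsto_intros)
  qed
  show thesis
  proof (rule that[of z])
    show "z 0 = z0" using fix_eq[of 0] by simp
    fix T t :: real assume T: "T \<ge> 0" and t: "t \<in> {0..T}"
    have "continuous_on {0..T} (\<lambda>s. F (z s))"
      by (intro continuous_on_compose2[OF cont_F[of UNIV] cont[OF T]]) auto
    from integral_has_vector_derivative[OF this t]
    have "((\<lambda>t. z0 + integral {0..t} (\<lambda>s. F (z s))) has_vector_derivative F (z t)) (at t within {0..T})"
      by (auto intro!: derivative_eq_intros)
    then show "(z has_vector_derivative F (z t)) (at t within {0..T})"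
      by (rule has_vector_derivative_transform[OF t, rotated]) (use fix_eq in auto)
  qed
qed

end

section \<open>Bounded Lipschitz functions\<close>

text \<open>Boundedness is part of the notion because products of Lipschitz functions are Lipschitz
  only with it.\<close>

definition blip :: "'a::metric_space set \<Rightarrow> ('a \<Rightarrow> real) \<Rightarrow> bool" where
  "blip S f \<longleftrightarrow> (\<exists>L B. \<forall>x\<in>S. \<bar>f x\<bar> \<le> B \<and> (\<forall>y\<in>S. \<bar>f x - f y\<bar> \<le> L * dist x y))"

lemma blipE:
  assumes "blip S f"
  obtains L B where "L > 0" "B > 0" "\<And>x. x \<in> S \<Longrightarrow> \<bar>f x\<bar> \<le> B"
    "\<And>x y. x \<in> S \<Longrightarrow> y \<in> S \<Longrightarrow> \<bar>f x - f y\<bar> \<le> L * dist x y"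
proof -
  from assms obtain L B where LB: "\<And>x. x \<in> S \<Longrightarrow> \<bar>f x\<bar> \<le> B"
    "\<And>x y. x \<in> S \<Longrightarrow> y \<in> S \<Longrightarrow> \<bar>f x - f y\<bar> \<le> L * dist x y"
    unfolding blip_def by blast
  show thesis
  proof (rule that[of "\<bar>L\<bar> + 1" "\<bar>B\<bar> + 1"])
    show "\<bar>f x\<bar> \<le> \<bar>B\<bar> + 1" if "x \<in> S" for x using LB(1)[OF that] by linarith
    show "\<bar>f x - f y\<bar> \<le> (\<bar>L\<bar> + 1) * dist x y" if "x \<in> S" "y \<in> S" for x y
      using LB(2)[OF that] mult_right_mono[of L "\<bar>L\<bar> + 1" "dist x y"] by fastforce
  qed auto
qed

lemma blipI:
  assumes "\<And>x. x \<in> S \<Longrightarrow> \<bar>f x\<bar> \<le> B"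
    "\<And>x y. x \<in> S \<Longrightarrow> y \<in> S \<Longrightarrow> \<bar>f x - f y\<bar> \<le> L * dist x y"
  shows "blip S f"
  using assms unfolding blip_def by blast

lemma blipD:
  assumes "blip S f"
  shows "\<exists>L B. L > 0 \<and> B > 0 \<and> (\<forall>x\<in>S. \<bar>f x\<bar> \<le> B) \<and> (\<forall>x\<in>S. \<forall>y\<in>S. \<bar>f x - f y\<bar> \<le> L * dist x y)"
  by (rule blipE[OF assms]) blast

lemma blip_const: "blip S (\<lambda>x. c)"
  by (rule blipI[of _ _ "\<bar>c\<bar>" 0]) auto

lemma blip_add:
  assumes "blip S f" "blip S g" shows "blip S (\<lambda>x. f x + g x)"
proof -
  obtain L B where f: "\<And>x. x \<in> S \<Longrightarrow> \<bar>f x\<bar> \<le> B"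
    "\<And>x y. x \<in> S \<Longrightarrow> y \<in> S \<Longrightarrow> \<bar>f x - f y\<bar> \<le> L * dist x y" using blipE[OF assms(1)] by metis
  obtain L' B' where g: "\<And>x. x \<in> S \<Longrightarrow> \<bar>g x\<bar> \<le> B'"
    "\<And>x y. x \<in> S \<Longrightarrow> y \<in> S \<Longrightarrow> \<bar>g x - g y\<bar> \<le> L' * dist x y" using blipE[OF assms(2)] by metis
  show ?thesis
  proof (rule blipI[of _ _ "B + B'" "L + L'"])
    show "\<bar>f x + g x\<bar> \<le> B + B'" if "x \<in> S" for x using f(1)[OF that] g(1)[OF that] by linarith
    show "\<bar>f x + g x - (f y + g y)\<bar> \<le> (L + L') * dist x y" if "x \<in> S" "y \<in> S" for x y
      using f(2)[OF that] g(2)[OF that] unfolding distrib_right by linarith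
  qed
qed

lemma blip_mult:
  assumes "blip S f" "blip S g" shows "blip S (\<lambda>x. f x * g x)"
proof -
  obtain L B where f: "L > 0" "B > 0" "\<And>x. x \<in> S \<Longrightarrow> \<bar>f x\<bar> \<le> B"
    "\<And>x y. x \<in> S \<Longrightarrow> y \<in> S \<Longrightarrow> \<bar>f x - f y\<bar> \<le> L * dist x y" using blipE[OF assms(1)] by metis
  obtain L' B' where g: "L' > 0" "B' > 0" "\<And>x. x \<in> S \<Longrightarrow> \<bar>g x\<bar> \<le> B'"
    "\<And>x y. x \<in> S \<Longrightarrow> y \<in> S \<Longrightarrow> \<bar>g x - g y\<bar> \<le> L' * dist x y" using blipE[OF assms(2)] by metis
  show ?thesis
  proof (rule blipI[of _ _ "B * B'" "B * L' + L * B'"])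
    show "\<bar>f x * g x\<bar> \<le> B * B'" if "x \<in> S" for x
      using f(2) f(3)[OF that] g(3)[OF that] by (simp add: abs_mult mult_mono)
    show "\<bar>f x * g x - f y * g y\<bar> \<le> (B * L' + L * B') * dist x y" if "x \<in> S" "y \<in> S" for x y
    proof -
      have "f x * g x - f y * g y = f x * (g x - g y) + (f x - f y) * g y" by (simp add: algebra_simps)
      then have "\<bar>f x * g x - f y * g y\<bar> \<le> \<bar>f x\<bar> * \<bar>g x - g y\<bar> + \<bar>f x - f y\<bar> * \<bar>g y\<bar>"
        using abs_triangle_ineq[of "f x * (g x - g y)" "(f x - f y) * g y"] by (simp add: abs_mult)
      also have "\<dots> \<le> B * (L' * dist x y) + (L * dist x y) * B'"
        using that f g by (intro add_mono mult_mono) (auto intro!: mult_nonneg_nonneg simp: less_imp_le)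
      finally show ?thesis by (simp add: algebra_simps)
    qed
  qed
qed

lemma blip_diff: "blip S f \<Longrightarrow> blip S g \<Longrightarrow> blip S (\<lambda>x. f x - g x)"
  using blip_add[of S f "\<lambda>x. (-1) * g x"] blip_mult[OF blip_const[of S "-1"], of g] by simp

lemma blip_sum:
  assumes "finite I" "\<And>i. i \<in> I \<Longrightarrow> blip S (f i)" shows "blip S (\<lambda>x. \<Sum>i\<in>I. f i x)"
  using assms by (induction I rule: finite_induct) (auto intro: blip_const blip_add)

lemma blip_fst:
  assumes "blip S f" shows "blip (S \<times> W) (\<lambda>p. f (fst p))"
proof -
  obtain L B where f: "L > 0" "B > 0" "\<And>x. x \<in> S \<Longrightarrow> \<bar>f x\<bar> \<le> B"
    "\<And>x y. x \<in> S \<Longrightarrow> y \<in> S \<Longrightarrow> \<bar>f x - f y\<bar> \<le> L * dist x y" using blipE[OF assms] by metis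
  show ?thesis
  proof (rule blipI[of _ _ B L])
    show "\<bar>f (fst p) - f (fst q)\<bar> \<le> L * dist p q" if "p \<in> S \<times> W" "q \<in> S \<times> W" for p q
    proof -
      have "\<bar>f (fst p) - f (fst q)\<bar> \<le> L * dist (fst p) (fst q)" using that by (intro f(4)) auto
      also have "\<dots> \<le> L * dist p q" using f(1) by (intro mult_left_mono dist_fst_le) auto
      finally show ?thesis .
    qed
  qed (use f(3) in auto)
qed

lemma blip_snd_nth:
  fixes W :: "(real ^ 'n::finite) set"
  assumes "bounded W" shows "blip (S \<times> W) (\<lambda>p. snd p $ i)"
proof -
  from assms obtain B where B: "\<And>w. w \<in> W \<Longrightarrow> norm w \<le> B" by (auto simp: bounded_iff)
  show ?thesis
  proof (rule blipI[of _ _ B 1])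
    show "\<bar>snd p $ i\<bar> \<le> B" if "p \<in> S \<times> W" for p
      using B[of "snd p"] that component_le_norm_cart[of "snd p" i] by auto
    show "\<bar>snd p $ i - snd q $ i\<bar> \<le> 1 * dist p q" if "p \<in> S \<times> W" "q \<in> S \<times> W" for p q
      using component_le_norm_cart[of "snd p - snd q" i] dist_snd_le[of p q] by (simp add: dist_norm)
  qed
qed

lemma analytic_continuous_on:
  fixes f :: "real ^ 'n::finite \<Rightarrow> real"
  assumes "\<And>y. y \<in> S \<Longrightarrow> analytic_at f y" shows "continuous_on S f"
  using assms by (auto intro!: continuous_at_imp_continuous_on analytic_at_isCont)

text \<open>The partial derivatives are continuous, hence bounded on the compact set; convexity then
  allows the mean value inequality.\<close>

lemma blip_analytic:
  fixes f :: "real ^ 'n::finite \<Rightarrow> real"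
  assumes "\<And>y. y \<in> K \<Longrightarrow> analytic_at f y" "compact K" "convex K"
  shows "blip K f"
proof -
  have bd: "\<exists>B. \<forall>y\<in>K. \<bar>h y\<bar> \<le> B" if "\<And>y. y \<in> K \<Longrightarrow> analytic_at h y" for h :: "real ^ 'n \<Rightarrow> real"
    using compact_imp_bounded[OF compact_continuous_image[OF analytic_continuous_on[OF that] assms(2)]]
    by (auto simp: bounded_iff)
  obtain B where B: "\<And>y. y \<in> K \<Longrightarrow> \<bar>f y\<bar> \<le> B" using bd[OF assms(1)] by blast
  have "\<exists>D. \<forall>y\<in>K. \<bar>partial i f y\<bar> \<le> D" for i by (rule bd) (rule analytic_at_partial[OF assms(1)])
  then obtain D where D: "\<And>i y. y \<in> K \<Longrightarrow> \<bar>partial i f y\<bar> \<le> D i" by metis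
  show ?thesis
  proof (rule blipI[of _ _ B "\<Sum>i\<in>UNIV. D i"])
    fix x y assume xy: "x \<in> K" "y \<in> K"
    have "norm (f x - f y) \<le> (\<Sum>i\<in>UNIV. D i) * norm (x - y)"
    proof (rule differentiable_bound[OF assms(3) _ _ xy(1) xy(2)])
      fix z assume z: "z \<in> K"
      show "(f has_derivative (\<lambda>h. \<Sum>i\<in>UNIV. partial i f z * h $ i)) (at z within K)"
        by (rule has_derivative_at_withinI[OF analytic_at_has_derivative[OF assms(1)[OF z]]])
      show "onorm (\<lambda>h. \<Sum>i\<in>UNIV. partial i f z * h $ i) \<le> (\<Sum>i\<in>UNIV. D i)"
      proof (rule onorm_bound)
        show "norm (\<Sum>i\<in>UNIV. partial i f z * h $ i) \<le> (\<Sum>i\<in>UNIV. D i) * norm h" for h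
          unfolding sum_distrib_right
          by (rule order.trans[OF norm_sum], rule sum_mono)
             (use D[OF z] in \<open>auto simp: abs_mult intro!: mult_mono component_le_norm_cart intro: order.trans[OF abs_ge_zero]\<close>)
        show "0 \<le> (\<Sum>i\<in>UNIV. D i)"
          using D[OF z] by (intro sum_nonneg) (metis abs_ge_zero order.trans)
      qed
    qed
    then show "\<bar>f x - f y\<bar> \<le> (\<Sum>i\<in>UNIV. D i) * dist x y" by (simp add: dist_norm)
  qed (rule B)
qed

section \<open>The Euler--Lagrange equation in coordinates\<close>

locale coord_lagrangian =
  fixes \<Omega> :: "(real ^ 'n::finite) set" and gm :: "'n \<Rightarrow> 'n \<Rightarrow> real ^ 'n \<Rightarrow> real"
    and u :: "real ^ 'n \<Rightarrow> real" and mu :: "'n \<Rightarrow> real ^ 'n \<Rightarrow> real"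
  assumes open_dom: "open \<Omega>"
    and analytic_gm: "\<And>y i j. y \<in> \<Omega> \<Longrightarrow> analytic_at (gm i j) y"
    and analytic_u: "\<And>y. y \<in> \<Omega> \<Longrightarrow> analytic_at u y"
    and analytic_mu: "\<And>y i. y \<in> \<Omega> \<Longrightarrow> analytic_at (mu i) y"
    and gm_sym: "\<And>y i j. y \<in> \<Omega> \<Longrightarrow> gm i j y = gm j i y"
    and gm_pos: "\<And>y w. y \<in> \<Omega> \<Longrightarrow> w \<noteq> 0 \<Longrightarrow> (\<Sum>i\<in>UNIV. \<Sum>j\<in>UNIV. gm i j y * w $ i * w $ j) > 0"
begin

definition "gmat y = (\<chi> i j. gm i j y)"

text \<open>Component \<open>l\<close> of the contraction of \<open>d mu\<close> with
  \<open>w\<close>.\<close>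

definition "magnetic y w l = (\<Sum>k\<in>UNIV. w $ k * (partial k (mu l) y - partial l (mu k) y))"

text \<open>The equation of motion with its index lowered: the quadratic terms are the Christoffel
  symbols of the first kind, so the inverse metric enters only through \<open>accel\<close>.\<close>

definition force :: "real ^ 'n \<Rightarrow> real ^ 'n \<Rightarrow> real ^ 'n" where
  "force y w = (\<chi> l. - (1/2) * (\<Sum>j\<in>UNIV. \<Sum>k\<in>UNIV.
       (partial j (gm l k) y + partial k (gm j l) y - partial l (gm j k) y) * w $ j * w $ k)
     - partial l u y - magnetic y w l)"

definition "accel y w = matrix_inv (gmat y) *v force y w"

definition "momentum y w l = (\<Sum>k\<in>UNIV. gm l k y * w $ k)"

definition "energy_at y w = (1/2) * (\<Sum>l\<in>UNIV. w $ l * momentum y w l) + u y"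

definition solution :: "real \<Rightarrow> (real \<Rightarrow> real ^ 'n) \<Rightarrow> (real \<Rightarrow> real ^ 'n) \<Rightarrow> bool" where
  "solution T y w \<longleftrightarrow> (\<forall>t\<in>{0..T}. y t \<in> \<Omega> \<and>
     (y has_vector_derivative w t) (at t within {0..T}) \<and>
     (w has_vector_derivative accel (y t) (w t)) (at t within {0..T}))"

lemma quad_eq: "(\<Sum>i\<in>UNIV. \<Sum>j\<in>UNIV. gm i j y * w $ i * w $ j) = w \<bullet> (gmat y *v w)"
  by (simp add: inner_vec_def matrix_vector_mult_def gmat_def sum_distrib_left mult_ac)

lemma momentum_eq: "momentum y w l = (gmat y *v w) $ l"
  by (simp add: momentum_def matrix_vector_mult_def gmat_def)

lemma quad_momentum: "w \<bullet> (gmat y *v w) = (\<Sum>l\<in>UNIV. w $ l * momentum y w l)"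
  by (simp add: inner_vec_def momentum_eq)

text \<open>The estimates below use the acceleration only as the solution of this linear system,
  never through the entries of the inverse matrix.\<close>

lemma gmat_accel:
  assumes "y \<in> \<Omega>" shows "gmat y *v accel y w = force y w"
proof -
  have "\<forall>x. gmat y *v x = 0 \<longrightarrow> x = 0"
  proof (intro allI impI)
    fix x assume "gmat y *v x = 0"
    then have "x \<bullet> (gmat y *v x) = 0" by simp
    then show "x = 0" using gm_pos[OF assms, of x] unfolding quad_eq by force
  qed
  then have "invertible (gmat y)"
    by (auto simp: invertible_left_inverse matrix_left_invertible_ker)
  then have "gmat y ** matrix_inv (gmat y) = mat 1 \<and> matrix_inv (gmat y) ** gmat y = mat 1"
    unfolding invertible_def matrix_inv_def by (rule someI_ex)
  then have "gmat y ** matrix_inv (gmat y) = mat 1" ..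
  then show ?thesis by (simp add: accel_def matrix_vector_mul_assoc)
qed

text \<open>The quadratic form attains a positive minimum on the compact product of \<open>K\<close>
  with the unit sphere, and scaling extends the bound to all \<open>w\<close>.\<close>

lemma coercive:
  assumes "compact K" "K \<subseteq> \<Omega>"
  obtains c where "c > 0" "\<And>y w. y \<in> K \<Longrightarrow> c * (norm w)\<^sup>2 \<le> w \<bullet> (gmat y *v w)"
proof (cases "K = {}")
  case False
  let ?S = "sphere (0 :: real ^ 'n) 1"
  let ?q = "\<lambda>p. \<Sum>i\<in>UNIV. \<Sum>j\<in>UNIV. gm i j (fst p) * snd p $ i * snd p $ j"
  have cg: "continuous_on (K \<times> ?S) (\<lambda>p. gm i j (fst p))" for i j
    by (rule continuous_on_compose2[OF analytic_continuous_on[of K "gm i j"]])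
       (use assms(2) in \<open>auto intro: analytic_gm continuous_on_fst\<close>)
  have cq: "continuous_on (K \<times> ?S) ?q"
    by (intro continuous_on_sum continuous_on_mult cg continuous_intros)
  have cK: "compact (K \<times> ?S)" using assms(1) by (intro compact_Times) auto
  have "(axis undefined 1 :: real ^ 'n) \<in> ?S" by simp
  then have "K \<times> ?S \<noteq> {}" using False by blast
  from continuous_attains_inf[OF cK this cq]
  obtain p where p: "p \<in> K \<times> ?S" "\<forall>p'\<in>K \<times> ?S. ?q p \<le> ?q p'" by (elim bexE)
  have "?q p > 0" using p(1) assms(2) by (intro gm_pos) auto
  moreover have "?q p * (norm w)\<^sup>2 \<le> w \<bullet> (gmat y *v w)" if "y \<in> K" for y w
  proof (cases "w = 0")
    case False
    have "?q p \<le> ?q (y, w /\<^sub>R norm w)" using that False by (intro bspec[OF p(2)]) auto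
    also have "\<dots> = (w /\<^sub>R norm w) \<bullet> (gmat y *v (w /\<^sub>R norm w))" by (simp only: quad_eq fst_conv snd_conv)
    also have "\<dots> = (w \<bullet> (gmat y *v w)) / (norm w)\<^sup>2"
      by (simp add: matrix_vector_mult_scaleR power2_eq_square divide_inverse mult_ac)
    finally show ?thesis using False by (simp add: field_simps)
  qed simp
  ultimately show thesis by (rule that)
qed (rule that[of 1]; simp)

lemma blip_force:
  assumes "compact K" "convex K" "K \<subseteq> \<Omega>" "bounded W"
  shows "blip (K \<times> W) (\<lambda>p. force (fst p) (snd p) $ l)"
proof -
  have an: "blip (K \<times> W) (\<lambda>p. f (fst p))" if "\<And>y. y \<in> \<Omega> \<Longrightarrow> analytic_at f y" for f
    by (intro blip_fst blip_analytic assms that) (use assms(3) in auto)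
  show ?thesis unfolding force_def magnetic_def vec_lambda_beta
    by (intro blip_diff blip_mult blip_const blip_sum blip_add finite an blip_snd_nth assms(4)
        analytic_at_partial analytic_gm analytic_u analytic_mu)
qed

text \<open>The difference of two accelerations solves a linear system whose right-hand side is the
  difference of the forces plus the difference of the matrices applied to one acceleration.
  Coercivity bounds such a solution by its right-hand side.\<close>

lemma accel_lipschitz:
  assumes K: "compact K" "convex K" "K \<subseteq> \<Omega>" "bounded W"
  obtains L where "\<And>p q. p \<in> K \<times> W \<Longrightarrow> q \<in> K \<times> W \<Longrightarrow>
    norm (accel (fst p) (snd p) - accel (fst q) (snd q)) \<le> L * dist p q"
proof -
  obtain c where c: "c > 0" "\<And>y w. y \<in> K \<Longrightarrow> c * (norm w)\<^sup>2 \<le> w \<bullet> (gmat y *v w)"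
    using coercive[OF K(1,3)] by metis
  have solve: "c * norm x \<le> norm (gmat y *v x)" if "y \<in> K" for x y
  proof (cases "x = 0")
    case False
    have "c * (norm x)\<^sup>2 \<le> norm x * norm (gmat y *v x)"
      using c(2)[OF that, of x] norm_cauchy_schwarz[of x "gmat y *v x"] by linarith
    then have "norm x * (c * norm x) \<le> norm x * norm (gmat y *v x)"
      by (simp add: power2_eq_square mult_ac)
    then show ?thesis using False by simp
  qed simp
  have "\<forall>l. \<exists>L B. L > 0 \<and> B > 0 \<and> (\<forall>p\<in>K \<times> W. \<bar>force (fst p) (snd p) $ l\<bar> \<le> B) \<and>
     (\<forall>p\<in>K \<times> W. \<forall>q\<in>K \<times> W. \<bar>force (fst p) (snd p) $ l - force (fst q) (snd q) $ l\<bar> \<le> L * dist p q)"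
    by (intro allI blipD blip_force K)
  then obtain LF BF where F: "\<And>l p. p \<in> K \<times> W \<Longrightarrow> \<bar>force (fst p) (snd p) $ l\<bar> \<le> BF l"
    "\<And>l p q. p \<in> K \<times> W \<Longrightarrow> q \<in> K \<times> W \<Longrightarrow>
      \<bar>force (fst p) (snd p) $ l - force (fst q) (snd q) $ l\<bar> \<le> LF l * dist p q" by metis
  have "\<forall>l k. \<exists>L B. L > 0 \<and> B > 0 \<and> (\<forall>p\<in>K. \<bar>gm l k p\<bar> \<le> B) \<and>
     (\<forall>p\<in>K. \<forall>q\<in>K. \<bar>gm l k p - gm l k q\<bar> \<le> L * dist p q)"
    by (intro allI blipD blip_analytic K analytic_gm) (use K(3) in auto)
  then obtain LG where G: "\<And>l k p q. p \<in> K \<Longrightarrow> q \<in> K \<Longrightarrow> \<bar>gm l k p - gm l k q\<bar> \<le> LG l k * dist p q"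
    and LG: "\<And>l k. LG l k > 0" by metis
  define SF where "SF = (\<Sum>l\<in>UNIV. BF l)"
  define SL where "SL = (\<Sum>l\<in>UNIV. LF l)"
  define SG where "SG = (\<Sum>l\<in>UNIV. \<Sum>k\<in>UNIV. LG l k)"
  have aB: "norm (accel (fst q) (snd q)) \<le> SF / c" if q: "q \<in> K \<times> W" for q
  proof -
    have "c * norm (accel (fst q) (snd q)) \<le> norm (force (fst q) (snd q))"
      using solve[of "fst q" "accel (fst q) (snd q)"] q K(3) by (auto simp: gmat_accel subset_iff)
    also have "\<dots> \<le> (\<Sum>l\<in>UNIV. \<bar>force (fst q) (snd q) $ l\<bar>)" by (rule norm_le_l1_cart)
    also have "\<dots> \<le> SF" unfolding SF_def by (intro sum_mono F q)
    finally show ?thesis using c(1) by (simp add: field_simps)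
  qed
  show thesis
  proof (rule that)
    fix p q assume p: "p \<in> K \<times> W" and q: "q \<in> K \<times> W"
    let ?a = "accel (fst p) (snd p)" and ?b = "accel (fst q) (snd q)"
    have "gmat (fst p) *v (?a - ?b) = (force (fst p) (snd p) - force (fst q) (snd q))
        + (gmat (fst q) - gmat (fst p)) *v ?b"
      using p q K(3) by (auto simp: matrix_vector_mult_diff_distrib matrix_vector_mult_diff_rdistrib gmat_accel subset_iff)
    then have "c * norm (?a - ?b) \<le> norm (force (fst p) (snd p) - force (fst q) (snd q))
        + norm ((gmat (fst q) - gmat (fst p)) *v ?b)"
      using solve[of "fst p" "?a - ?b"] p norm_triangle_ineq[of "force (fst p) (snd p) - force (fst q) (snd q)"
        "(gmat (fst q) - gmat (fst p)) *v ?b"] by auto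
    moreover have "norm (force (fst p) (snd p) - force (fst q) (snd q)) \<le> SL * dist p q"
    proof -
      have "norm (force (fst p) (snd p) - force (fst q) (snd q))
          \<le> (\<Sum>l\<in>UNIV. \<bar>(force (fst p) (snd p) - force (fst q) (snd q)) $ l\<bar>)" by (rule norm_le_l1_cart)
      also have "\<dots> \<le> (\<Sum>l\<in>UNIV. LF l * dist p q)"
        using F(2)[OF p q] by (intro sum_mono) simp
      finally show ?thesis by (simp add: SL_def sum_distrib_right)
    qed
    moreover have "norm ((gmat (fst q) - gmat (fst p)) *v ?b) \<le> SG * dist p q * (SF / c)"
    proof -
      have "norm ((gmat (fst q) - gmat (fst p)) *v ?b)
          \<le> (\<Sum>l\<in>UNIV. \<bar>((gmat (fst q) - gmat (fst p)) *v ?b) $ l\<bar>)" by (rule norm_le_l1_cart)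
      also have "\<dots> \<le> (\<Sum>l\<in>UNIV. \<Sum>k\<in>UNIV. LG l k * dist p q * (SF / c))"
      proof (rule sum_mono)
        fix l
        have "\<bar>((gmat (fst q) - gmat (fst p)) *v ?b) $ l\<bar>
            \<le> (\<Sum>k\<in>UNIV. \<bar>(gm l k (fst q) - gm l k (fst p)) * ?b $ k\<bar>)"
          unfolding matrix_vector_mult_def vec_lambda_beta by (rule order.trans[OF sum_abs]) (simp add: gmat_def)
        also have "\<dots> \<le> (\<Sum>k\<in>UNIV. LG l k * dist p q * (SF / c))"
        proof (rule sum_mono)
          fix k
          have "\<bar>gm l k (fst q) - gm l k (fst p)\<bar> \<le> LG l k * dist (fst q) (fst p)" using p q by (intro G) auto
          also have "\<dots> \<le> LG l k * dist p q"
            using LG dist_fst_le[of p q] by (simp add: dist_commute less_imp_le)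
          finally show "\<bar>(gm l k (fst q) - gm l k (fst p)) * ?b $ k\<bar> \<le> LG l k * dist p q * (SF / c)"
            unfolding abs_mult using aB[OF q] component_le_norm_cart[of ?b k]
            by (intro mult_mono) auto
        qed
        finally show "\<bar>((gmat (fst q) - gmat (fst p)) *v ?b) $ l\<bar> \<le> (\<Sum>k\<in>UNIV. LG l k * dist p q * (SF / c))" .
      qed
      finally show ?thesis unfolding SG_def sum_distrib_right .
    qed
    ultimately have "c * norm (?a - ?b) \<le> SL * dist p q + SG * dist p q * (SF / c)" by linarith
    then show "norm (?a - ?b) \<le> ((SL + SG * (SF / c)) / c) * dist p q"
      using c(1) by (simp add: field_simps)
  qed
qed

end

section \<open>Existence of trajectories, momentum equation and energy\<close>

context coord_lagrangian begin

text \<open>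
  The vector field is made globally Lipschitz by precomposing it with the nearest-point projection onto a
  product of balls; as long as a solution stays there it solves the original equation.
\<close>

lemma truncated_solution:
  assumes "cball 0 r \<subseteq> \<Omega>" "norm y0 < r" "norm w0 < R"
  obtains y w where "y 0 = y0" "w 0 = w0" "continuous_on {0..} y" "continuous_on {0..} w"
    "\<And>T. T \<ge> 0 \<Longrightarrow> (\<And>t. t \<in> {0..T} \<Longrightarrow> norm (y t) \<le> r \<and> norm (w t) \<le> R) \<Longrightarrow> solution T y w"
proof -
  let ?Y = "cball (0 :: real ^ 'n) r" and ?W = "cball (0 :: real ^ 'n) R"
  define K where "K = ?Y \<times> ?W"
  have K: "closed K" "convex K" "(y0, w0) \<in> K"
    using assms by (auto simp: K_def intro!: closed_Times convex_Times)
  then have ne: "K \<noteq> {}" by auto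
  obtain L where L: "\<And>p q. p \<in> K \<Longrightarrow> q \<in> K \<Longrightarrow>
      norm (accel (fst p) (snd p) - accel (fst q) (snd q)) \<le> L * dist p q"
    using accel_lipschitz[of ?Y ?W] assms(1) by (auto simp: K_def)
  define F where "F p = (snd p, accel (fst p) (snd p))" for p
  define G where "G p = F (closest_point K p)" for p
  have lip: "norm (G p - G q) \<le> (\<bar>L\<bar> + 1) * norm (p - q)" for p q
  proof -
    let ?p = "closest_point K p" and ?q = "closest_point K q"
    have in_K: "?p \<in> K" "?q \<in> K" using closest_point_in_set[OF K(1) ne] by auto
    have "norm (G p - G q) \<le> norm (snd ?p - snd ?q) + norm (accel (fst ?p) (snd ?p) - accel (fst ?q) (snd ?q))"
      using norm_Pair_le[of "snd ?p - snd ?q" "accel (fst ?p) (snd ?p) - accel (fst ?q) (snd ?q)"]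
      by (simp add: G_def F_def)
    also have "\<dots> \<le> dist ?p ?q + L * dist ?p ?q"
      using dist_snd_le[of ?p ?q] L[OF in_K] by (simp add: dist_norm)
    also have "\<dots> \<le> (\<bar>L\<bar> + 1) * dist ?p ?q"
      using mult_right_mono[of L "\<bar>L\<bar>" "dist ?p ?q"] by (simp add: algebra_simps)
    also have "\<dots> \<le> (\<bar>L\<bar> + 1) * dist p q"
      by (intro mult_left_mono closest_point_lipschitz K ne) auto
    finally show ?thesis by (simp add: dist_norm)
  qed
  obtain z where z: "z 0 = (y0, w0)"
    "\<And>T t. T \<ge> 0 \<Longrightarrow> t \<in> {0..T} \<Longrightarrow> (z has_vector_derivative G (z t)) (at t within {0..T})"
  proof (rule lipschitz_ode_solution[of G "\<bar>L\<bar> + 1" "(y0, w0)", OF lip])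
    show "0 < \<bar>L\<bar> + 1" by simp
  qed blast
  have cz: "continuous_on {0..} z"
    unfolding continuous_on_eq_continuous_within
  proof
    fix t :: real assume "t \<in> {0..}"
    \<comment> \<open>The interval up to \<open>t + 1\<close> is a neighbourhood of \<open>t\<close>
      in \<open>{0..}\<close>, unlike the one up to \<open>t\<close>.\<close>
    then have "(z has_vector_derivative G (z t)) (at t within {0..t + 1})" by (intro z(2)) auto
    then have "continuous (at t within {0..t + 1}) z" by (rule has_vector_derivative_continuous)
    moreover have "at t within {0..t + 1} = at t within {0..}"
      by (rule at_within_nhd[of _ "{t - 1<..<t + 1}"]) auto
    ultimately show "continuous (at t within {0..}) z" by simp
  qed
  show thesis
  proof (rule that[of "\<lambda>t. fst (z t)" "\<lambda>t. snd (z t)"])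
    show "continuous_on {0..} (\<lambda>t. fst (z t))" "continuous_on {0..} (\<lambda>t. snd (z t))"
      using cz by (auto intro: continuous_intros)
    fix T :: real assume T: "T \<ge> 0"
      and inK: "\<And>t. t \<in> {0..T} \<Longrightarrow> norm (fst (z t)) \<le> r \<and> norm (snd (z t)) \<le> R"
    show "solution T (\<lambda>t. fst (z t)) (\<lambda>t. snd (z t))"
      unfolding solution_def
    proof (intro ballI conjI)
      fix t assume t: "t \<in> {0..T}"
      then have zK: "z t \<in> K" using inK[OF t] by (simp add: K_def mem_Times_iff)
      have "G (z t) = (snd (z t), accel (fst (z t)) (snd (z t)))"
        unfolding G_def F_def closest_point_self[OF zK] ..
      then have d: "(z has_vector_derivative (snd (z t), accel (fst (z t)) (snd (z t)))) (at t within {0..T})"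
        using z(2)[OF T t] by simp
      show "fst (z t) \<in> \<Omega>" using inK[OF t] assms(1) by (auto simp: subset_iff)
      show "((\<lambda>t. fst (z t)) has_vector_derivative snd (z t)) (at t within {0..T})"
        using bounded_linear.has_vector_derivative[OF bounded_linear_fst d] by simp
      show "((\<lambda>t. snd (z t)) has_vector_derivative accel (fst (z t)) (snd (z t))) (at t within {0..T})"
        using bounded_linear.has_vector_derivative[OF bounded_linear_snd d] by simp
    qed
  qed (simp_all add: z(1))
qed

text \<open>The derivative of the quadratic form of the metric at \<open>w\<close> in direction
  \<open>l\<close>. In \<open>transport_term\<close> the matrix is instead differentiated along
  \<open>w\<close>, as happens in the time derivative of the momentum.\<close>

definition "metric_term y w l = (\<Sum>j\<in>UNIV. \<Sum>k\<in>UNIV. partial l (gm j k) y * w $ j * w $ k)"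

definition "transport_term y w l = (\<Sum>j\<in>UNIV. \<Sum>k\<in>UNIV. partial j (gm l k) y * w $ j * w $ k)"

lemma partial_gm_sym:
  assumes "y \<in> \<Omega>" shows "partial l (gm i j) y = partial l (gm j i) y"
proof (rule partial_cong[OF _ analytic_gm[OF assms]])
  have "eventually (\<lambda>x. x \<in> \<Omega>) (nhds y)" using open_dom assms by (rule eventually_nhds_in_open)
  then show "eventually (\<lambda>x. gm i j x = gm j i x) (nhds y)" by (rule eventually_mono) (rule gm_sym)
qed

text \<open>By symmetry of the metric the first two Christoffel terms agree after contraction with
  \<open>w\<close> in both slots.\<close>

lemma force_eq:
  assumes "y \<in> \<Omega>"
  shows "force y w $ l = - transport_term y w l + (1/2) * metric_term y w l - partial l u y - magnetic y w l"
proof -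
  have "(\<Sum>j\<in>UNIV. \<Sum>k\<in>UNIV. partial k (gm j l) y * w $ j * w $ k) = transport_term y w l"
    unfolding transport_term_def
    by (subst sum.swap) (simp add: partial_gm_sym[OF assms, of _ _ l] mult_ac)
  then show ?thesis
    by (simp add: force_def transport_term_def metric_term_def distrib_right left_diff_distrib
        sum.distrib sum_subtractf) (simp add: field_simps)
qed

text \<open>The magnetic force does no work, because \<open>d mu\<close> is alternating.\<close>

lemma sum_magnetic: "(\<Sum>l\<in>UNIV. w $ l * magnetic y w l) = 0"
proof -
  let ?S = "\<Sum>l\<in>UNIV. \<Sum>k\<in>UNIV. w $ l * (w $ k * partial k (mu l) y)"
  have "(\<Sum>l\<in>UNIV. \<Sum>k\<in>UNIV. w $ l * (w $ k * partial l (mu k) y)) = ?S"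
    by (subst sum.swap) (simp add: mult_ac)
  then show ?thesis
    by (simp add: magnetic_def sum_distrib_left right_diff_distrib sum_subtractf)
qed

lemma sum_transport: "(\<Sum>l\<in>UNIV. w $ l * transport_term y w l) = (\<Sum>l\<in>UNIV. w $ l * metric_term y w l)"
  unfolding transport_term_def metric_term_def sum_distrib_left
  by (subst sum.swap) (simp add: mult_ac)

lemma sum_accel_momentum:
  assumes "y \<in> \<Omega>"
  shows "(\<Sum>l\<in>UNIV. accel y w $ l * momentum y w l) = (\<Sum>l\<in>UNIV. w $ l * force y w $ l)"
proof -
  have "(\<Sum>l\<in>UNIV. accel y w $ l * momentum y w l) =
      (\<Sum>l\<in>UNIV. \<Sum>k\<in>UNIV. w $ k * (gm k l y * accel y w $ l))"
    unfolding momentum_def sum_distrib_left by (simp add: gm_sym[OF assms, of _ _] mult_ac)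
  also have "\<dots> = (\<Sum>k\<in>UNIV. w $ k * (gmat y *v accel y w) $ k)"
    by (subst sum.swap) (simp add: sum_distrib_left[symmetric] matrix_vector_mult_def gmat_def)
  finally show ?thesis by (simp add: gmat_accel[OF assms])
qed

context
  fixes T y w
  assumes sol: "solution T y w"
begin

lemma sol_nth:
  assumes "t \<in> {0..T}"
  shows "((\<lambda>s. y s $ l) has_real_derivative w t $ l) (at t within {0..T})"
    and "((\<lambda>s. w s $ l) has_real_derivative accel (y t) (w t) $ l) (at t within {0..T})"
  using sol assms bounded_linear.has_vector_derivative[OF bounded_linear_vec_nth]
  unfolding solution_def has_real_derivative_iff_has_vector_derivative by blast+

lemma sol_dom: "t \<in> {0..T} \<Longrightarrow> y t \<in> \<Omega>"
  using sol by (auto simp: solution_def)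

lemma sol_curve:
  assumes "t \<in> {0..T}" "analytic_at f (y t)"
  shows "((\<lambda>s. f (y s)) has_real_derivative (\<Sum>i\<in>UNIV. partial i f (y t) * w t $ i)) (at t within {0..T})"
  by (rule analytic_curve_derivative) (use assms sol in \<open>auto simp: solution_def\<close>)

text \<open>The transport term produced by differentiating \<open>gm\<close> along the motion
  cancels the one in the force, which leaves the Euler-Lagrange equation for the conjugate variable
  of the kinetic energy.\<close>

lemma sol_momentum:
  assumes t: "t \<in> {0..T}"
  shows "((\<lambda>s. momentum (y s) (w s) l) has_real_derivative
    (1/2) * metric_term (y t) (w t) l - partial l u (y t) - magnetic (y t) (w t) l) (at t within {0..T})"
proof -
  have "((\<lambda>s. momentum (y s) (w s) l) has_real_derivative
     (\<Sum>k\<in>UNIV. (\<Sum>j\<in>UNIV. partial j (gm l k) (y t) * w t $ j) * w t $ k +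
        accel (y t) (w t) $ k * gm l k (y t))) (at t within {0..T})"
    unfolding momentum_def
    by (intro DERIV_sum DERIV_mult sol_curve sol_nth t analytic_gm sol_dom)
  also have "(\<Sum>k\<in>UNIV. (\<Sum>j\<in>UNIV. partial j (gm l k) (y t) * w t $ j) * w t $ k +
        accel (y t) (w t) $ k * gm l k (y t)) = transport_term (y t) (w t) l + (gmat (y t) *v accel (y t) (w t)) $ l"
  proof -
    have "(\<Sum>k\<in>UNIV. (\<Sum>j\<in>UNIV. partial j (gm l k) (y t) * w t $ j) * w t $ k) = transport_term (y t) (w t) l"
      unfolding transport_term_def sum_distrib_right by (rule sum.swap)
    then show ?thesis by (simp add: sum.distrib matrix_vector_mult_def gmat_def mult.commute)
  qed
  also have "\<dots> = (1/2) * metric_term (y t) (w t) l - partial l u (y t) - magnetic (y t) (w t) l"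
    using sol_dom[OF t] by (simp add: gmat_accel force_eq)
  finally show ?thesis .
qed

text \<open>Contracted with \<open>w\<close>, the transport and metric terms coincide and cancel and
  the magnetic terms vanish; what remains are gradient terms of opposite sign.\<close>

lemma energy_constant:
  assumes "t \<in> {0..T}"
  shows "energy_at (y t) (w t) = energy_at (y 0) (w 0)"
proof -
  have "((\<lambda>s. energy_at (y s) (w s)) has_real_derivative 0) (at s within {0..T})" if s: "s \<in> {0..T}" for s
  proof -
    let ?p' = "\<lambda>l. (1/2) * metric_term (y s) (w s) l - partial l u (y s) - magnetic (y s) (w s) l"
    let ?p = "momentum (y s) (w s)" and ?w = "w s" and ?a = "accel (y s) (w s)"
    have "((\<lambda>s. energy_at (y s) (w s)) has_real_derivative
       (1/2) * (\<Sum>l\<in>UNIV. ?a $ l * ?p l + ?p' l * ?w $ l) + (\<Sum>i\<in>UNIV. partial i u (y s) * ?w $ i)) (at s within {0..T})"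
      unfolding energy_at_def
      by (intro DERIV_add DERIV_cmult DERIV_sum DERIV_mult sol_curve sol_nth sol_momentum s analytic_u sol_dom)
    moreover have "(\<Sum>l\<in>UNIV. ?a $ l * ?p l + ?p' l * ?w $ l) = (\<Sum>l\<in>UNIV. ?w $ l * force (y s) ?w $ l) + (\<Sum>l\<in>UNIV. ?p' l * ?w $ l)"
      by (simp add: sum.distrib sum_accel_momentum[OF sol_dom[OF s]])
    moreover have "(\<Sum>l\<in>UNIV. ?w $ l * force (y s) ?w $ l) = - (\<Sum>l\<in>UNIV. ?w $ l * transport_term (y s) ?w l)
        + (1/2) * (\<Sum>l\<in>UNIV. ?w $ l * metric_term (y s) ?w l) - (\<Sum>l\<in>UNIV. partial l u (y s) * ?w $ l) - (\<Sum>l\<in>UNIV. ?w $ l * magnetic (y s) ?w l)"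
      unfolding force_eq[OF sol_dom[OF s]]
      by (simp add: algebra_simps sum.distrib sum_subtractf sum_negf sum_distrib_left)
    moreover have "(\<Sum>l\<in>UNIV. ?p' l * ?w $ l) = (1/2) * (\<Sum>l\<in>UNIV. ?w $ l * metric_term (y s) ?w l)
        - (\<Sum>l\<in>UNIV. partial l u (y s) * ?w $ l) - (\<Sum>l\<in>UNIV. ?w $ l * magnetic (y s) ?w l)"
      by (simp add: algebra_simps sum.distrib sum_subtractf sum_distrib_left)
    ultimately show ?thesis by (simp add: sum_transport sum_magnetic)
  qed
  then obtain c where "\<And>s. s \<in> {0..T} \<Longrightarrow> energy_at (y s) (w s) = c"
    using has_field_derivative_zero_constant[of "{0..T}" "\<lambda>s. energy_at (y s) (w s)"] by auto
  moreover have "0 \<in> {0..T}" using assms by auto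
  ultimately show ?thesis using assms by metis
qed

end

text \<open>
  Here \<open>k2\<close> is the degree minus two, and the radial weight \<open>\<bar>y\<bar>\<^bsup>3-k\<^esup>\<close> is written \<open>\<rho> / \<rho> ^ k2\<close> since its
  exponent may be negative. The constant \<open>M\<close> is chosen so that the gain \<open>M q \<bar>grad u\<bar>\<^sup>2\<close> exceeds the error
  \<open>C2\<close> in Euler's identity plus the part of the magnetic term that is not absorbed by the kinetic energy.
\<close>

lemma growth_pointwise:
  fixes y w :: "real ^ 'n" and C0 C1 C2 C3 c lam q q' :: real and m k2 :: nat
  defines "N \<equiv> real CARD('n)" and "\<rho> \<equiv> norm y"
  defines "M \<equiv> (C2 + 4 * N\<^sup>2 * C3) / c"
  assumes y0: "y \<noteq> 0" "\<rho> \<le> 1"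
    and nn: "C0 \<ge> 0" "C1 \<ge> 0" "C2 \<ge> 0" "C3 \<ge> 0" "c > 0"
    and gB: "\<And>i j. \<bar>gm i j y\<bar> \<le> C0" and dgB: "\<And>l i j. \<bar>partial l (gm i j) y\<bar> \<le> C0"
    and duB: "\<And>l. \<bar>partial l u y\<bar> \<le> C1 * \<rho> ^ (k2 + 1)"
    and dduB: "\<And>j l. \<bar>partial j (partial l u) y\<bar> \<le> C1 * \<rho> ^ k2"
    and eul: "\<bar>(\<Sum>i\<in>UNIV. y $ i * partial i u y) - (real k2 + 2) * u y\<bar> \<le> C2 * \<rho> ^ (k2 + 3)"
    and nondeg: "c * \<rho> ^ (2 * k2 + 2) \<le> (\<Sum>i\<in>UNIV. (partial i u y)\<^sup>2)"
    and muB: "\<And>j l. \<bar>partial j (mu l) y\<bar> \<le> C3 * \<rho> ^ m" and m: "2 * m \<ge> k2 + 2"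
    and coerc: "lam * (norm w)\<^sup>2 \<le> (\<Sum>l\<in>UNIV. w $ l * momentum y w l)"
    and small1: "M * C1 * \<rho> \<le> 1"
    and small2: "(M * N * ((real k2 + 1) * C1 + N * C1) * N * C0 + N ^ 3 * C0 + 4 * N\<^sup>2 * C3) * \<rho> \<le> lam"
    and q: "q = \<rho> / \<rho> ^ k2" and q': "\<bar>q'\<bar> \<le> (real k2 + 1) * norm w / \<rho> ^ k2"
  shows "- (real k2 + 2) * u y \<le> (\<Sum>l\<in>UNIV.
      (w $ l - M * (q' * partial l u y + (\<Sum>j\<in>UNIV. partial j (partial l u) y * w $ j) * q)) * momentum y w l +
      ((1/2) * metric_term y w l - partial l u y - magnetic y w l) * (y $ l - M * (q * partial l u y)))"
proof -
  define v where "v = norm w"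
  have rho: "\<rho> > 0" "v \<ge> 0" "N \<ge> 0" "M \<ge> 0" using y0 nn by (auto simp: \<rho>_def v_def N_def M_def)
  have wv: "\<bar>w $ i\<bar> \<le> v" for i unfolding v_def by (rule component_le_norm_cart)
  have yr: "\<bar>y $ i\<bar> \<le> \<rho>" for i unfolding \<rho>_def by (rule component_le_norm_cart)
  have sum_bound: "\<bar>\<Sum>i\<in>(UNIV :: 'n set). f i\<bar> \<le> N * B" if "\<And>i. \<bar>f i\<bar> \<le> B" for f B
  proof -
    have "\<bar>\<Sum>i\<in>(UNIV :: 'n set). f i\<bar> \<le> (\<Sum>i\<in>(UNIV :: 'n set). \<bar>f i\<bar>)" by (rule sum_abs)
    also have "\<dots> \<le> (\<Sum>i\<in>(UNIV :: 'n set). B)" by (rule sum_mono) (rule that)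
    finally show ?thesis by (simp add: N_def)
  qed
  have mul: "\<bar>a * b\<bar> \<le> A * B" if "\<bar>a\<bar> \<le> A" "\<bar>b\<bar> \<le> B" for a b A B :: real
    unfolding abs_mult using that by (intro mult_mono) auto
  let ?p = "momentum y w"
  define Z where "Z l = q' * partial l u y + (\<Sum>j\<in>UNIV. partial j (partial l u) y * w $ j) * q" for l
  define X where "X l = y $ l - M * (q * partial l u y)" for l
  have pB: "\<bar>?p l\<bar> \<le> N * (C0 * v)" for l
    unfolding momentum_def by (intro sum_bound mul gB wv)
  \<comment> \<open>In the application \<open>M * Z l\<close> is the time derivative of the
    correction in \<open>X\<close>. The weight makes it of size \<open>\<rho> * v\<close>, so its
    product with the momentum is small against the kinetic energy.\<close>
  have ZB: "\<bar>Z l\<bar> \<le> ((real k2 + 1) * C1 + N * C1) * (\<rho> * v)" for l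
  proof -
    have "\<bar>q' * partial l u y\<bar> \<le> ((real k2 + 1) * v / \<rho> ^ k2) * (C1 * \<rho> ^ (k2 + 1))"
      unfolding v_def by (rule mul[OF q' duB])
    also have "\<dots> = (real k2 + 1) * C1 * (\<rho> * v)" using rho(1) by simp
    finally have 1: "\<bar>q' * partial l u y\<bar> \<le> (real k2 + 1) * C1 * (\<rho> * v)" .
    have "\<bar>(\<Sum>j\<in>UNIV. partial j (partial l u) y * w $ j) * q\<bar> \<le> (N * ((C1 * \<rho> ^ k2) * v)) * (\<rho> / \<rho> ^ k2)"
      using rho(1) by (intro mul sum_bound dduB wv) (auto simp: q)
    also have "\<dots> = N * C1 * (\<rho> * v)" using rho(1) by simp
    finally have 2: "\<bar>(\<Sum>j\<in>UNIV. partial j (partial l u) y * w $ j) * q\<bar> \<le> N * C1 * (\<rho> * v)" .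
    show ?thesis unfolding Z_def using 1 2 by (simp add: distrib_right)
  qed
  \<comment> \<open>\<open>small1\<close> keeps the correction below \<open>\<rho>\<close>, hence
    \<open>X\<close> is of the size of \<open>y\<close>.\<close>
  have XB: "\<bar>X l\<bar> \<le> 2 * \<rho>" for l
  proof -
    have "\<bar>q * partial l u y\<bar> \<le> (\<rho> / \<rho> ^ k2) * (C1 * \<rho> ^ (k2 + 1))"
      using rho(1) by (intro mul duB) (auto simp: q)
    also have "\<dots> = C1 * \<rho> * \<rho>" using rho(1) by simp
    finally have "M * \<bar>q * partial l u y\<bar> \<le> M * (C1 * \<rho> * \<rho>)" using rho(4) by (rule mult_left_mono)
    also have "\<dots> \<le> \<rho>" using mult_right_mono[OF small1, of \<rho>] rho(1) by (simp add: mult_ac)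
    finally have "\<bar>M * (q * partial l u y)\<bar> \<le> \<rho>" using rho(4) by (simp add: abs_mult)
    then show ?thesis unfolding X_def using yr[of l] by linarith
  qed
  have e1: "\<bar>\<Sum>l\<in>UNIV. M * Z l * ?p l\<bar> \<le> (M * N * ((real k2 + 1) * C1 + N * C1) * N * C0) * (\<rho> * v\<^sup>2)"
  proof -
    have "\<bar>\<Sum>l\<in>UNIV. M * Z l * ?p l\<bar> \<le> N * (M * (((real k2 + 1) * C1 + N * C1) * (\<rho> * v)) * (N * (C0 * v)))"
      using rho(4) by (intro sum_bound mul ZB pB) simp
    then show ?thesis by (simp add: power2_eq_square mult_ac)
  qed
  have e2: "\<bar>\<Sum>l\<in>UNIV. (1/2) * metric_term y w l * X l\<bar> \<le> N ^ 3 * C0 * (\<rho> * v\<^sup>2)"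
  proof -
    have "\<bar>\<Sum>l\<in>UNIV. (1/2) * metric_term y w l * X l\<bar> \<le> N * ((1/2) * (N * (N * (C0 * v * v))) * (2 * \<rho>))"
      unfolding metric_term_def by (intro sum_bound mul dgB wv XB) simp
    then show ?thesis by (simp add: power2_eq_square power3_eq_cube mult_ac)
  qed
  \<comment> \<open>The product \<open>v * \<rho> ^ m\<close> splits into a kinetic part and
    \<open>\<rho> ^ (2 * m)\<close>; the assumption \<open>m\<close>, which encodes weak magnetism,
    turns the latter into a quantity of the order of the Euler remainder.\<close>
  have e3: "\<bar>\<Sum>l\<in>UNIV. magnetic y w l * X l\<bar> \<le> 4 * N\<^sup>2 * C3 * (\<rho> * v\<^sup>2) + 4 * N\<^sup>2 * C3 * \<rho> ^ (k2 + 3)"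
  proof -
    have "\<bar>partial k (mu l) y - partial l (mu k) y\<bar> \<le> 2 * (C3 * \<rho> ^ m)" for k l
      using muB[of k l] muB[of l k] by linarith
    then have "\<bar>\<Sum>l\<in>UNIV. magnetic y w l * X l\<bar> \<le> N * ((N * (v * (2 * (C3 * \<rho> ^ m)))) * (2 * \<rho>))"
      unfolding magnetic_def by (intro sum_bound mul wv XB)
    also have "\<dots> = 4 * N\<^sup>2 * C3 * (\<rho> * (v * \<rho> ^ m))" by (simp add: power2_eq_square mult_ac)
    also have "\<dots> \<le> 4 * N\<^sup>2 * C3 * (\<rho> * (v\<^sup>2 + \<rho> ^ (k2 + 2)))"
    proof (intro mult_left_mono)
      have "v * \<rho> ^ m \<le> v\<^sup>2 + (\<rho> ^ m)\<^sup>2"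
      proof -
        have "0 \<le> v * \<rho> ^ m" using rho by simp
        then show ?thesis using sum_squares_bound[of v "\<rho> ^ m"] by linarith
      qed
      also have "(\<rho> ^ m)\<^sup>2 \<le> \<rho> ^ (k2 + 2)"
        unfolding power_mult[symmetric] using m y0(2) rho(1) by (intro power_decreasing) auto
      finally show "v * \<rho> ^ m \<le> v\<^sup>2 + \<rho> ^ (k2 + 2)" by simp
    qed (use rho nn in auto)
    also have "\<dots> = 4 * N\<^sup>2 * C3 * (\<rho> * v\<^sup>2) + 4 * N\<^sup>2 * C3 * \<rho> ^ (k2 + 3)"
      by (simp add: algebra_simps power_add eval_nat_numeral)
    finally show ?thesis .
  qed
  have e4: "(\<Sum>l\<in>UNIV. partial l u y * X l) = (\<Sum>l\<in>UNIV. y $ l * partial l u y) - M * (q * (\<Sum>l\<in>UNIV. (partial l u y)\<^sup>2))"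
    unfolding X_def by (simp add: right_diff_distrib sum_subtractf sum_distrib_left power2_eq_square mult_ac)
  \<comment> \<open>Counting exponents: \<open>q\<close> contributes \<open>1 - k2\<close> and the
    squared gradient \<open>2 * k2 + 2\<close>, together \<open>k2 + 3\<close>, the order in
    \<open>eul\<close>.\<close>
  have e5: "M * (q * (\<Sum>l\<in>UNIV. (partial l u y)\<^sup>2)) \<ge> (C2 + 4 * N\<^sup>2 * C3) * \<rho> ^ (k2 + 3)"
  proof -
    have "q \<ge> 0" using rho(1) by (simp add: q)
    have "(C2 + 4 * N\<^sup>2 * C3) * \<rho> ^ (k2 + 3) = M * (q * (c * \<rho> ^ (2 * k2 + 2)))"
      using rho(1) nn(5) by (simp add: M_def q power_add power_mult power2_eq_square eval_nat_numeral field_simps)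
    also have "\<dots> \<le> M * (q * (\<Sum>l\<in>UNIV. (partial l u y)\<^sup>2))"
      using nondeg rho(4) \<open>q \<ge> 0\<close> by (intro mult_left_mono)
    finally show ?thesis .
  qed
  have e6: "(M * N * ((real k2 + 1) * C1 + N * C1) * N * C0 + N ^ 3 * C0 + 4 * N\<^sup>2 * C3) * (\<rho> * v\<^sup>2) \<le> lam * v\<^sup>2"
    using mult_right_mono[OF small2, of "v\<^sup>2"] by (simp add: mult.assoc)
  have eq: "(\<Sum>l\<in>UNIV. (w $ l - M * Z l) * ?p l +
      ((1/2) * metric_term y w l - partial l u y - magnetic y w l) * X l)
    = (\<Sum>l\<in>UNIV. w $ l * ?p l) - (\<Sum>l\<in>UNIV. M * Z l * ?p l) + (\<Sum>l\<in>UNIV. (1/2) * metric_term y w l * X l)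
      - (\<Sum>l\<in>UNIV. partial l u y * X l) - (\<Sum>l\<in>UNIV. magnetic y w l * X l)"
    by (simp add: left_diff_distrib sum.distrib sum_subtractf)
  \<comment> \<open>By \<open>e6\<close> the kinetic energy pays for all terms in
    \<open>\<rho> * v\<^sup>2\<close>; by \<open>e5\<close> the gradient term pays for the error in
    \<open>eul\<close> and for the rest of \<open>e3\<close>.\<close>
  have "- ((real k2 + 2) * u y) \<le> (\<Sum>l\<in>UNIV. (w $ l - M * Z l) * ?p l +
      ((1/2) * metric_term y w l - partial l u y - magnetic y w l) * X l)"
    unfolding eq e4 using coerc[folded v_def] e1[unfolded distrib_right] e2 e3
      e5[unfolded distrib_right] e6[unfolded distrib_right] eul by linarith
  then show ?thesis unfolding Z_def X_def mult_minus_left .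
qed

end

section \<open>Taylor estimates near the origin\<close>

lemma power_series_order_eventually:
  fixes f :: "real ^ 'n::finite \<Rightarrow> real"
  assumes "has_power_series f a 0" "\<And>\<alpha>. mdeg \<alpha> < m \<Longrightarrow> a \<alpha> = 0"
  shows "\<exists>C\<ge>0. \<forall>\<^sub>F y in nhds 0. \<bar>f y\<bar> \<le> C * norm y ^ m"
proof -
  obtain C r where C: "C \<ge> 0" "r > 0" "\<And>h. norm h \<le> r \<Longrightarrow> norm (f (0 + h)) \<le> C * norm h ^ m"
    using power_series_order_bound[OF assms] by blast
  have "\<forall>\<^sub>F y in nhds 0. \<bar>f y\<bar> \<le> C * norm y ^ m"
    unfolding eventually_nhds_metric
  proof (intro exI[of _ r] conjI allI impI)
    fix y :: "real ^ 'n" assume "dist y 0 < r"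
    then show "\<bar>f y\<bar> \<le> C * norm y ^ m" using C(3)[of y] by simp
  qed (rule C(2))
  with C(1) show ?thesis by blast
qed

lemma eventually_bound_finite:
  fixes f :: "'i::finite \<Rightarrow> 'a \<Rightarrow> real" and g :: "'a \<Rightarrow> real"
  assumes "\<And>i. \<exists>C\<ge>0. \<forall>\<^sub>F y in F. \<bar>f i y\<bar> \<le> C * g y" "\<And>y. g y \<ge> 0"
  shows "\<exists>C\<ge>0. \<forall>\<^sub>F y in F. \<forall>i. \<bar>f i y\<bar> \<le> C * g y"
proof -
  from assms(1) obtain C where C: "\<And>i. C i \<ge> 0" "\<And>i. \<forall>\<^sub>F y in F. \<bar>f i y\<bar> \<le> C i * g y" by metis
  have "\<forall>\<^sub>F y in F. \<forall>i. \<bar>f i y\<bar> \<le> C i * g y"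
    by (rule eventually_all_finite) (rule C(2))
  then have "\<forall>\<^sub>F y in F. \<forall>i. \<bar>f i y\<bar> \<le> (\<Sum>i\<in>UNIV. C i) * g y"
  proof (rule eventually_mono, intro allI)
    fix y i assume *: "\<forall>i. \<bar>f i y\<bar> \<le> C i * g y"
    have "C i \<le> (\<Sum>i\<in>UNIV. C i)" by (rule member_le_sum) (auto simp: C)
    then have "C i * g y \<le> (\<Sum>i\<in>UNIV. C i) * g y" by (rule mult_right_mono) (rule assms(2))
    with * show "\<bar>f i y\<bar> \<le> (\<Sum>i\<in>UNIV. C i) * g y" by (meson order.trans)
  qed
  moreover have "(\<Sum>i\<in>UNIV. C i) \<ge> 0" by (intro sum_nonneg C)
  ultimately show ?thesis by blast
qed

lemma eventually_bound_finite2: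
  fixes f :: "'i::finite \<Rightarrow> 'j::finite \<Rightarrow> 'a \<Rightarrow> real" and g :: "'a \<Rightarrow> real"
  assumes "\<And>i j. \<exists>C\<ge>0. \<forall>\<^sub>F y in F. \<bar>f i j y\<bar> \<le> C * g y" "\<And>y. g y \<ge> 0"
  shows "\<exists>C\<ge>0. \<forall>\<^sub>F y in F. \<forall>i j. \<bar>f i j y\<bar> \<le> C * g y"
  using eventually_bound_finite[where f = "\<lambda>(i, j). f i j" and F = F and g = g] assms by (auto simp: split_paired_all)

lemma partial_order:
  assumes "\<And>\<alpha>. mdeg \<alpha> < Suc m \<Longrightarrow> a \<alpha> = 0" "mdeg \<gamma> < m"
  shows "real (Suc (\<gamma> i)) * a (index_inc i \<gamma>) = (0::real)"
  using assms by simp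

text \<open>In positive degree Euler's identity places critical points in the zero set, so the
  condition says that the real zero cone of the homogeneous part has no singular point outside the
  origin.\<close>

definition nondegenerate :: "(('n::finite \<Rightarrow> nat) \<Rightarrow> real) \<Rightarrow> nat \<Rightarrow> bool" where
  "nondegenerate a k \<longleftrightarrow> (\<forall>x. x \<noteq> 0 \<longrightarrow> (\<exists>i. partial i (hpart a k) x \<noteq> 0))"

text \<open>Compactness of the sphere makes the condition quantitative, both for the growth estimate
  and for the stability of the condition under small changes of the germ.\<close>

lemma nondegenerate_lower_bound:
  fixes a :: "('n::finite \<Rightarrow> nat) \<Rightarrow> real"
  assumes "nondegenerate a k"
  obtains c where "c > 0" "\<And>x. norm x = 1 \<Longrightarrow> c \<le> (\<Sum>i\<in>UNIV. (partial i (hpart a k) x)\<^sup>2)"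
proof -
  let ?S = "sphere (0 :: real ^ 'n) 1" and ?q = "\<lambda>x. \<Sum>i\<in>UNIV. (partial i (hpart a k) x)\<^sup>2"
  have cq: "continuous_on ?S ?q"
    by (intro continuous_on_sum continuous_on_power analytic_continuous_on analytic_at_partial analytic_at_hpart)
  have "(axis undefined 1 :: real ^ 'n) \<in> ?S" by simp
  then have ne: "?S \<noteq> {}" by blast
  from continuous_attains_inf[OF compact_sphere ne cq]
  obtain x0 where x0: "x0 \<in> ?S" "\<forall>x\<in>?S. ?q x0 \<le> ?q x" by (elim bexE)
  show thesis
  proof (rule that)
    from x0(1) have "x0 \<noteq> 0" by auto
    then obtain i where "partial i (hpart a k) x0 \<noteq> 0" using assms by (auto simp: nondegenerate_def)
    then show "?q x0 > 0" by (intro sum_pos2[of _ i]) auto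
    show "?q x0 \<le> ?q x" if "norm x = 1" for x using bspec[OF x0(2), of x] that by simp
  qed
qed

lemma gradient_bounds:
  fixes u :: "real ^ 'n::finite \<Rightarrow> real" and a :: "('n \<Rightarrow> nat) \<Rightarrow> real"
  assumes u: "has_power_series u a 0" and van: "\<And>\<alpha>. mdeg \<alpha> < k2 + 2 \<Longrightarrow> a \<alpha> = 0"
    and nd: "nondegenerate a (k2 + 2)"
  shows "\<exists>C2 c. C2 \<ge> 0 \<and> c > 0 \<and> (\<forall>\<^sub>F y in nhds 0.
      \<bar>(\<Sum>i\<in>UNIV. y $ i * partial i u y) - (real k2 + 2) * u y\<bar> \<le> C2 * norm y ^ (k2 + 3) \<and>
      c * norm y ^ (2 * k2 + 2) \<le> (\<Sum>i\<in>UNIV. (partial i u y)\<^sup>2))"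
proof -
  let ?P = "hpart a (k2 + 2)"
  let ?N = "real CARD('n)"
  \<comment> \<open>\<open>R\<close> has order \<open>k2 + 3\<close> and its partial derivatives
    have order \<open>k2 + 2\<close>, one more than those of \<open>?P\<close>.\<close>
  define R where "R y = u y - ?P y" for y
  let ?b = "\<lambda>\<alpha>. a \<alpha> - (if mdeg \<alpha> = k2 + 2 then a \<alpha> else 0)"
  have R: "has_power_series R ?b 0"
    unfolding R_def by (intro has_power_series_diff u has_power_series_hpart)
  have Rvan: "?b \<alpha> = 0" if "mdeg \<alpha> < Suc (k2 + 2)" for \<alpha>
    using that van[of \<alpha>] by (cases "mdeg \<alpha> = k2 + 2") auto
  obtain CR where CR: "CR \<ge> 0" "\<forall>\<^sub>F y in nhds 0. \<bar>R y\<bar> \<le> CR * norm y ^ Suc (k2 + 2)"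
    using power_series_order_eventually[OF R Rvan] by blast
  have "\<exists>C\<ge>0. \<forall>\<^sub>F y in nhds 0. \<forall>i. \<bar>partial i R y\<bar> \<le> C * norm y ^ (k2 + 2)"
    by (intro eventually_bound_finite power_series_order_eventually[OF has_power_series_partial[OF R]]
        partial_order Rvan) auto
  then obtain CD where CD: "CD \<ge> 0" "\<forall>\<^sub>F y in nhds 0. \<forall>i. \<bar>partial i R y\<bar> \<le> CD * norm y ^ (k2 + 2)" by blast
  let ?q = "\<lambda>x. \<Sum>i\<in>UNIV. (partial i ?P x)\<^sup>2"
  obtain c0 where c0: "c0 > 0" "\<And>x. norm x = 1 \<Longrightarrow> c0 \<le> ?q x"
    using nondegenerate_lower_bound[OF nd] by blast
  have hom: "c0 * norm y ^ (2 * k2 + 2) \<le> ?q y" for y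
  proof (cases "y = 0")
    case False
    have "partial i ?P y = norm y ^ (k2 + 1) * partial i ?P (y /\<^sub>R norm y)" for i
      using partial_hpart_scaleR[of "norm y" i a "k2 + 1" "y /\<^sub>R norm y"] False by simp
    then have "?q y = (norm y ^ (k2 + 1))\<^sup>2 * ?q (y /\<^sub>R norm y)"
      by (simp add: power_mult_distrib sum_distrib_left)
    moreover have "?q (y /\<^sub>R norm y) \<ge> c0" using False by (intro c0(2)) simp
    ultimately have "(norm y ^ (k2 + 1))\<^sup>2 * c0 \<le> ?q y" by (simp add: mult_left_mono)
    also have "(norm y ^ (k2 + 1))\<^sup>2 = norm y ^ (2 * k2 + 2)"
      unfolding power_mult[symmetric] by (simp add: algebra_simps)
    finally show ?thesis by (simp add: mult.commute)
  qed (simp add: sum_nonneg)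
  have anu: "\<forall>\<^sub>F y in nhds 0. analytic_at u y"
    by (rule analytic_at_eventually) (use u in \<open>auto simp: analytic_at_def\<close>)
  \<comment> \<open>Inside radius \<open>d\<close> the squared gradient of \<open>R\<close> is at
    most a quarter of the lower bound for that of \<open>?P\<close>. As the latter is at most twice
    the sum of the squared gradients of \<open>u\<close> and \<open>R\<close>, a quarter of
    \<open>c0\<close> survives for \<open>u\<close>.\<close>
  define d where "d = sqrt (c0 / (4 * (?N * CD\<^sup>2 + 1)))"
  have pos: "4 * (?N * CD\<^sup>2 + 1) > 0" by (simp add: add_nonneg_pos)
  have d1: "d > 0" using c0(1) pos by (simp add: d_def)
  have d2: "?N * CD\<^sup>2 * d\<^sup>2 \<le> c0 / 4"
  proof -
    have "d\<^sup>2 = c0 / (4 * (?N * CD\<^sup>2 + 1))" using c0(1) pos by (simp add: d_def)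
    then have "?N * CD\<^sup>2 * d\<^sup>2 = c0 / 4 * (?N * CD\<^sup>2 / (?N * CD\<^sup>2 + 1))" by simp
    also have "\<dots> \<le> c0 / 4 * 1" using c0(1) pos by (intro mult_left_mono) (auto simp: field_simps)
    finally show ?thesis by simp
  qed
  have small: "\<forall>\<^sub>F y in nhds (0 :: real ^ 'n). norm y < d"
    using d1 by (auto simp: eventually_nhds_metric)
  show ?thesis
  proof (rule exI[of _ "?N * CD + (real k2 + 2) * CR"], rule exI[of _ "c0 / 4"], intro conjI)
    show "0 \<le> ?N * CD + (real k2 + 2) * CR" using CD(1) CR(1) by simp
    show "0 < c0 / 4" using c0(1) by simp
    show "\<forall>\<^sub>F y in nhds 0.
      \<bar>(\<Sum>i\<in>UNIV. y $ i * partial i u y) - (real k2 + 2) * u y\<bar> \<le> (?N * CD + (real k2 + 2) * CR) * norm y ^ (k2 + 3) \<and>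
      c0 / 4 * norm y ^ (2 * k2 + 2) \<le> (\<Sum>i\<in>UNIV. (partial i u y)\<^sup>2)"
      using CR(2) CD(2) anu small
    proof eventually_elim
      case (elim y)
      have pR: "partial i R y = partial i u y - partial i ?P y" for i
        unfolding R_def by (rule partial_diff[OF elim(3) analytic_at_hpart])
      \<comment> \<open>Euler's identity removes the leading part, so only the remainder is left to
        be estimated.\<close>
      have "(\<Sum>i\<in>UNIV. y $ i * partial i u y) - (real k2 + 2) * u y =
          (\<Sum>i\<in>UNIV. y $ i * partial i R y) - (real k2 + 2) * R y"
        using euler_identity[of y a "k2 + 2"]
        by (simp add: pR R_def right_diff_distrib sum_subtractf)
      moreover have "\<bar>\<Sum>i\<in>UNIV. y $ i * partial i R y\<bar> \<le> ?N * (CD * norm y ^ (k2 + 3))"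
      proof -
        have "\<bar>\<Sum>i\<in>UNIV. y $ i * partial i R y\<bar> \<le> (\<Sum>i\<in>(UNIV :: 'n set). norm y * (CD * norm y ^ (k2 + 2)))"
        proof (rule order.trans[OF sum_abs], rule sum_mono)
          fix i
          show "\<bar>y $ i * partial i R y\<bar> \<le> norm y * (CD * norm y ^ (k2 + 2))"
            unfolding abs_mult using elim(2) component_le_norm_cart[of y i] by (intro mult_mono) auto
        qed
        also have "\<dots> = ?N * (CD * norm y ^ (k2 + 3))" by (simp add: eval_nat_numeral mult_ac)
        finally show ?thesis .
      qed
      moreover have "\<bar>(real k2 + 2) * R y\<bar> \<le> (real k2 + 2) * (CR * norm y ^ (k2 + 3))"
      proof -
        have "(real k2 + 2) * \<bar>R y\<bar> \<le> (real k2 + 2) * (CR * norm y ^ (k2 + 3))"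
          using elim(1) by (intro mult_left_mono) (auto simp: eval_nat_numeral)
        then show ?thesis by (simp add: abs_mult)
      qed
      ultimately have A: "\<bar>(\<Sum>i\<in>UNIV. y $ i * partial i u y) - (real k2 + 2) * u y\<bar> \<le> (?N * CD + (real k2 + 2) * CR) * norm y ^ (k2 + 3)"
        unfolding distrib_right[of "?N * CD"] mult.assoc by linarith
      have "(\<Sum>i\<in>UNIV. (partial i R y)\<^sup>2) \<le> (\<Sum>i\<in>(UNIV :: 'n set). (CD * norm y ^ (k2 + 2))\<^sup>2)"
        using elim(2) by (intro sum_mono) (simp add: abs_le_square_iff[symmetric] CD(1))
      also have "\<dots> = ?N * CD\<^sup>2 * (norm y)\<^sup>2 * norm y ^ (2 * k2 + 2)"
        by (simp add: power_mult_distrib power_mult[symmetric] power_add[symmetric] algebra_simps)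
      also have "\<dots> \<le> ?N * CD\<^sup>2 * d\<^sup>2 * norm y ^ (2 * k2 + 2)"
        using elim(4) by (intro mult_right_mono mult_left_mono power_mono) auto
      also have "\<dots> \<le> c0 / 4 * norm y ^ (2 * k2 + 2)" by (intro mult_right_mono d2) simp
      finally have B1: "(\<Sum>i\<in>UNIV. (partial i R y)\<^sup>2) \<le> c0 / 4 * norm y ^ (2 * k2 + 2)" .
      have "?q y \<le> (\<Sum>i\<in>UNIV. 2 * (partial i u y)\<^sup>2 + 2 * (partial i R y)\<^sup>2)"
      proof (rule sum_mono)
        fix i
        have "(partial i ?P y)\<^sup>2 = (partial i u y - partial i R y)\<^sup>2" by (simp add: pR)
        also have "\<dots> \<le> 2 * (partial i u y)\<^sup>2 + 2 * (partial i R y)\<^sup>2"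
          using zero_le_power2[of "partial i u y + partial i R y"] by (simp add: power2_eq_square algebra_simps)
        finally show "(partial i ?P y)\<^sup>2 \<le> 2 * (partial i u y)\<^sup>2 + 2 * (partial i R y)\<^sup>2" .
      qed
      then have "?q y \<le> 2 * (\<Sum>i\<in>UNIV. (partial i u y)\<^sup>2) + 2 * (\<Sum>i\<in>UNIV. (partial i R y)\<^sup>2)"
        by (simp add: sum.distrib sum_distrib_left)
      then have B: "c0 / 4 * norm y ^ (2 * k2 + 2) \<le> (\<Sum>i\<in>UNIV. (partial i u y)\<^sup>2)"
        using hom[of y] B1 by (simp add: field_simps)
      from A B show ?case ..
    qed
  qed
qed

text \<open>The factor is the power \<open>1 - k\<close> of the norm, and the norm of
  \<open>y\<close> changes no faster than \<open>y\<close> itself.\<close>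

lemma radial_factor_derivative:
  fixes y :: "real \<Rightarrow> 'a::real_inner"
  assumes "(y has_vector_derivative w) (at t within S)" "y t \<noteq> 0"
  shows "\<exists>q'. ((\<lambda>s. norm (y s) / norm (y s) ^ k) has_real_derivative q') (at t within S) \<and>
    \<bar>q'\<bar> \<le> (real k + 1) * norm w / norm (y t) ^ k"
proof -
  define n' where "n' = (y t \<bullet> w) / norm (y t)"
  let ?n = "norm (y t)"
  have n: "?n > 0" using assms(2) by simp
  have "((\<lambda>s. norm (y s)) has_derivative (\<lambda>h. (h *\<^sub>R w) \<bullet> sgn (y t))) (at t within S)"
    by (rule has_derivative_compose[OF assms(1)[unfolded has_vector_derivative_def] has_derivative_norm[OF assms(2)]])
  also have "(\<lambda>h. (h *\<^sub>R w) \<bullet> sgn (y t)) = (*) n'"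
    by (rule ext) (simp add: n'_def sgn_div_norm divide_inverse inner_commute mult_ac)
  finally have dn: "((\<lambda>s. norm (y s)) has_real_derivative n') (at t within S)"
    by (simp add: has_field_derivative_def)
  have n'B: "\<bar>n'\<bar> \<le> norm w"
    using Cauchy_Schwarz_ineq2[of "y t" w] n by (simp add: n'_def abs_divide field_simps)
  define q' where "q' = (n' * ?n ^ k - ?n * (real k * (n' * ?n ^ (k - 1)))) / (?n ^ k * ?n ^ k)"
  have "((\<lambda>s. norm (y s) / norm (y s) ^ k) has_real_derivative q') (at t within S)"
    using DERIV_divide[OF dn DERIV_power[OF dn, of k]] n by (simp add: q'_def)
  moreover have "\<bar>q'\<bar> \<le> (real k + 1) * norm w / ?n ^ k"
  proof -
  have "q' = n' * (1 - real k) / ?n ^ k"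
    using n by (cases k) (auto simp: q'_def field_simps)
  then have "\<bar>q'\<bar> = \<bar>n'\<bar> * \<bar>1 - real k\<bar> / ?n ^ k" by (simp add: abs_mult)
  also have "\<dots> \<le> norm w * (real k + 1) / ?n ^ k"
    by (intro divide_right_mono mult_mono n'B) auto
  finally show ?thesis by (simp add: mult.commute)
  qed
  ultimately show ?thesis by blast
qed

section \<open>Escape of subcritical trajectories in coordinates\<close>

context coord_lagrangian begin

text \<open>The closed ball lies in \<open>\<Omega>\<close>, so that the trajectory is defined up to
  and including its exit time; this is the endpoint needed later for the orbit on the
  manifold.\<close>

theorem subcritical_escape:
  assumes dom0: "0 \<in> \<Omega>"
    and u: "has_power_series u a 0" and van: "\<And>\<alpha>. mdeg \<alpha> < k2 + 2 \<Longrightarrow> a \<alpha> = 0"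
    and nd: "nondegenerate a (k2 + 2)"
    and mu: "\<And>i. has_power_series (mu i) (b i) 0" and mvan: "\<And>i \<alpha>. mdeg \<alpha> < Suc m \<Longrightarrow> b i \<alpha> = 0"
    and m: "2 * m \<ge> k2 + 2"
  shows "\<exists>r>0. cball 0 r \<subseteq> \<Omega> \<and> (\<forall>y0 w0. norm y0 < r \<and> energy_at y0 w0 < 0 \<longrightarrow>
    (\<exists>T\<ge>0. \<exists>y w. solution T y w \<and> y 0 = y0 \<and> w 0 = w0 \<and> r \<le> norm (y T)))"
proof -
  let ?N = "real CARD('n)"
  have an0: "\<exists>a. has_power_series f a 0" if "analytic_at f 0" for f :: "real ^ 'n \<Rightarrow> real"
    using that by (simp add: analytic_at_def)
  have bdd: "\<exists>C\<ge>0. \<forall>\<^sub>F y in nhds 0. \<bar>f y\<bar> \<le> C * 1" if "analytic_at f 0" for f :: "real ^ 'n \<Rightarrow> real"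
  proof -
    from an0[OF that] obtain c where "has_power_series f c 0" ..
    from power_series_order_eventually[OF this, of 0] show ?thesis by simp
  qed
  note pu = has_power_series_partial[OF u]
  have "\<exists>C\<ge>0. \<forall>\<^sub>F y in nhds 0. \<forall>i j. \<bar>gm i j y\<bar> \<le> C * 1"
    by (intro eventually_bound_finite2 bdd analytic_gm dom0) simp
  then obtain G0 where G0: "G0 \<ge> 0" "\<forall>\<^sub>F y in nhds 0. \<forall>i j. \<bar>gm i j y\<bar> \<le> G0 * 1" by blast
  have "\<exists>C\<ge>0. \<forall>\<^sub>F y in nhds 0. \<forall>p l. \<bar>partial l (gm (fst p) (snd p)) y\<bar> \<le> C * 1"
    by (intro eventually_bound_finite2 bdd analytic_at_partial analytic_gm dom0) simp
  then obtain G1 where G1: "G1 \<ge> 0" "\<forall>\<^sub>F y in nhds 0. \<forall>p l. \<bar>partial l (gm (fst p) (snd p)) y\<bar> \<le> G1 * 1" by blast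
  have "\<exists>C\<ge>0. \<forall>\<^sub>F y in nhds 0. \<forall>l. \<bar>partial l u y\<bar> \<le> C * norm y ^ (k2 + 1)"
    by (intro eventually_bound_finite power_series_order_eventually[OF pu] partial_order van) auto
  then obtain D1 where D1: "D1 \<ge> 0" "\<forall>\<^sub>F y in nhds 0. \<forall>l. \<bar>partial l u y\<bar> \<le> D1 * norm y ^ (k2 + 1)" by blast
  have "\<exists>C\<ge>0. \<forall>\<^sub>F y in nhds 0. \<forall>j l. \<bar>partial j (partial l u) y\<bar> \<le> C * norm y ^ k2"
    by (intro eventually_bound_finite2 power_series_order_eventually[OF has_power_series_partial[OF pu]]
        partial_order van) auto
  then obtain D2 where D2: "D2 \<ge> 0" "\<forall>\<^sub>F y in nhds 0. \<forall>j l. \<bar>partial j (partial l u) y\<bar> \<le> D2 * norm y ^ k2" by blast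
  obtain C2 c where C2: "C2 \<ge> 0" "c > 0" "\<forall>\<^sub>F y in nhds 0.
      \<bar>(\<Sum>i\<in>UNIV. y $ i * partial i u y) - (real k2 + 2) * u y\<bar> \<le> C2 * norm y ^ (k2 + 3) \<and>
      c * norm y ^ (2 * k2 + 2) \<le> (\<Sum>i\<in>UNIV. (partial i u y)\<^sup>2)"
    using gradient_bounds[OF u van nd] by blast
  have "\<exists>C\<ge>0. \<forall>\<^sub>F y in nhds 0. \<forall>j l. \<bar>partial j (mu l) y\<bar> \<le> C * norm y ^ m"
    by (intro eventually_bound_finite2 power_series_order_eventually[OF has_power_series_partial[OF mu]]
        partial_order mvan) auto
  then obtain C3 where C3: "C3 \<ge> 0" "\<forall>\<^sub>F y in nhds 0. \<forall>j l. \<bar>partial j (mu l) y\<bar> \<le> C3 * norm y ^ m" by blast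
  obtain Cu where Cu: "Cu \<ge> 0" "\<forall>\<^sub>F y in nhds 0. \<bar>u y\<bar> \<le> Cu * 1"
    using bdd[OF analytic_u[OF dom0]] by blast
  define C0 where "C0 = max G0 G1"
  define C1 where "C1 = max D1 D2"
  have nn: "C0 \<ge> 0" "C1 \<ge> 0" using G0(1) D1(1) by (auto simp: C0_def C1_def)
  define good where "good y \<longleftrightarrow> y \<in> \<Omega> \<and> (\<forall>i j. \<bar>gm i j y\<bar> \<le> C0) \<and> (\<forall>l i j. \<bar>partial l (gm i j) y\<bar> \<le> C0)
    \<and> (\<forall>l. \<bar>partial l u y\<bar> \<le> C1 * norm y ^ (k2 + 1)) \<and> (\<forall>j l. \<bar>partial j (partial l u) y\<bar> \<le> C1 * norm y ^ k2)
    \<and> \<bar>(\<Sum>i\<in>UNIV. y $ i * partial i u y) - (real k2 + 2) * u y\<bar> \<le> C2 * norm y ^ (k2 + 3)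
    \<and> c * norm y ^ (2 * k2 + 2) \<le> (\<Sum>i\<in>UNIV. (partial i u y)\<^sup>2)
    \<and> (\<forall>j l. \<bar>partial j (mu l) y\<bar> \<le> C3 * norm y ^ m) \<and> \<bar>u y\<bar> \<le> Cu" for y
  have "\<forall>\<^sub>F y in nhds 0. y \<in> \<Omega>" using open_dom dom0 by (rule eventually_nhds_in_open)
  with G0(2) G1(2) D1(2) D2(2) C2(3) C3(2) Cu(2) have "\<forall>\<^sub>F y in nhds 0. good y"
  proof eventually_elim
    case (elim y)
    have m1: "\<bar>x\<bar> \<le> C1 * z" if "\<bar>x\<bar> \<le> D1 * z \<or> \<bar>x\<bar> \<le> D2 * z" "z \<ge> 0" for x z :: real
      using that mult_right_mono[of D1 C1 z] mult_right_mono[of D2 C1 z] by (auto simp: C1_def)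
    have m0: "\<bar>x\<bar> \<le> C0" if "\<bar>x\<bar> \<le> G0 * 1 \<or> \<bar>x\<bar> \<le> G1 * 1" for x :: real
      using that by (auto simp: C0_def)
    have "\<bar>partial l (gm i j) y\<bar> \<le> C0" for l i j using elim(2) m0[of "partial l (gm i j) y"] by auto
    moreover have "\<bar>gm i j y\<bar> \<le> C0" for i j using elim(1) m0[of "gm i j y"] by auto
    moreover have "\<bar>partial l u y\<bar> \<le> C1 * norm y ^ (k2 + 1)" for l using elim(3) by (intro m1) auto
    moreover have "\<bar>partial j (partial l u) y\<bar> \<le> C1 * norm y ^ k2" for j l using elim(4) by (intro m1) auto
    ultimately show ?case unfolding good_def using elim(5-8) by simp
  qed
  then obtain d where d: "d > 0" "\<And>y. dist y 0 < d \<Longrightarrow> good y" by (auto simp: eventually_nhds_metric)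
  define r0 where "r0 = min 1 (d / 2)"
  have r0: "r0 > 0" "r0 \<le> 1" using d(1) by (auto simp: r0_def)
  have good: "good y" if "norm y \<le> r0" for y
    using d(1) that by (intro d(2)) (auto simp: r0_def)
  have r0_dom: "cball 0 r0 \<subseteq> \<Omega>" using good by (auto simp: good_def)
  obtain lam where lam: "lam > 0" "\<And>y w. y \<in> cball 0 r0 \<Longrightarrow> lam * (norm w)\<^sup>2 \<le> w \<bullet> (gmat y *v w)"
    using coercive[OF compact_cball r0_dom] by blast
  define M where "M = (C2 + 4 * ?N\<^sup>2 * C3) / c"
  have M: "M \<ge> 0" using C2 C3(1) by (simp add: M_def)
  define Q where "Q = M * ?N * ((real k2 + 1) * C1 + ?N * C1) * ?N * C0 + ?N ^ 3 * C0 + 4 * ?N\<^sup>2 * C3"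
  have Q: "Q \<ge> 0" unfolding Q_def using M nn C3(1) by (intro add_nonneg_nonneg mult_nonneg_nonneg) auto
  \<comment> \<open>The first bound gives the estimates collected in \<open>good\<close>, the other
    two become \<open>small1\<close> and \<open>small2\<close> of \<open>growth_pointwise\<close>.
    The \<open>+ 1\<close> avoids a zero denominator.\<close>
  define r where "r = min r0 (min (1 / (M * C1 + 1)) (lam / (Q + 1)))"
  have r: "r > 0" "r \<le> r0" "M * C1 * r \<le> 1" "Q * r \<le> lam"
  proof -
    have MC: "M * C1 \<ge> 0" using M nn by simp
    show "r > 0" using r0(1) MC Q lam(1) by (simp add: r_def add_nonneg_pos)
    show "r \<le> r0" by (simp add: r_def)
    have "M * C1 * r \<le> M * C1 * (1 / (M * C1 + 1))" using MC by (intro mult_left_mono) (auto simp: r_def)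
    also have "\<dots> \<le> 1" using MC by (simp add: field_simps)
    finally show "M * C1 * r \<le> 1" .
    have "Q * r \<le> Q * (lam / (Q + 1))" using Q by (intro mult_left_mono) (auto simp: r_def)
    also have "\<dots> \<le> lam" using Q lam(1) by (simp add: field_simps)
    finally show "Q * r \<le> lam" .
  qed
  have goodr: "good y" if "norm y \<le> r" for y using good that r(2) by simp
  have r_dom: "cball 0 r \<subseteq> \<Omega>" using goodr by (auto simp: good_def)
  have coerc: "lam * (norm w)\<^sup>2 \<le> (\<Sum>l\<in>UNIV. w $ l * momentum y w l)" if "norm y \<le> r" for y w
    using lam(2)[of y w] that r(2) by (simp add: quad_momentum)
  have u0: "u 0 = 0" using has_power_series_value[OF u] van[of "\<lambda>_. 0"] by simp
  \<comment> \<open>Negative energy bounds the kinetic part by \<open>- u \<le> Cu\<close>. The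
    added 1 makes the velocity bound strict, so a trajectory cannot leave the truncated region
    through its velocity.\<close>
  define R where "R = sqrt (2 * Cu / lam) + 1"
  have kinetic: "norm w < R" "u y \<le> energy_at y w" if "norm y \<le> r" "energy_at y w < 0" for y w
  proof -
    have 1: "lam * (norm w)\<^sup>2 / 2 + u y \<le> energy_at y w"
      using coerc[OF that(1), of w] by (simp add: energy_at_def)
    have "\<bar>u y\<bar> \<le> Cu" using goodr[OF that(1)] by (simp add: good_def)
    with 1 that(2) have "lam * (norm w)\<^sup>2 \<le> 2 * Cu" by linarith
    then have "(norm w)\<^sup>2 \<le> 2 * Cu / lam" using lam(1) by (simp add: field_simps)
    then have "norm w \<le> sqrt (2 * Cu / lam)" by (rule real_le_rsqrt)
    then show "norm w < R" by (simp add: R_def)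
    have "0 \<le> lam * (norm w)\<^sup>2 / 2" using lam(1) by simp
    with 1 show "u y \<le> energy_at y w" by linarith
  qed
  define X where "X y l = y $ l - M * ((norm y / norm y ^ k2) * partial l u y)" for y l
  define f where "f y w = (\<Sum>l\<in>UNIV. X y l * momentum y w l)" for y w
  have f_bound: "\<bar>f y w\<bar> \<le> ?N * (2 * (?N * (C0 * R)))" if "norm y \<le> r" "norm w \<le> R" for y w
  proof -
    have g: "good y" by (rule goodr[OF that(1)])
    have y1: "norm y \<le> 1" using that(1) r(2) r0(2) by simp
    have "\<bar>X y l * momentum y w l\<bar> \<le> 2 * (?N * (C0 * R))" for l
    proof -
      have "\<bar>M * ((norm y / norm y ^ k2) * partial l u y)\<bar> \<le> 1"
      proof (cases "y = 0")
        case False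
        have "\<bar>M * ((norm y / norm y ^ k2) * partial l u y)\<bar> = M * (norm y / norm y ^ k2) * \<bar>partial l u y\<bar>"
          using M by (simp add: abs_mult)
        also have "\<dots> \<le> M * (norm y / norm y ^ k2) * (C1 * norm y ^ (k2 + 1))"
          using g M by (intro mult_left_mono) (auto simp: good_def)
        also have "\<dots> = (M * C1 * norm y) * norm y" using False by simp
        also have "\<dots> \<le> 1 * 1"
        proof (intro mult_mono y1)
          have "M * C1 * norm y \<le> M * C1 * r" using that(1) M nn by (intro mult_left_mono) auto
          with r(3) show "M * C1 * norm y \<le> 1" by simp
        qed auto
        finally show ?thesis by simp
      qed simp
      then have XB: "\<bar>X y l\<bar> \<le> 2" unfolding X_def using component_le_norm_cart[of y l] y1 by linarith
      have "\<bar>momentum y w l\<bar> \<le> (\<Sum>k\<in>(UNIV :: 'n set). C0 * R)"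
        unfolding momentum_def
      proof (rule order.trans[OF sum_abs], rule sum_mono)
        fix k
        show "\<bar>gm l k y * w $ k\<bar> \<le> C0 * R" unfolding abs_mult
          using g component_le_norm_cart[of w k] that(2) nn(1) by (intro mult_mono) (auto simp: good_def)
      qed
      then have "\<bar>momentum y w l\<bar> \<le> ?N * (C0 * R)" by simp
      with XB show ?thesis unfolding abs_mult by (intro mult_mono) auto
    qed
    then have "(\<Sum>l\<in>UNIV. \<bar>X y l * momentum y w l\<bar>) \<le> (\<Sum>l\<in>(UNIV :: 'n set). 2 * (?N * (C0 * R)))"
      by (intro sum_mono)
    then show ?thesis unfolding f_def by (intro order.trans[OF sum_abs]) simp
  qed
  have growth: "\<exists>f'. ((\<lambda>s. f (y s) (w s)) has_real_derivative f') (at t within {0..T}) \<and> - (real k2 + 2) * h \<le> f'"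
    if sol: "solution T y w" and t: "t \<in> {0..T}" and yr: "norm (y t) \<le> r"
      and h: "energy_at (y t) (w t) = h" "h < 0" for T y w t h
  proof -
    have uh: "u (y t) \<le> h" using kinetic(2)[OF yr, of "w t"] h by simp
    \<comment> \<open>Since \<open>u\<close> is negative along the trajectory and zero at the
      origin, the radial weight is differentiable along it.\<close>
    have y0: "y t \<noteq> 0" using uh h(2) u0 by auto
    obtain q' where q': "((\<lambda>s. norm (y s) / norm (y s) ^ k2) has_real_derivative q') (at t within {0..T})"
      "\<bar>q'\<bar> \<le> (real k2 + 1) * norm (w t) / norm (y t) ^ k2"
      using radial_factor_derivative[of y "w t" t "{0..T}" k2] sol t y0 by (auto simp: solution_def)
    let ?f' = "\<Sum>l\<in>UNIV.
      (w t $ l - M * (q' * partial l u (y t) + (\<Sum>j\<in>UNIV. partial j (partial l u) (y t) * w t $ j) * (norm (y t) / norm (y t) ^ k2))) * momentum (y t) (w t) l +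
      ((1/2) * metric_term (y t) (w t) l - partial l u (y t) - magnetic (y t) (w t) l) * X (y t) l"
    have "((\<lambda>s. f (y s) (w s)) has_real_derivative ?f') (at t within {0..T})"
      unfolding f_def
      by (intro DERIV_sum DERIV_mult sol_momentum[OF sol t], unfold X_def,
          intro DERIV_diff DERIV_cmult DERIV_mult q'(1) sol_nth[OF sol t] sol_curve[OF sol t]
            analytic_at_partial analytic_u sol_dom[OF sol t])
    moreover have "- (real k2 + 2) * u (y t) \<le> ?f'"
      unfolding X_def M_def
    proof (rule growth_pointwise)
      have g: "good (y t)" by (rule goodr[OF yr])
      show "y t \<noteq> 0" by (rule y0)
      show "norm (y t) \<le> 1" using yr r(2) r0(2) by simp
      show "\<bar>gm i j (y t)\<bar> \<le> C0" "\<bar>partial l (gm i j) (y t)\<bar> \<le> C0"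
        "\<bar>partial l u (y t)\<bar> \<le> C1 * norm (y t) ^ (k2 + 1)" "\<bar>partial j (partial l u) (y t)\<bar> \<le> C1 * norm (y t) ^ k2"
        "\<bar>partial j (mu l) (y t)\<bar> \<le> C3 * norm (y t) ^ m" for i j l
        using g by (auto simp: good_def)
      show "\<bar>(\<Sum>i\<in>UNIV. y t $ i * partial i u (y t)) - (real k2 + 2) * u (y t)\<bar> \<le> C2 * norm (y t) ^ (k2 + 3)"
        "c * norm (y t) ^ (2 * k2 + 2) \<le> (\<Sum>i\<in>UNIV. (partial i u (y t))\<^sup>2)"
        using g by (auto simp: good_def)
      show "lam * (norm (w t))\<^sup>2 \<le> (\<Sum>l\<in>UNIV. w t $ l * momentum (y t) (w t) l)" by (rule coerc[OF yr])
      have "M * C1 * norm (y t) \<le> M * C1 * r" using yr M nn by (intro mult_left_mono) auto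
      with r(3) show "(C2 + 4 * ?N\<^sup>2 * C3) / c * C1 * norm (y t) \<le> 1" by (simp add: M_def)
      have "Q * norm (y t) \<le> Q * r" using yr Q by (intro mult_left_mono) auto
      with r(4) show "((C2 + 4 * ?N\<^sup>2 * C3) / c * ?N * ((real k2 + 1) * C1 + ?N * C1) * ?N * C0 + ?N ^ 3 * C0 + 4 * ?N\<^sup>2 * C3) * norm (y t) \<le> lam"
        by (simp add: Q_def M_def)
    qed (use nn C2 C3 m q'(2) in auto)
    moreover have "- (real k2 + 2) * h \<le> - (real k2 + 2) * u (y t)"
      using mult_left_mono[OF uh, of "real k2 + 2"] by (simp only: mult_minus_left) simp
    ultimately show ?thesis by (meson order.trans)
  qed
  show ?thesis
  proof (rule exI[of _ r], intro conjI allI impI r(1) r_dom)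
    fix y0 w0 assume *: "norm y0 < r \<and> energy_at y0 w0 < 0"
    define h where "h = energy_at y0 w0"
    have h: "h < 0" using * by (simp add: h_def)
    have w0: "norm w0 < R" using kinetic(1)[of y0 w0] * by simp
    obtain y w where yw: "y 0 = y0" "w 0 = w0" "continuous_on {0..} y" "continuous_on {0..} w"
      and sol: "\<And>T. T \<ge> 0 \<Longrightarrow> (\<And>t. t \<in> {0..T} \<Longrightarrow> norm (y t) \<le> r \<and> norm (w t) \<le> R) \<Longrightarrow> solution T y w"
      using truncated_solution[OF r_dom conjunct1[OF *] w0] by metis
    \<comment> \<open>Times at which the truncated solution has reached the boundary. If there were
      none, it would solve the original equation forever while \<open>f\<close> stays
      bounded.\<close>
    define S where "S = {t\<in>{0..}. r \<le> norm (y t) \<or> R \<le> norm (w t)}"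
    have "S \<noteq> {}"
    proof
      assume "S = {}"
      then have inside: "norm (y t) < r \<and> norm (w t) < R" if "t \<ge> 0" for t
      proof -
        have "t \<notin> S" using \<open>S = {}\<close> by simp
        with that show ?thesis by (auto simp: S_def)
      qed
      define F where "F = ?N * (2 * (?N * (C0 * R)))"
      \<comment> \<open>Growing at least at rate \<open>- (real k2 + 2) * h\<close>, the function
        \<open>f\<close> would gain \<open>2 * F + 1\<close> by time \<open>T\<close>, more than the
        bound \<open>F\<close> on its absolute value permits.\<close>
      define T where "T = (2 * F + 1) / (- (real k2 + 2) * h)"
      have kh: "- (real k2 + 2) * h > 0" using h by (simp add: mult_neg_neg)
      have F0: "\<bar>f (y t) (w t)\<bar> \<le> F" if "t \<ge> 0" for t
        unfolding F_def using inside[OF that] by (intro f_bound) auto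
      have T: "T > 0" unfolding T_def using kh order.trans[OF abs_ge_zero F0[of 0]] by (intro divide_pos_pos) auto
      have so: "solution T y w" by (rule sol) (use T inside in \<open>auto simp: less_imp_le\<close>)
      have "\<forall>t. \<exists>f'. t \<in> {0..T} \<longrightarrow> ((\<lambda>s. f (y s) (w s)) has_real_derivative f') (at t within {0..T}) \<and> - (real k2 + 2) * h \<le> f'"
      proof
        fix t
        show "\<exists>f'. t \<in> {0..T} \<longrightarrow> ((\<lambda>s. f (y s) (w s)) has_real_derivative f') (at t within {0..T}) \<and> - (real k2 + 2) * h \<le> f'"
        proof (cases "t \<in> {0..T}")
          case True
          have "energy_at (y t) (w t) = h" using energy_constant[OF so True] yw by (simp add: h_def)
          moreover have "norm (y t) \<le> r" using inside[of t] True by simp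
          ultimately show ?thesis using growth[OF so True _ _ h] by blast
        qed blast
      qed
      then obtain f' where f': "\<And>t. t \<in> {0..T} \<Longrightarrow> ((\<lambda>s. f (y s) (w s)) has_real_derivative f' t) (at t within {0..T})"
        "\<And>t. t \<in> {0..T} \<Longrightarrow> - (real k2 + 2) * h \<le> f' t" by metis
      have "\<exists>t\<in>{0..T}. f (y T) (w T) - f (y 0) (w 0) = (*) (f' t) (T - 0)"
        by (rule mvt_very_simple) (use T f'(1) in \<open>auto simp: has_field_derivative_def\<close>)
      then obtain t where t: "t \<in> {0..T}" "f (y T) (w T) - f (y 0) (w 0) = f' t * T" by auto
      have "2 * F + 1 \<le> f (y T) (w T) - f (y 0) (w 0)"
      proof -
        have "- (real k2 + 2) * h * T = 2 * F + 1"
          unfolding T_def using kh by (metis less_irrefl nonzero_mult_div_cancel_left times_divide_eq_right)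
        moreover have "- (real k2 + 2) * h * T \<le> f' t * T" using f'(2)[OF t(1)] T by (intro mult_right_mono) auto
        ultimately show ?thesis using t(2) by linarith
      qed
      with F0[of T] F0[of 0] T show False by linarith
    qed
    define T where "T = Inf S"
    have bdd: "bdd_below S" by (rule bdd_belowI[of _ 0]) (auto simp: S_def)
    have clS: "closed S"
    proof -
      have "S = ({0..} \<inter> (\<lambda>t. norm (y t)) -` {r..}) \<union> ({0..} \<inter> (\<lambda>t. norm (w t)) -` {R..})"
        by (auto simp: S_def)
      also have "closed \<dots>"
        by (intro closed_Un continuous_closed_preimage continuous_on_norm yw closed_atLeast)
      finally show ?thesis .
    qed
    have TS: "T \<in> S" unfolding T_def by (rule closed_contains_Inf[OF \<open>S \<noteq> {}\<close> bdd clS])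
    then have T0: "T \<ge> 0" by (simp add: S_def)
    \<comment> \<open>Both inequalities are strict at time 0, so the first exit happens later and
      the solution stays in the closed region up to it.\<close>
    have "T \<noteq> 0" using TS * w0 yw by (auto simp: S_def)
    with T0 have Tpos: "T > 0" by simp
    have before: "norm (y t) \<le> r \<and> norm (w t) \<le> R" if "t \<in> {0..<T}" for t
    proof -
      have "t \<notin> S" using cInf_lower[OF _ bdd, of t] that by (auto simp: T_def[symmetric])
      with that show ?thesis by (auto simp: S_def)
    qed
    have cl: "closure {0..<T} = {0..T}" using Tpos by (rule closure_atLeastLessThan)
    have upto: "norm (y t) \<le> r \<and> norm (w t) \<le> R" if "t \<in> {0..T}" for t
    proof
      show "norm (y t) \<le> r"
        by (rule continuous_le_on_closure[of "{0..<T}" "\<lambda>t. norm (y t)"])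
           (use before that in \<open>auto simp: cl intro!: continuous_on_norm continuous_on_subset[OF yw(3)]\<close>)
      show "norm (w t) \<le> R"
        by (rule continuous_le_on_closure[of "{0..<T}" "\<lambda>t. norm (w t)"])
           (use before that in \<open>auto simp: cl intro!: continuous_on_norm continuous_on_subset[OF yw(4)]\<close>)
    qed
    have so: "solution T y w" by (rule sol[OF T0 upto])
    have TT: "T \<in> {0..T}" using T0 by simp
    \<comment> \<open>Energy conservation gives the strict velocity bound at the exit time, so it is
      the position that has reached the boundary.\<close>
    have "energy_at (y T) (w T) < 0" using energy_constant[OF so TT] yw * by simp
    then have "norm (w T) < R" using kinetic(1) upto[OF TT] by blast
    with TS have "r \<le> norm (y T)" by (auto simp: S_def)
    with so yw T0 show "\<exists>T\<ge>0. \<exists>y w. solution T y w \<and> y 0 = y0 \<and> w 0 = w0 \<and> r \<le> norm (y T)" by blast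
  qed
qed

end

section \<open>Charts and tangent vectors\<close>

text \<open>Inverse of evaluation at \<open>c\<close>: the tangent vector with prescribed components
  in that chart, extended to all charts by the transition derivatives. The basis vectors give
  \<open>coord_vec\<close>.\<close>

definition tvec_of ::
  "('a, 'n::finite) chart set \<Rightarrow> ('a, 'n) chart \<Rightarrow> 'a \<Rightarrow> real ^ 'n \<Rightarrow> ('a, 'n) tvec" where
  "tvec_of \<C> c x w = (\<lambda>d. if d \<in> charts_at \<C> x then frechet_derivative (transition c d) (at (snd c x)) w else 0)"

lemma has_derivative_cong_nhds:
  assumes "(f has_derivative D) (at x)" "\<forall>\<^sub>F y in nhds x. f y = g y"
  shows "(g has_derivative D) (at x)"
proof (rule has_derivative_transform_eventually[OF assms(1)])
  show "\<forall>\<^sub>F y in at x. f y = g y"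
    unfolding eventually_at_filter using assms(2) by (rule eventually_mono) simp
  show "f x = g x" using assms(2) by (rule eventually_nhds_x_imp_x)
qed simp

lemma frechet_derivative_at':
  "(f has_derivative D) (at x) \<Longrightarrow> frechet_derivative f (at x) = D"
  using frechet_derivative_at by metis

lemma coord_vec_eq: "coord_vec \<C> c i x = tvec_of \<C> c x (axis i 1)"
  by (simp add: coord_vec_def tvec_of_def)

context
  fixes \<C> :: "('a::topological_space, 'n::finite) chart set"
  assumes atlas: "analytic_structure \<C>"
begin

lemma chartD:
  assumes "c \<in> \<C>"
  shows "open (fst c)" "open (snd c ` fst c)" "homeomorphism (fst c) (snd c ` fst c) (snd c) (chart_inv c)"
  using atlas assms by (auto simp: analytic_structure_def analytic_atlas_def is_chart_def)

lemma chart_inverse: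
  assumes "c \<in> \<C>"
  shows "x \<in> fst c \<Longrightarrow> chart_inv c (snd c x) = x" "y \<in> snd c ` fst c \<Longrightarrow> snd c (chart_inv c y) = y"
    "y \<in> snd c ` fst c \<Longrightarrow> chart_inv c y \<in> fst c"
  using chartD(3)[OF assms] by (auto simp: homeomorphism_def)

lemma chart_image_open:
  assumes "c \<in> \<C>" "open A"
  shows "open (snd c ` (A \<inter> fst c))"
proof -
  have "snd c ` (A \<inter> fst c) = (snd c ` fst c) \<inter> chart_inv c -` A"
    using chart_inverse[OF assms(1)] by force
  also have "open \<dots>"
    using chartD[OF assms(1)] assms(2) by (auto simp: homeomorphism_def intro: continuous_open_preimage)
  finally show ?thesis .
qed

lemma eventually_chart_inv:
  assumes "c \<in> \<C>" "x \<in> fst c" "eventually P (nhds x)"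
  shows "\<forall>\<^sub>F y in nhds (snd c x). y \<in> snd c ` fst c \<and> P (chart_inv c y)"
proof -
  obtain S where S: "open S" "x \<in> S" "\<And>z. z \<in> S \<Longrightarrow> P z" using assms(3) by (auto simp: eventually_nhds)
  have "open (snd c ` (S \<inter> fst c))" by (rule chart_image_open[OF assms(1) S(1)])
  then show ?thesis
    by (rule eventually_mono[OF eventually_nhds_in_open])
       (use assms(2) S chart_inverse(1)[OF assms(1)] in auto)
qed

lemma eventually_chart:
  assumes "c \<in> \<C>" "x \<in> fst c" "eventually Q (nhds (snd c x))"
  shows "\<forall>\<^sub>F z in nhds x. z \<in> fst c \<and> Q (snd c z)"
proof -
  obtain S where S: "open S" "snd c x \<in> S" "\<And>z. z \<in> S \<Longrightarrow> Q z" using assms(3) by (auto simp: eventually_nhds)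
  have "open (fst c \<inter> snd c -` S)"
    using chartD[OF assms(1)] S(1) by (auto simp: homeomorphism_def intro: continuous_open_preimage)
  then show ?thesis
    by (rule eventually_mono[OF eventually_nhds_in_open]) (use assms(2) S in auto)
qed

lemma transition_differentiable:
  assumes "c \<in> charts_at \<C> x" "d \<in> charts_at \<C> x"
  shows "transition c d differentiable (at (snd c x))"
proof -
  have "analytic_at (\<lambda>y. transition c d y $ i) (snd c x)" for i
    using atlas assms by (auto simp: analytic_structure_def analytic_atlas_def charts_at_def)
  then have "(\<lambda>y. transition c d y $ i) differentiable (at (snd c x))" for i
    by (rule analytic_at_imp_differentiable)
  then show ?thesis
    by (subst differentiable_componentwise_within) (auto simp: Basis_vec_def inner_axis)
qed

lemma transition_has_derivative:
  assumes "c \<in> charts_at \<C> x" "d \<in> charts_at \<C> x"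
  shows "(transition c d has_derivative frechet_derivative (transition c d) (at (snd c x))) (at (snd c x))"
  using transition_differentiable[OF assms] by (simp add: frechet_derivative_works)

lemma transition_value:
  assumes "c \<in> charts_at \<C> x" shows "transition c d (snd c x) = snd d x"
  using assms chart_inverse(1)[of c x] by (simp add: transition_def charts_at_def)

text \<open>The chain rule as a cocycle condition; it is what makes \<open>tvec_of\<close> satisfy
  the compatibility required of a tangent vector.\<close>

lemma transition_chain:
  assumes "c \<in> charts_at \<C> x" "d \<in> charts_at \<C> x" "e \<in> charts_at \<C> x"
  shows "frechet_derivative (transition c e) (at (snd c x)) w =
    frechet_derivative (transition d e) (at (snd d x)) (frechet_derivative (transition c d) (at (snd c x)) w)"
proof -
  let ?D = "\<lambda>a b. frechet_derivative (transition a b) (at (snd a x))"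
  have "(transition d e has_derivative ?D d e) (at (transition c d (snd c x)))"
    using transition_has_derivative[OF assms(2,3)] by (simp add: transition_value[OF assms(1)])
  then have "((\<lambda>y. transition d e (transition c d y)) has_derivative (\<lambda>w. ?D d e (?D c d w))) (at (snd c x))"
    by (rule has_derivative_compose[OF transition_has_derivative[OF assms(1,2)]])
  moreover have "\<forall>\<^sub>F y in nhds (snd c x). transition d e (transition c d y) = transition c e y"
  proof -
    have "eventually (\<lambda>z. z \<in> fst d) (nhds x)"
      using assms(2) chartD(1)[of d] by (intro eventually_nhds_in_open) (auto simp: charts_at_def)
    from eventually_chart_inv[OF _ _ this, of c] assms(1)
    have "\<forall>\<^sub>F y in nhds (snd c x). y \<in> snd c ` fst c \<and> chart_inv c y \<in> fst d" by (simp add: charts_at_def)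
    then show ?thesis
      by (rule eventually_mono) (use assms(2) in \<open>auto simp: transition_def charts_at_def chart_inverse\<close>)
  qed
  ultimately have "(transition c e has_derivative (\<lambda>w. ?D d e (?D c d w))) (at (snd c x))"
    by (rule has_derivative_cong_nhds)
  then show ?thesis by (simp only: frechet_derivative_at')
qed

lemma transition_self:
  assumes "c \<in> charts_at \<C> x" shows "frechet_derivative (transition c c) (at (snd c x)) w = w"
proof -
  have c: "c \<in> \<C>" "x \<in> fst c" using assms by (auto simp: charts_at_def)
  have "\<forall>\<^sub>F y in nhds (snd c x). y \<in> snd c ` fst c"
    using chartD(2)[OF c(1)] c(2) by (intro eventually_nhds_in_open) auto
  then have "\<forall>\<^sub>F y in nhds (snd c x). transition c c y = y"
    by (rule eventually_mono) (auto simp: transition_def chart_inverse[OF c(1)])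
  then have "\<forall>\<^sub>F y in nhds (snd c x). y = transition c c y" by (rule eventually_mono) simp
  with has_derivative_ident have "(transition c c has_derivative (\<lambda>w. w)) (at (snd c x))"
    by (rule has_derivative_cong_nhds)
  then show ?thesis by (simp only: frechet_derivative_at')
qed

lemma tvec_of_in:
  assumes "c \<in> charts_at \<C> x" shows "tvec_of \<C> c x w \<in> tangent_space \<C> x"
  unfolding tangent_space_def
proof (intro CollectI conjI allI impI ballI)
  fix d e assume "d \<in> charts_at \<C> x" "e \<in> charts_at \<C> x"
  then show "tvec_of \<C> c x w e = frechet_derivative (transition d e) (at (snd d x)) (tvec_of \<C> c x w d)"
    unfolding tvec_of_def using transition_chain[OF assms, of d e w] by (simp only: if_True)
qed (simp add: tvec_of_def)

lemma tvec_of_self: "c \<in> charts_at \<C> x \<Longrightarrow> tvec_of \<C> c x w c = w"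
  by (simp add: tvec_of_def transition_self)

lemma tvec_of_eq:
  assumes "c \<in> charts_at \<C> x" "v \<in> tangent_space \<C> x"
  shows "v = tvec_of \<C> c x (v c)"
proof
  fix d
  show "v d = tvec_of \<C> c x (v c) d"
  proof (cases "d \<in> charts_at \<C> x")
    case True
    then have "v d = frechet_derivative (transition c d) (at (snd c x)) (v c)"
      using assms unfolding tangent_space_def by blast
    with True show ?thesis by (simp only: tvec_of_def if_True)
  next
    case False
    then have "v d = 0" using assms(2) unfolding tangent_space_def by blast
    with False show ?thesis by (simp only: tvec_of_def if_False)
  qed
qed

lemma tvec_of_linear:
  assumes "c \<in> charts_at \<C> x"
  shows "tvec_of \<C> c x (a *\<^sub>R w + b *\<^sub>R w') = (\<lambda>d. a *\<^sub>R tvec_of \<C> c x w d + b *\<^sub>R tvec_of \<C> c x w' d)"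
proof
  fix d
  show "tvec_of \<C> c x (a *\<^sub>R w + b *\<^sub>R w') d = a *\<^sub>R tvec_of \<C> c x w d + b *\<^sub>R tvec_of \<C> c x w' d"
    using has_derivative_linear[OF transition_has_derivative[OF assms, of d]]
    by (auto simp: tvec_of_def linear_add linear_scale)
qed

lemma linear_form_expand:
  assumes "c \<in> charts_at \<C> x" "linear_form \<C> x \<phi>"
  shows "\<phi> (tvec_of \<C> c x w) = (\<Sum>i\<in>UNIV. w $ i * \<phi> (coord_vec \<C> c i x))"
proof -
  define \<psi> where "\<psi> w = \<phi> (tvec_of \<C> c x w)" for w
  have comb: "\<psi> (a *\<^sub>R w + b *\<^sub>R w') = a * \<psi> w + b * \<psi> w'" for a b w w'
    using assms(2) tvec_of_in[OF assms(1)] unfolding \<psi>_def tvec_of_linear[OF assms(1)] linear_form_def by blast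
  have "linear \<psi>"
    by (rule linearI) (use comb[of 1 _ 1] comb[of _ _ 0] in auto)
  then have "\<psi> (\<Sum>i\<in>UNIV. w $ i *\<^sub>R axis i 1) = (\<Sum>i\<in>UNIV. w $ i * \<psi> (axis i 1))"
    by (simp add: linear_sum linear_scale)
  also have "(\<Sum>i\<in>UNIV. w $ i *\<^sub>R axis i 1) = w"
    using basis_expansion[of w] by (simp add: scalar_mult_eq_scaleR)
  finally show ?thesis by (simp add: \<psi>_def coord_vec_eq)
qed

section \<open>The system in a fixed chart\<close>

context
  fixes g :: "'a \<Rightarrow> ('a, 'n) tvec \<Rightarrow> ('a, 'n) tvec \<Rightarrow> real"
    and c :: "('a, 'n) chart"
  assumes metric: "analytic_riemannian_metric \<C> g" and c: "c \<in> \<C>"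
begin

text \<open>Linearity of the metric is given in its second argument; symmetry moves the first
  argument there for the second expansion.\<close>

lemma metric_expand:
  assumes "x \<in> fst c"
  shows "g x (tvec_of \<C> c x w) (tvec_of \<C> c x w) =
    (\<Sum>i\<in>UNIV. \<Sum>j\<in>UNIV. metric_comp \<C> g c i j (snd c x) * w $ i * w $ j)"
proof -
  have cx: "c \<in> charts_at \<C> x" using assms c by (simp add: charts_at_def)
  note T = tvec_of_in[OF cx]
  have lin: "linear_form \<C> x (g x (tvec_of \<C> c x w))" for w
    using metric T by (auto simp: analytic_riemannian_metric_def)
  have sym: "g x (tvec_of \<C> c x w) (tvec_of \<C> c x w') = g x (tvec_of \<C> c x w') (tvec_of \<C> c x w)" for w w'
    using metric T by (auto simp: analytic_riemannian_metric_def)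
  have "g x (tvec_of \<C> c x w) (tvec_of \<C> c x w) = (\<Sum>i\<in>UNIV. w $ i * g x (tvec_of \<C> c x w) (coord_vec \<C> c i x))"
    by (rule linear_form_expand[OF cx lin])
  also have "\<dots> = (\<Sum>i\<in>UNIV. w $ i * (\<Sum>j\<in>UNIV. w $ j * g x (coord_vec \<C> c i x) (coord_vec \<C> c j x)))"
  proof (rule sum.cong[OF refl])
    fix i
    have "g x (tvec_of \<C> c x w) (coord_vec \<C> c i x) = g x (coord_vec \<C> c i x) (tvec_of \<C> c x w)"
      unfolding coord_vec_eq by (rule sym)
    also have "\<dots> = (\<Sum>j\<in>UNIV. w $ j * g x (coord_vec \<C> c i x) (coord_vec \<C> c j x))"
      by (rule linear_form_expand[OF cx]) (simp add: coord_vec_eq lin)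
    finally show "w $ i * g x (tvec_of \<C> c x w) (coord_vec \<C> c i x) =
      w $ i * (\<Sum>j\<in>UNIV. w $ j * g x (coord_vec \<C> c i x) (coord_vec \<C> c j x))" by simp
  qed
  also have "\<dots> = (\<Sum>i\<in>UNIV. \<Sum>j\<in>UNIV. metric_comp \<C> g c i j (snd c x) * w $ i * w $ j)"
    using assms by (simp add: metric_comp_def chart_inverse[OF c] sum_distrib_left mult_ac)
  finally show ?thesis .
qed

lemma coordinate_lagrangian:
  assumes "open A" "\<forall>x\<in>A. analytic_fun_at \<C> U x" "analytic_one_form \<C> A \<mu>"
  shows "coord_lagrangian (snd c ` (A \<inter> fst c)) (metric_comp \<C> g c) (U \<circ> chart_inv c) (form_comp \<C> \<mu> c)"
proof
  show "open (snd c ` (A \<inter> fst c))" by (rule chart_image_open[OF c assms(1)])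
  fix y i j assume "y \<in> snd c ` (A \<inter> fst c)"
  then obtain x where x: "y = snd c x" "x \<in> A" "x \<in> fst c" by auto
  then have cx: "c \<in> charts_at \<C> x" using c by (simp add: charts_at_def)
  show "analytic_at (metric_comp \<C> g c i j) y"
    using metric cx x by (auto simp: analytic_riemannian_metric_def)
  show "analytic_at (U \<circ> chart_inv c) y" using assms(2) cx x by (auto simp: analytic_fun_at_def)
  show "analytic_at (form_comp \<C> \<mu> c i) y" using assms(3) cx x by (auto simp: analytic_one_form_def)
  show "metric_comp \<C> g c i j y = metric_comp \<C> g c j i y"
    using metric tvec_of_in[OF cx] x chart_inverse(1)[OF c]
    by (auto simp: metric_comp_def coord_vec_eq analytic_riemannian_metric_def)
next
  fix y and w :: "real ^ 'n" assume "y \<in> snd c ` (A \<inter> fst c)" "w \<noteq> 0"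
  then obtain x where x: "y = snd c x" "x \<in> A" "x \<in> fst c" by auto
  then have cx: "c \<in> charts_at \<C> x" using c by (simp add: charts_at_def)
  have "tvec_of \<C> c x w c \<noteq> 0" using tvec_of_self[OF cx, of w] \<open>w \<noteq> 0\<close> by simp
  then have "tvec_of \<C> c x w \<noteq> (\<lambda>_. 0)" by auto
  then have "g x (tvec_of \<C> c x w) (tvec_of \<C> c x w) > 0"
    using metric tvec_of_in[OF cx] by (auto simp: analytic_riemannian_metric_def)
  then show "(\<Sum>i\<in>UNIV. \<Sum>j\<in>UNIV. metric_comp \<C> g c i j y * w $ i * w $ j) > 0"
    by (simp add: metric_expand[OF x(3)] x(1))
qed

text \<open>\<open>el_solution\<close> asks for one chart at each time, and the chart
  \<open>c\<close> serves at all of them because the curve stays in its image.\<close>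

lemma solution_transfer:
  assumes A: "open A" "\<forall>x\<in>A. analytic_fun_at \<C> U x" "analytic_one_form \<C> A \<mu>"
  defines "\<Omega> \<equiv> snd c ` (A \<inter> fst c)"
  assumes sol: "coord_lagrangian.solution \<Omega> (metric_comp \<C> g c) (U \<circ> chart_inv c) (form_comp \<C> \<mu> c) T y w"
  shows "el_solution \<C> g A U \<mu> T (\<lambda>t. chart_inv c (y t)) (\<lambda>t. tvec_of \<C> c (chart_inv c (y t)) (w t))"
proof -
  interpret coord_lagrangian \<Omega> "metric_comp \<C> g c" "U \<circ> chart_inv c" "form_comp \<C> \<mu> c"
    unfolding \<Omega>_def by (rule coordinate_lagrangian[OF A])
  note S = sol[unfolded solution_def, rule_format]
  have dom: "chart_inv c (y t) \<in> A" "chart_inv c (y t) \<in> fst c" "snd c (chart_inv c (y t)) = y t"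
    "y t \<in> snd c ` fst c" if "t \<in> {0..T}" for t
    using S[OF that] chart_inverse[OF c] by (auto simp: \<Omega>_def)
  have at: "c \<in> charts_at \<C> (chart_inv c (y t))" if "t \<in> {0..T}" for t
    using dom(2)[OF that] c by (simp add: charts_at_def)
  have cy: "continuous_on {0..T} y"
    unfolding continuous_on_eq_continuous_within
    using S has_vector_derivative_continuous by blast
  show ?thesis unfolding el_solution_def
  proof (intro conjI ballI)
    show "continuous_on {0..T} (\<lambda>t. chart_inv c (y t))"
      by (rule continuous_on_compose2[of "snd c ` fst c" "chart_inv c", OF _ cy])
         (use chartD(3)[OF c] dom(4) in \<open>auto simp: homeomorphism_def\<close>)
    fix t assume t: "t \<in> {0..T}"
    show "(chart_inv c (y t), tvec_of \<C> c (chart_inv c (y t)) (w t)) \<in> tangent_bundle \<C> A"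
      using dom(1)[OF t] tvec_of_in[OF at[OF t]] by (simp add: tangent_bundle_def)
    let ?x = "\<lambda>t. chart_inv c (y t)" and ?v = "\<lambda>t. tvec_of \<C> c (chart_inv c (y t)) (w t)"
    let ?inv = "matrix_inv (gmat (y t))"
    have gram_eq: "gram \<C> g c (y t) = gmat (y t)" by (simp add: gram_def gmat_def)
    \<comment> \<open>Christoffel terms with the upper index lowered. Factoring out the inverse
      matrix reduces the covariant equation to the linear system that defines
      \<open>accel\<close>.\<close>
    define G where "G = (\<chi> l. (1/2) * (\<Sum>j\<in>UNIV. \<Sum>k\<in>UNIV. (partial j (metric_comp \<C> g c l k) (y t)
      + partial k (metric_comp \<C> g c j l) (y t) - partial l (metric_comp \<C> g c j k) (y t)) * w t $ j * w t $ k))"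
    have cov: "cov_deriv \<C> g c (y t) (w t) (w t) (accel (y t) (w t)) = accel (y t) (w t) + ?inv *v G"
    proof -
      have "(\<Sum>j\<in>UNIV. \<Sum>k\<in>UNIV. christoffel \<C> g c i j k (y t) * w t $ j * w t $ k) = (?inv *v G) $ i" for i
      proof -
        let ?B = "\<lambda>l j k. partial j (metric_comp \<C> g c l k) (y t)
          + partial k (metric_comp \<C> g c j l) (y t) - partial l (metric_comp \<C> g c j k) (y t)"
        have "(\<Sum>j\<in>UNIV. \<Sum>k\<in>UNIV. christoffel \<C> g c i j k (y t) * w t $ j * w t $ k) =
            (\<Sum>j\<in>UNIV. \<Sum>k\<in>UNIV. \<Sum>l\<in>UNIV. ?inv $ i $ l * ((1/2) * (?B l j k * w t $ j * w t $ k)))"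
          unfolding christoffel_def gram_eq sum_distrib_left sum_distrib_right
          by (intro sum.cong refl) (simp add: mult_ac)
        also have "\<dots> = (\<Sum>j\<in>UNIV. \<Sum>l\<in>UNIV. \<Sum>k\<in>UNIV. ?inv $ i $ l * ((1/2) * (?B l j k * w t $ j * w t $ k)))"
          by (rule sum.cong[OF refl], rule sum.swap)
        also have "\<dots> = (\<Sum>l\<in>UNIV. \<Sum>j\<in>UNIV. \<Sum>k\<in>UNIV. ?inv $ i $ l * ((1/2) * (?B l j k * w t $ j * w t $ k)))"
          by (rule sum.swap)
        also have "\<dots> = (?inv *v G) $ i"
          unfolding matrix_vector_mult_def G_def vec_lambda_beta sum_distrib_left ..
        finally show ?thesis .
      qed
      then show ?thesis by (simp add: cov_deriv_def vec_eq_iff)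
    qed
    define P where "P = (\<chi> i. partial i (U \<circ> chart_inv c) (y t))"
    let ?C = "contract_d \<C> \<mu> c (y t) (w t)"
    have f: "force (y t) (w t) = 0 - G - P - ?C"
      by (simp add: vec_eq_iff force_def G_def P_def magnetic_def contract_d_def)
    have "accel (y t) (w t) + ?inv *v G = - (?inv *v P) - ?inv *v ?C"
      unfolding accel_def f by (simp only: matrix_vector_mult_diff_distrib matrix_vector_mult_0_right) simp
    then have eq: "cov_deriv \<C> g c (y t) (w t) (w t) (accel (y t) (w t)) =
        - grad \<C> g U c (y t) - riesz \<C> g c (y t) (contract_d \<C> \<mu> c (y t) (w t))"
      by (simp add: cov grad_def riesz_def gram_eq P_def)
    have dx: "((\<lambda>s. snd c (?x s)) has_vector_derivative w t) (at t within {0..T})"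
      by (rule has_vector_derivative_transform[OF t, of _ y]) (use S[OF t] dom(3) in auto)
    have dv: "((\<lambda>s. ?v s c) has_vector_derivative accel (y t) (w t)) (at t within {0..T})"
      by (rule has_vector_derivative_transform[OF t, of _ w]) (use S[OF t] tvec_of_self[OF at] in auto)
    show "\<exists>c\<in>charts_at \<C> (?x t). \<exists>v'.
        ((\<lambda>s. snd c (?x s)) has_vector_derivative ?v t c) (at t within {0..T}) \<and>
        ((\<lambda>s. ?v s c) has_vector_derivative v') (at t within {0..T}) \<and>
        cov_deriv \<C> g c (snd c (?x t)) (?v t c) (?v t c) v' =
          - grad \<C> g U c (snd c (?x t)) - riesz \<C> g c (snd c (?x t)) (contract_d \<C> \<mu> c (snd c (?x t)) (?v t c))"
      by (rule bexI[OF _ at[OF t]], rule exI[of _ "accel (y t) (w t)"])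
         (use dx dv eq tvec_of_self[OF at[OF t]] dom(3)[OF t] in simp)
  qed
qed

end

end

section \<open>Instability on the manifold for a nondegenerate potential\<close>

lemma weak_magnetism_order:
  fixes \<C> :: "('a, 'n::finite) chart set"
  assumes wm: "weak_magnetism \<C> c U \<mu> p" and c0: "snd c p = 0"
    and u: "has_power_series (U \<circ> chart_inv c) a 0" and van: "\<And>\<alpha>. mdeg \<alpha> < l \<Longrightarrow> a \<alpha> = 0"
    and ne: "mdeg \<beta> = l" "a \<beta> \<noteq> 0"
    and mu: "\<And>i. has_power_series (form_comp \<C> \<mu> c i) (b i) 0"
  obtains m where "2 * m \<ge> l" "\<And>i \<alpha>. mdeg \<alpha> < Suc m \<Longrightarrow> b i \<alpha> = 0"
proof (cases "\<exists>d i \<alpha>. mdeg \<alpha> = d \<and> b i \<alpha> \<noteq> 0")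
  case False
  \<comment> \<open>The purely mechanical germ: all coefficients of the one-form vanish, so any
    large \<open>m\<close> works.\<close>
  then show thesis using that[of l] by auto
next
  case True
  define P where "P d \<longleftrightarrow> (\<exists>i \<alpha>. mdeg \<alpha> = d \<and> b i \<alpha> \<noteq> 0)" for d
  define d where "d = (LEAST d. P d)"
  have "\<exists>d. P d" using True unfolding P_def by blast
  then have d: "P d" unfolding d_def by (rule LeastI_ex)
  have less: "b i \<alpha> = 0" if "mdeg \<alpha> < d" for i \<alpha>
    using not_less_Least[of "mdeg \<alpha>" P] that unfolding d_def P_def by blast
  have 1: "first_jet_degree (form_comp \<C> \<mu> c) (snd c p) d"
    unfolding first_jet_degree_def c0
  proof (rule exI[of _ b], intro conjI allI impI)
    show "\<exists>j \<alpha>. mdeg \<alpha> = d \<and> b j \<alpha> \<noteq> 0" using d[unfolded P_def] .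
  qed (simp_all add: mu less)
  have 2: "first_jet_degree (\<lambda>_::unit. U \<circ> chart_inv c) (snd c p) l"
    unfolding first_jet_degree_def c0
  proof (rule exI[of _ "\<lambda>_. a"], intro conjI allI impI)
    show "\<exists>(j::unit) \<alpha>. mdeg \<alpha> = l \<and> a \<alpha> \<noteq> 0" using ne by blast
  qed (simp_all add: u van)
  have "real d - real l / 2 \<ge> 1" using wm 1 2 unfolding weak_magnetism_def by blast
  then have "2 * real d \<ge> real l + 2" by linarith
  then have "2 * d \<ge> l + 2" by linarith
  \<comment> \<open>\<open>d - 1\<close> is the order to which the derivatives of the one-form
    vanish, and the hypothesis reads \<open>2 * (d - 1) \<ge> l\<close>. It also forces
    \<open>d \<ge> 1\<close>, so the natural subtraction is genuine.\<close>
  then show thesis using less by (intro that[of "d - 1"]) auto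
qed

theorem total_instability:
  fixes \<C> :: "('a::topological_space, 'n::finite) chart set"
  assumes atlas: "analytic_structure \<C>" and metric: "analytic_riemannian_metric \<C> g"
    and c: "c \<in> \<C>" "p \<in> fst c" "snd c p = 0"
    and A: "open A" "p \<in> A" "\<forall>x\<in>A. analytic_fun_at \<C> U x" "analytic_one_form \<C> A \<mu>"
    and wm: "weak_magnetism \<C> c U \<mu> p"
    and u: "has_power_series (U \<circ> chart_inv c) a 0" and van: "\<And>\<alpha>. mdeg \<alpha> < k2 + 2 \<Longrightarrow> a \<alpha> = 0"
    and nd: "nondegenerate a (k2 + 2)"
  shows "totally_unstable \<C> g A U \<mu> p"
proof -
  define \<Omega> where "\<Omega> = snd c ` (A \<inter> fst c)"
  interpret coord_lagrangian \<Omega> "metric_comp \<C> g c" "U \<circ> chart_inv c" "form_comp \<C> \<mu> c"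
    unfolding \<Omega>_def by (rule coordinate_lagrangian[OF atlas metric c(1) A(1,3,4)])
  have dom0: "0 \<in> \<Omega>" unfolding \<Omega>_def c(3)[symmetric] using A(2) c(2) by blast
  have "\<exists>b. has_power_series (form_comp \<C> \<mu> c i) b 0" for i
    using analytic_mu[OF dom0, of i] by (simp add: analytic_at_def)
  then obtain b where b: "\<And>i. has_power_series (form_comp \<C> \<mu> c i) (b i) 0" by metis
  \<comment> \<open>Nondegeneracy excludes a zero homogeneous part, so \<open>k2 + 2\<close> is the
    exact degree of the first jet of the potential, as weak magnetism needs it.\<close>
  have "\<exists>\<beta>. mdeg \<beta> = k2 + 2 \<and> a \<beta> \<noteq> 0"
  proof (rule ccontr)
    assume "\<not> ?thesis"
    then have z: "hpart a (k2 + 2) = (\<lambda>_. 0)" by (auto simp: hpart_def fun_eq_iff intro!: sum.neutral)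
    have "axis undefined 1 \<noteq> (0 :: real ^ 'n)" by (simp add: axis_eq_0_iff)
    then obtain i where "partial i (hpart a (k2 + 2)) (axis undefined 1) \<noteq> 0"
      using nd unfolding nondegenerate_def by blast
    then show False unfolding z partial_def by simp
  qed
  then obtain \<beta> where \<beta>: "mdeg \<beta> = k2 + 2" "a \<beta> \<noteq> 0" by blast
  obtain m where m: "2 * m \<ge> k2 + 2" "\<And>i \<alpha>. mdeg \<alpha> < Suc m \<Longrightarrow> b i \<alpha> = 0"
    using weak_magnetism_order[OF wm c(3) u van \<beta> b] by blast
  obtain r where r: "r > 0" "cball 0 r \<subseteq> \<Omega>" "\<And>y0 w0. norm y0 < r \<Longrightarrow> energy_at y0 w0 < 0 \<Longrightarrow>
    \<exists>T\<ge>0. \<exists>y w. solution T y w \<and> y 0 = y0 \<and> w 0 = w0 \<and> r \<le> norm (y T)"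
    using subcritical_escape[OF dom0 u van nd b m(2,1)] by blast
  define B where "B = {x \<in> fst c. norm (snd c x) < r}"
  \<comment> \<open>\<open>\<Omega>\<close> is the image of \<open>A\<close> under the chart, and
    injectivity of the chart brings the point itself back into \<open>A\<close>.\<close>
  have inB: "x \<in> A" if "x \<in> B" for x
  proof -
    have "snd c x \<in> \<Omega>" using that r(2) by (auto simp: B_def)
    then obtain x' where x': "x' \<in> A" "x' \<in> fst c" "snd c x = snd c x'" by (auto simp: \<Omega>_def)
    then have "chart_inv c (snd c x) = chart_inv c (snd c x')" by simp
    then have "x = x'"
      using x'(2) that chart_inverse(1)[OF atlas c(1), of x] chart_inverse(1)[OF atlas c(1), of x'] by (simp add: B_def)
    with x'(1) show ?thesis by simp
  qed
  have "open B"
  proof -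
    have "B = fst c \<inter> snd c -` ball 0 r" by (auto simp: B_def)
    also have "open \<dots>"
      using chartD[OF atlas c(1)] by (auto simp: homeomorphism_def intro: continuous_open_preimage)
    finally show ?thesis .
  qed
  have esc: "\<not> positive_orbit \<C> g A U \<mu> z \<subseteq> tangent_bundle \<C> B"
    if z: "z \<in> tangent_bundle \<C> B" "energy g U z < 0" for z
  proof -
    obtain x0 v0 where xv: "z = (x0, v0)" "x0 \<in> B" "v0 \<in> tangent_space \<C> x0"
      using z(1) by (auto simp: tangent_bundle_def)
    have x0: "x0 \<in> fst c" "norm (snd c x0) < r" using xv(2) by (auto simp: B_def)
    have cx0: "c \<in> charts_at \<C> x0" using x0 c(1) by (simp add: charts_at_def)
    define w0 where "w0 = v0 c"
    have v0: "v0 = tvec_of \<C> c x0 w0" unfolding w0_def by (rule tvec_of_eq[OF atlas cx0 xv(3)])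
    have inv0: "chart_inv c (snd c x0) = x0" by (rule chart_inverse(1)[OF atlas c(1) x0(1)])
    have "g x0 v0 v0 = (\<Sum>l\<in>UNIV. w0 $ l * momentum (snd c x0) w0 l)"
      unfolding v0 metric_expand[OF atlas metric c(1) x0(1)] quad_eq quad_momentum ..
    then have "energy_at (snd c x0) w0 < 0" using z(2) by (simp add: energy_at_def energy_def xv(1) inv0)
    from r(3)[OF x0(2) this] obtain T y w where T: "T \<ge> 0" "solution T y w" "y 0 = snd c x0" "w 0 = w0" "r \<le> norm (y T)"
      by blast
    let ?x = "\<lambda>t. chart_inv c (y t)" and ?v = "\<lambda>t. tvec_of \<C> c (chart_inv c (y t)) (w t)"
    have el: "el_solution \<C> g A U \<mu> T ?x ?v"
      by (rule solution_transfer[OF atlas metric c(1) A(1,3,4) T(2)[unfolded \<Omega>_def]])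
    have init: "(?x 0, ?v 0) = z" using T(3,4) by (simp add: inv0 xv(1) v0)
    \<comment> \<open>A single solution ending outside \<open>B\<close> suffices, because
      \<open>positive_orbit\<close> contains the end states of all solutions that start at
      \<open>z\<close>.\<close>
    have orb: "(?x T, ?v T) \<in> positive_orbit \<C> g A U \<mu> z"
      unfolding positive_orbit_def
      by (rule CollectI, rule exI[of _ T], rule exI[of _ ?x], rule exI[of _ ?v], intro conjI refl T(1) el init)
    have "y T \<in> \<Omega>" using T(1,2) by (auto simp: solution_def)
    then have "snd c (?x T) = y T" using chart_inverse(2)[OF atlas c(1)] by (auto simp: \<Omega>_def)
    then have "?x T \<notin> B" using T(5) by (simp add: B_def)
    then have "(?x T, ?v T) \<notin> tangent_bundle \<C> B" by (simp add: tangent_bundle_def)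
    with orb show ?thesis by blast
  qed
  show ?thesis unfolding totally_unstable_def
  proof (intro exI[of _ B] conjI ballI impI)
    show "open B" by fact
    show "p \<in> B" using c(2,3) r(1) by (simp add: B_def)
    show "B \<subseteq> A" using inB by blast
  qed (rule esc)
qed

section \<open>The ring of germs\<close>

lemma germ_eq_iff: "germ p f = germ p h \<longleftrightarrow> (\<forall>\<^sub>F y in nhds p. f y = h y)"
proof
  assume "germ p f = germ p h"
  moreover have "f \<in> germ p f" by (simp add: germ_def)
  ultimately show "\<forall>\<^sub>F y in nhds p. f y = h y" by (simp add: germ_def)
next
  assume *: "\<forall>\<^sub>F y in nhds p. f y = h y"
  show "germ p f = germ p h"
    unfolding germ_def
  proof (intro Collect_cong iffI)
    fix q
    show "\<forall>\<^sub>F y in nhds p. q y = h y" if "\<forall>\<^sub>F y in nhds p. q y = f y"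
      using that * by eventually_elim simp
    show "\<forall>\<^sub>F y in nhds p. q y = f y" if "\<forall>\<^sub>F y in nhds p. q y = h y"
      using that * by eventually_elim simp
  qed
qed

lemma mem_germ_iff: "h \<in> germ p f \<longleftrightarrow> germ p h = germ p f"
  unfolding germ_eq_iff by (simp add: germ_def)

lemma germ_self: "f \<in> germ p f"
  by (simp add: mem_germ_iff)

lemma germ_value: "germ p f = germ p h \<Longrightarrow> f p = h p"
  unfolding germ_eq_iff by (rule eventually_nhds_x_imp_x)

text \<open>The operation is a union over all representatives; its members are one and the same germ
  and the union is not empty.\<close>

lemma germ_ring_mult:
  "germ p f \<otimes>\<^bsub>germ_ring \<C> p\<^esub> germ p h = germ p (\<lambda>x. f x * h x)"
proof -
  have *: "germ p (\<lambda>x. f' x * h' x) = germ p (\<lambda>x. f x * h x)" if "f' \<in> germ p f" "h' \<in> germ p h" for f' h'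
    using that unfolding mem_germ_iff germ_eq_iff by eventually_elim simp
  have ne: "germ p f \<noteq> {}" "germ p h \<noteq> {}" using germ_self by blast+
  have "(\<Union>f'\<in>germ p f. \<Union>h'\<in>germ p h. germ p (\<lambda>x. f' x * h' x)) =
      (\<Union>f'\<in>germ p f. \<Union>h'\<in>germ p h. germ p (\<lambda>x. f x * h x))"
    by (intro SUP_cong refl *)
  also have "\<dots> = germ p (\<lambda>x. f x * h x)" using ne by (simp add: UN_constant)
  finally show ?thesis unfolding germ_ring_def by simp
qed

lemma germ_ring_add:
  "germ p f \<oplus>\<^bsub>germ_ring \<C> p\<^esub> germ p h = germ p (\<lambda>x. f x + h x)"
proof -
  have *: "germ p (\<lambda>x. f' x + h' x) = germ p (\<lambda>x. f x + h x)" if "f' \<in> germ p f" "h' \<in> germ p h" for f' h'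
    using that unfolding mem_germ_iff germ_eq_iff by eventually_elim simp
  have ne: "germ p f \<noteq> {}" "germ p h \<noteq> {}" using germ_self by blast+
  have "(\<Union>f'\<in>germ p f. \<Union>h'\<in>germ p h. germ p (\<lambda>x. f' x + h' x)) =
      (\<Union>f'\<in>germ p f. \<Union>h'\<in>germ p h. germ p (\<lambda>x. f x + h x))"
    by (intro SUP_cong refl *)
  also have "\<dots> = germ p (\<lambda>x. f x + h x)" using ne by (simp add: UN_constant)
  finally show ?thesis unfolding germ_ring_def by simp
qed

lemma germ_ring_one: "\<one>\<^bsub>germ_ring \<C> p\<^esub> = germ p (\<lambda>_. 1)"
  and germ_ring_zero: "\<zero>\<^bsub>germ_ring \<C> p\<^esub> = germ p (\<lambda>_. 0)"
  and germ_ring_carrier: "carrier (germ_ring \<C> p) = germ p ` {f. analytic_fun_at \<C> f p}"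
  by (simp_all add: germ_ring_def)

lemma analytic_fun_at_add: "analytic_fun_at \<C> f x \<Longrightarrow> analytic_fun_at \<C> h x \<Longrightarrow> analytic_fun_at \<C> (\<lambda>x. f x + h x) x"
  unfolding analytic_fun_at_def o_def by (intro ballI analytic_at_add) auto

lemma analytic_fun_at_mult: "analytic_fun_at \<C> f x \<Longrightarrow> analytic_fun_at \<C> h x \<Longrightarrow> analytic_fun_at \<C> (\<lambda>x. f x * h x) x"
  unfolding analytic_fun_at_def o_def by (intro ballI analytic_at_mult) auto

lemma analytic_fun_at_const: "analytic_fun_at \<C> (\<lambda>x. k) x"
  unfolding analytic_fun_at_def o_def by (intro ballI analytic_at_const)

lemma germ_in_carrier: "analytic_fun_at \<C> f p \<Longrightarrow> germ p f \<in> carrier (germ_ring \<C> p)"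
  unfolding germ_ring_carrier by (intro imageI CollectI)

lemma analytic_fun_at_power: "analytic_fun_at \<C> f x \<Longrightarrow> analytic_fun_at \<C> (\<lambda>x. f x ^ m) x"
  unfolding analytic_fun_at_def o_def by (intro ballI analytic_at_power) auto

lemma analytic_fun_at_sum:
  "finite S \<Longrightarrow> (\<And>s. s \<in> S \<Longrightarrow> analytic_fun_at \<C> (f s) x) \<Longrightarrow> analytic_fun_at \<C> (\<lambda>x. \<Sum>s\<in>S. f s x) x"
  unfolding analytic_fun_at_def o_def by (intro ballI analytic_at_sum) auto

section \<open>The maximal ideal and its powers\<close>

context
  fixes \<C> :: "('a::topological_space, 'n::finite) chart set" and c :: "('a, 'n) chart" and p :: 'a
    and \<mm> :: "('a \<Rightarrow> real) set set"
  assumes atlas: "analytic_structure \<C>" and c: "c \<in> \<C>" "p \<in> fst c" "snd c p = 0"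
    and maximal: "maximalideal \<mm> (germ_ring \<C> p)"
begin

lemma chart_at_p: "c \<in> charts_at \<C> p"
  using c by (simp add: charts_at_def)

lemma germ_pullback:
  assumes "germ p f = germ p h"
  shows "\<forall>\<^sub>F y in nhds 0. f (chart_inv c y) = h (chart_inv c y)"
  using eventually_chart_inv[OF atlas c(1,2) assms[unfolded germ_eq_iff]] unfolding c(3)
  by (rule eventually_mono) simp

lemma analytic_fun_at_inverse:
  assumes "analytic_fun_at \<C> f p" "f p \<noteq> 0"
  shows "analytic_fun_at \<C> (\<lambda>x. inverse (f x)) p"
  unfolding analytic_fun_at_def
proof
  fix d assume d: "d \<in> charts_at \<C> p"
  then have "chart_inv d (snd d p) = p" using chart_inverse(1)[OF atlas] by (simp add: charts_at_def)
  then show "analytic_at ((\<lambda>x. inverse (f x)) \<circ> chart_inv d) (snd d p)"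
    using assms d analytic_at_inverse[of "f \<circ> chart_inv d" "snd d p"] by (simp add: analytic_fun_at_def o_def)
qed

lemma eventually_nonzero:
  assumes "analytic_fun_at \<C> f p" "f p \<noteq> 0"
  shows "\<forall>\<^sub>F x in nhds p. f x \<noteq> 0"
proof -
  have "isCont (f \<circ> chart_inv c) 0"
    using assms(1) chart_at_p analytic_at_isCont unfolding analytic_fun_at_def c(3)[symmetric] by blast
  moreover have "(f \<circ> chart_inv c) 0 \<noteq> 0" using chart_inverse(1)[OF atlas c(1,2)] c(3) assms(2) by simp
  moreover from this calculation have "\<forall>\<^sub>F y in at 0. (f \<circ> chart_inv c) y \<noteq> 0"
    unfolding isCont_def by (intro tendsto_imp_eventually_ne)
  ultimately have "\<forall>\<^sub>F y in nhds 0. (f \<circ> chart_inv c) y \<noteq> 0"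
    by (simp only: eventually_nhds_conv_at) simp
  then have "\<forall>\<^sub>F x in nhds p. x \<in> fst c \<and> (f \<circ> chart_inv c) (snd c x) \<noteq> 0"
    using eventually_chart[OF atlas c(1,2)] by (simp add: c(3))
  then show ?thesis
  proof (rule eventually_mono)
    fix x assume x: "x \<in> fst c \<and> (f \<circ> chart_inv c) (snd c x) \<noteq> 0"
    then have "chart_inv c (snd c x) = x" by (intro chart_inverse(1)[OF atlas c(1)]) simp
    with x show "f x \<noteq> 0" by simp
  qed
qed

text \<open>A germ with non-zero value at \<open>p\<close> is a unit, so the proper ideal
  \<open>\<mm>\<close> consists of germs vanishing at \<open>p\<close>. These form a proper ideal
  themselves, and maximality gives equality.\<close>

lemma maximal_ideal_eq: "\<mm> = {germ p f |f. analytic_fun_at \<C> f p \<and> f p = 0}"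
proof -
  interpret maximalideal \<mm> "germ_ring \<C> p" by (rule maximal)
  let ?R = "germ_ring \<C> p"
  let ?J = "{germ p f |f. analytic_fun_at \<C> f p \<and> f p = 0}"
  have J_mem: "germ p f \<in> ?J" if "analytic_fun_at \<C> f p" "f p = 0" for f
    using that by (intro CollectI exI[of _ f]) simp
  have ne_emptyI: "S \<noteq> {}" if "x \<in> S" for S :: "('a \<Rightarrow> real) set set" and x using that by blast
  have sub: "\<mm> \<subseteq> ?J"
  proof
    fix G assume G: "G \<in> \<mm>"
    then have "G \<in> carrier ?R" by (rule Icarr)
    then obtain f where f: "G = germ p f" "analytic_fun_at \<C> f p" by (auto simp: germ_ring_carrier)
    have "f p = 0"
    proof (rule ccontr)
      assume ne: "f p \<noteq> 0"
      have "germ p (\<lambda>x. inverse (f x)) \<in> carrier ?R"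
        using analytic_fun_at_inverse[OF f(2) ne] by (simp add: germ_ring_carrier)
      then have "germ p (\<lambda>x. inverse (f x)) \<otimes>\<^bsub>?R\<^esub> G \<in> \<mm>" by (rule I_l_closed[OF G])
      moreover have "germ p (\<lambda>x. inverse (f x)) \<otimes>\<^bsub>?R\<^esub> G = \<one>\<^bsub>?R\<^esub>"
        unfolding f(1) germ_ring_mult germ_ring_one germ_eq_iff
        using eventually_nonzero[OF f(2) ne] by (rule eventually_mono) simp
      ultimately have "\<mm> = carrier ?R" using one_imp_carrier by simp
      then show False using I_notcarr by simp
    qed
    with f show "G \<in> ?J" using J_mem by simp
  qed
  have carr: "?J \<subseteq> carrier ?R" by (auto simp: germ_ring_carrier)
  have "ideal ?J ?R"
  proof (rule idealI)
    show "ring ?R" by (rule ring_axioms)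
    show "subgroup ?J (add_monoid ?R)"
    proof (rule add.subgroupI)
      show "?J \<subseteq> carrier ?R" by (rule carr)
      have "germ p (\<lambda>_. 0) \<in> ?J" by (rule J_mem) (simp_all add: analytic_fun_at_const)
      then show "?J \<noteq> {}" by (rule ne_emptyI)
      fix G assume "G \<in> ?J"
      then obtain f where f: "G = germ p f" "analytic_fun_at \<C> f p" "f p = 0" by blast
      have an: "analytic_fun_at \<C> (\<lambda>x. -1 * f x) p" by (intro analytic_fun_at_mult analytic_fun_at_const f(2))
      have "\<ominus>\<^bsub>?R\<^esub> G = germ p (\<lambda>x. -1 * f x)"
      proof (rule minus_equality)
        show "germ p (\<lambda>x. -1 * f x) \<oplus>\<^bsub>?R\<^esub> G = \<zero>\<^bsub>?R\<^esub>"
          unfolding f(1) germ_ring_add germ_ring_zero by simp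
      qed (use f an in \<open>auto simp: germ_ring_carrier\<close>)
      moreover have "germ p (\<lambda>x. -1 * f x) \<in> ?J" by (rule J_mem) (use an f(3) in simp_all)
      ultimately show "\<ominus>\<^bsub>?R\<^esub> G \<in> ?J" by (simp only:)
    next
      fix G H assume "G \<in> ?J" "H \<in> ?J"
      then obtain f h where fh: "G = germ p f" "analytic_fun_at \<C> f p" "f p = 0"
        "H = germ p h" "analytic_fun_at \<C> h p" "h p = 0" by blast
      have "G \<oplus>\<^bsub>?R\<^esub> H = germ p (\<lambda>x. f x + h x)" unfolding fh(1,4) germ_ring_add ..
      moreover have "germ p (\<lambda>x. f x + h x) \<in> ?J"
        by (rule J_mem) (use analytic_fun_at_add[OF fh(2,5)] fh(3,6) in simp_all)
      ultimately show "G \<oplus>\<^bsub>?R\<^esub> H \<in> ?J" by (simp only:)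
    qed
  next
    fix G H assume "G \<in> ?J" "H \<in> carrier ?R"
    then obtain f h where fh: "G = germ p f" "analytic_fun_at \<C> f p" "f p = 0"
      "H = germ p h" "analytic_fun_at \<C> h p" by (auto simp: germ_ring_carrier)
    have "H \<otimes>\<^bsub>?R\<^esub> G = germ p (\<lambda>x. h x * f x)" "G \<otimes>\<^bsub>?R\<^esub> H = germ p (\<lambda>x. f x * h x)"
      unfolding fh(1,4) germ_ring_mult by simp_all
    moreover have "germ p (\<lambda>x. h x * f x) \<in> ?J"
      by (rule J_mem) (use analytic_fun_at_mult[OF fh(5,2)] fh(3) in simp_all)
    moreover have "germ p (\<lambda>x. f x * h x) \<in> ?J"
      by (rule J_mem) (use analytic_fun_at_mult[OF fh(2,5)] fh(3) in simp_all)
    ultimately show "H \<otimes>\<^bsub>?R\<^esub> G \<in> ?J" "G \<otimes>\<^bsub>?R\<^esub> H \<in> ?J" by (simp_all only:)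
  qed
  from I_maximal[OF this sub carr] have "?J = \<mm> \<or> ?J = carrier ?R" .
  moreover have "?J \<noteq> carrier ?R"
  proof
    assume "?J = carrier ?R"
    moreover have "germ p (\<lambda>_. 1) \<in> carrier ?R" by (rule germ_in_carrier[OF analytic_fun_at_const])
    ultimately have "germ p (\<lambda>_. 1) \<in> ?J" by (simp only:)
    then obtain f where f: "germ p (\<lambda>_. 1 :: real) = germ p f" "f p = 0" by blast
    from germ_value[OF f(1)] f(2) show False by simp
  qed
  ultimately show ?thesis by simp
qed

text \<open>Orders of vanishing add under products and are kept by sums, and the ideal product is
  generated by these two operations. This turns the algebraic hypothesis on the germ into one on
  Taylor coefficients.\<close>

lemma ideal_power_order:
  assumes "G \<in> ideal_power (germ_ring \<C> p) \<mm> k"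
  shows "\<exists>f a. G = germ p f \<and> analytic_fun_at \<C> f p \<and> has_power_series (f \<circ> chart_inv c) a 0 \<and>
    (\<forall>\<alpha>. mdeg \<alpha> < k \<longrightarrow> a \<alpha> = 0)"
  using assms
proof (induction k arbitrary: G)
  case 0
  then obtain f where f: "G = germ p f" "analytic_fun_at \<C> f p" by (auto simp: germ_ring_carrier)
  then have "analytic_at (f \<circ> chart_inv c) 0"
    using chart_at_p by (auto simp: analytic_fun_at_def c(3)[symmetric])
  then obtain a where a: "has_power_series (f \<circ> chart_inv c) a 0" unfolding analytic_at_def by (rule exE)
  show ?case by (rule exI[of _ f], rule exI[of _ a], intro conjI f a allI impI) simp
next
  case (Suc k)
  from Suc.prems have "G \<in> ideal_prod (germ_ring \<C> p) \<mm> (ideal_power (germ_ring \<C> p) \<mm> k)" by simp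
  then show ?case
  proof (induction rule: ideal_prod.induct)
    case (prod G H)
    from prod(1) obtain f where f: "G = germ p f" "analytic_fun_at \<C> f p" "f p = 0"
      unfolding maximal_ideal_eq by blast
    have "analytic_at (f \<circ> chart_inv c) 0"
      using f(2) chart_at_p by (auto simp: analytic_fun_at_def c(3)[symmetric])
    then obtain a where a: "has_power_series (f \<circ> chart_inv c) a 0" unfolding analytic_at_def by (rule exE)
    have "a (\<lambda>_. 0) = 0"
      using has_power_series_value[OF a] f(3) chart_inverse(1)[OF atlas c(1,2)] c(3) by simp
    then have a0: "a \<alpha> = 0" if "mdeg \<alpha> < 1" for \<alpha> using that by (simp add: mdeg_eq_0_iff)
    from Suc.IH[OF prod(2)] obtain h b where h: "H = germ p h" "analytic_fun_at \<C> h p"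
      "has_power_series (h \<circ> chart_inv c) b 0" "\<forall>\<alpha>. mdeg \<alpha> < k \<longrightarrow> b \<alpha> = 0" by blast
    have "has_power_series ((\<lambda>x. f x * h x) \<circ> chart_inv c) (cauchy_prod a b) 0"
      using has_power_series_mult[OF a h(3)] by (simp add: o_def)
    moreover have "\<forall>\<alpha>. mdeg \<alpha> < Suc k \<longrightarrow> cauchy_prod a b \<alpha> = 0"
      using cauchy_prod_order[of 1 a k b] a0 h(4) by simp
    moreover have "G \<otimes>\<^bsub>germ_ring \<C> p\<^esub> H = germ p (\<lambda>x. f x * h x)" unfolding f(1) h(1) germ_ring_mult ..
    ultimately show ?case using analytic_fun_at_mult[OF f(2) h(2)]
      by (intro exI[of _ "\<lambda>x. f x * h x"], intro exI[of _ "cauchy_prod a b"] conjI)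
  next
    case (sum G H)
    then obtain f a h b where f: "G = germ p f" "analytic_fun_at \<C> f p"
      "has_power_series (f \<circ> chart_inv c) a 0" "\<forall>\<alpha>. mdeg \<alpha> < Suc k \<longrightarrow> a \<alpha> = 0"
      and h: "H = germ p h" "analytic_fun_at \<C> h p"
      "has_power_series (h \<circ> chart_inv c) b 0" "\<forall>\<alpha>. mdeg \<alpha> < Suc k \<longrightarrow> b \<alpha> = 0" by blast
    have "has_power_series ((\<lambda>x. f x + h x) \<circ> chart_inv c) (\<lambda>\<alpha>. a \<alpha> + b \<alpha>) 0"
      using has_power_series_add[OF f(3) h(3)] by (simp add: o_def)
    moreover have "\<forall>\<alpha>. mdeg \<alpha> < Suc k \<longrightarrow> a \<alpha> + b \<alpha> = 0" using f(4) h(4) by simp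
    moreover have "G \<oplus>\<^bsub>germ_ring \<C> p\<^esub> H = germ p (\<lambda>x. f x + h x)" unfolding f(1) h(1) germ_ring_add ..
    ultimately show ?case using analytic_fun_at_add[OF f(2) h(2)]
      by (intro exI[of _ "\<lambda>x. f x + h x"], intro exI[of _ "\<lambda>\<alpha>. a \<alpha> + b \<alpha>"] conjI)
  qed
qed

lemma ideal_power_add:
  assumes "germ p f \<in> ideal_power (germ_ring \<C> p) \<mm> (Suc k)" "germ p h \<in> ideal_power (germ_ring \<C> p) \<mm> (Suc k)"
  shows "germ p (\<lambda>x. f x + h x) \<in> ideal_power (germ_ring \<C> p) \<mm> (Suc k)"
  using ideal_prod.sum[of "germ p f" "germ_ring \<C> p" \<mm> "ideal_power (germ_ring \<C> p) \<mm> k" "germ p h"] assms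
  by (simp add: germ_ring_add)

lemma analytic_fun_at_coord: "analytic_fun_at \<C> (\<lambda>x. snd c x $ i) p"
  unfolding analytic_fun_at_def
proof
  fix d assume d: "d \<in> charts_at \<C> p"
  have "analytic_at (\<lambda>y. transition d c y $ i) (snd d p)"
    using atlas d chart_at_p by (auto simp: analytic_structure_def analytic_atlas_def charts_at_def)
  then show "analytic_at ((\<lambda>x. snd c x $ i) \<circ> chart_inv d) (snd d p)" by (simp add: transition_def o_def)
qed

text \<open>The germ is a product of \<open>k\<close> coordinate germs from \<open>\<mm>\<close> and
  a constant; the constant is the element of the zeroth power with which the recursion
  starts.\<close>

lemma ideal_power_coord:
  "germ p (\<lambda>x. t * snd c x $ i ^ k) \<in> ideal_power (germ_ring \<C> p) \<mm> k"
proof -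
  have pw: "germ p (\<lambda>x. t * snd c x $ i ^ k) \<in> ideal_power (germ_ring \<C> p) \<mm> k" for t
  proof (induction k arbitrary: t)
    case 0
    have "germ p (\<lambda>x. t) \<in> carrier (germ_ring \<C> p)" by (rule germ_in_carrier) (rule analytic_fun_at_const)
    then show ?case by simp
  next
    case (Suc k)
    have "germ p (\<lambda>x. snd c x $ i) \<in> \<mm>"
      unfolding maximal_ideal_eq by (rule CollectI, rule exI[of _ "\<lambda>x. snd c x $ i"]) (simp add: analytic_fun_at_coord c(3))
    from ideal_prod.prod[OF this Suc.IH[of t], of "germ_ring \<C> p"]
    show ?case by (simp add: germ_ring_mult mult_ac)
  qed
  then show ?thesis .
qed

text \<open>Ensures that the perturbations of the density argument stay inside the ideal
  power.\<close>

lemma ideal_power_coord_sum: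
  "germ p (\<lambda>x. \<Sum>i\<in>UNIV. v i * snd c x $ i ^ Suc k) \<in> ideal_power (germ_ring \<C> p) \<mm> (Suc k)"
proof -
  have "finite S \<Longrightarrow> germ p (\<lambda>x. \<Sum>i\<in>S. v i * snd c x $ i ^ Suc k) \<in> ideal_power (germ_ring \<C> p) \<mm> (Suc k)" for S
  proof (induction S rule: finite_induct)
    case empty
    show ?case using ideal_power_coord[of 0 undefined "Suc k"] by simp
  next
    case (insert i S)
    show ?case using ideal_power_add[OF ideal_power_coord[of "v i" i "Suc k"] insert.IH] insert.hyps
      by (simp del: ideal_power.simps)
  qed
  then show ?thesis by simp
qed

end

section \<open>Homogeneous parts of holomorphic germs\<close>

text \<open>Restriction to complex lines reduces several variables to one, where Cauchy's inequality
  is available.\<close>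

lemma analytic_line_holomorphic:
  fixes F :: "complex ^ 'n::finite \<Rightarrow> complex"
  assumes "analytic_at F (w + t *s z)"
  shows "(\<lambda>t. F (w + t *s z)) field_differentiable (at t)"
proof -
  obtain a where a: "has_power_series F a (w + t *s z)" using assms unfolding analytic_at_def by (rule exE)
  have "bounded_linear (\<lambda>t. t *s z)"
    by (rule linear_conv_bounded_linear[THEN iffD1], rule linearI)
       (simp_all add: vec_eq_iff algebra_simps)
  then have "((\<lambda>t. w + t *s z) has_derivative (\<lambda>s. s *s z)) (at t)"
    using has_derivative_add[OF has_derivative_const[of w] bounded_linear.has_derivative[OF _ has_derivative_ident]]
    by simp
  from has_derivative_compose[OF this has_power_series_has_derivative[OF a]]
  have "((\<lambda>t. F (w + t *s z)) has_derivative (\<lambda>s. \<Sum>i\<in>UNIV. a (index_unit i) * (s *s z) $ i)) (at t)" .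
  also have "(\<lambda>s. \<Sum>i\<in>UNIV. a (index_unit i) * (s *s z) $ i) = (*) (\<Sum>i\<in>UNIV. a (index_unit i) * z $ i)"
    by (rule ext) (simp add: sum_distrib_left sum_distrib_right mult_ac)
  finally show ?thesis unfolding field_differentiable_def has_field_derivative_def by blast
qed

text \<open>Grouping the monomials by degree turns the series along a line into a power series in
  \<open>t\<close> whose coefficients are the values of the homogeneous parts at
  \<open>z\<close>.\<close>

lemma power_series_line_sums:
  fixes a :: "('n::finite \<Rightarrow> nat) \<Rightarrow> complex"
  assumes "((\<lambda>\<alpha>. a \<alpha> * mpow (t *s z) \<alpha>) has_sum S) UNIV"
  shows "(\<lambda>m. hpart a m z * t ^ m) sums S"
proof -
  have bij: "bij_betw snd (SIGMA m:UNIV. {\<alpha>::'n \<Rightarrow> nat. mdeg \<alpha> = m}) UNIV"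
    by (rule bij_betw_byWitness[where f' = "\<lambda>\<alpha>. (mdeg \<alpha>, \<alpha>)"]) auto
  have "((\<lambda>p. a (snd p) * mpow (t *s z) (snd p)) has_sum S) (SIGMA m:UNIV. {\<alpha>::'n \<Rightarrow> nat. mdeg \<alpha> = m})"
    using has_sum_reindex_bij_betw[OF bij, of "\<lambda>\<alpha>. a \<alpha> * mpow (t *s z) \<alpha>" S] assms by simp
  then have "((\<lambda>m. hpart a m z * t ^ m) has_sum S) UNIV"
  proof (rule has_sum_SigmaD)
    fix m :: nat
    show "((\<lambda>\<alpha>. a (snd (m, \<alpha>)) * mpow (t *s z) (snd (m, \<alpha>))) has_sum hpart a m z * t ^ m) {\<alpha>. mdeg \<alpha> = m}"
    proof (rule has_sum_finiteI[OF finite_mdeg_eq])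
      have "mpow (t *s z) \<alpha> = t ^ mdeg \<alpha> * mpow z \<alpha>" for \<alpha>
        using mpow_scaleR[of t z \<alpha>] by (simp add: vector_scalar_mult_def)
      then show "hpart a m z * t ^ m = (\<Sum>\<alpha>\<in>{\<alpha>. mdeg \<alpha> = m}. a (snd (m, \<alpha>)) * mpow (t *s z) (snd (m, \<alpha>)))"
        unfolding hpart_def sum_distrib_right by (intro sum.cong) auto
    qed
  qed
  then show ?thesis by (rule has_sum_imp_sums)
qed

lemma norm_cscale: "norm (t *s z) = norm t * norm (z :: complex ^ 'n::finite)"
  by (simp add: norm_vec_def norm_mult L2_set_right_distrib[symmetric])

text \<open>The value of the homogeneous part at \<open>z\<close> is the \<open>k\<close>-th Taylor
  coefficient of \<open>F\<close> along the line through \<open>z\<close>, which stays in the ball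
  for \<open>norm t \<le> 1\<close>; Cauchy's inequality on the unit disc gives the bound.\<close>

lemma hpart_bound:
  fixes F :: "complex ^ 'n::finite \<Rightarrow> complex"
  assumes an: "\<And>z. z \<in> cball 0 \<rho> \<Longrightarrow> analytic_at F z" and bd: "\<And>z. z \<in> cball 0 \<rho> \<Longrightarrow> norm (F z) \<le> B"
    and a: "has_power_series F a 0" and z: "norm z \<le> \<rho>"
  shows "norm (hpart a k z) \<le> B"
proof -
  define h where "h t = F (0 + t *s z)" for t
  have in_ball: "0 + t *s z \<in> cball 0 \<rho>" if "norm t \<le> 1" for t
  proof -
    have "norm t * norm z \<le> 1 * norm z" using that by (intro mult_right_mono) auto
    then show ?thesis using z by (simp add: norm_cscale)
  qed
  have fd: "h field_differentiable (at t)" if "norm t \<le> 1" for t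
    unfolding h_def[abs_def] by (rule analytic_line_holomorphic[OF an[OF in_ball[OF that]]])
  have holo: "h holomorphic_on ball 0 1"
    unfolding holomorphic_on_def by (auto intro!: field_differentiable_at_within fd)
  have cont: "continuous_on (cball 0 1) h"
    by (auto intro!: continuous_at_imp_continuous_on field_differentiable_imp_continuous_at fd)
  have "norm ((deriv ^^ k) h 0) \<le> fact k * B / 1 ^ k"
  proof (rule Cauchy_inequality[OF holo cont])
    show "norm (h t) \<le> B" if "norm (0 - t) = 1" for t
      unfolding h_def using that by (intro bd in_ball) simp
  qed simp
  moreover have "(deriv ^^ k) h 0 / fact k = hpart a k z"
  proof -
    obtain r where r: "r > 0" "\<And>h. norm h < r \<Longrightarrow> ((\<lambda>\<alpha>. a \<alpha> * mpow h \<alpha>) has_sum F (0 + h)) UNIV"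
      using a unfolding has_power_series_def by blast
    have "\<forall>\<^sub>F t in nhds 0. (\<lambda>m. fps_nth (Abs_fps (\<lambda>m. hpart a m z)) m * t ^ m) sums h t"
      unfolding eventually_nhds_metric
    proof (intro exI[of _ "r / (norm z + 1)"] conjI allI impI)
      show "r / (norm z + 1) > 0" using r(1) by (simp add: add_nonneg_pos)
      fix t :: complex assume "dist t 0 < r / (norm z + 1)"
      moreover have "norm z + 1 > 0" by (simp add: add_nonneg_pos)
      ultimately have "norm t * (norm z + 1) < r" by (simp add: pos_less_divide_eq)
      then have "norm t * norm z + norm t < r" by (simp add: distrib_left)
      then have "norm (t *s z) < r" unfolding norm_cscale using norm_ge_zero[of t] by linarith
      from power_series_line_sums[OF r(2)[OF this]]
      show "(\<lambda>m. fps_nth (Abs_fps (\<lambda>m. hpart a m z)) m * t ^ m) sums h t" by (simp add: h_def)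
    qed
    then have "h has_fps_expansion Abs_fps (\<lambda>m. hpart a m z)" by (rule has_fps_expansionI)
    from fps_nth_fps_expansion[OF this, of k] show ?thesis by simp
  qed
  then have "norm (hpart a k z) = norm ((deriv ^^ k) h 0) / fact k" by (metis norm_divide norm_fact)
  ultimately show ?thesis by (simp add: pos_divide_le_eq mult.commute)
qed

lemma Re_hpart_cvec: "Re (hpart a k (cvec x)) = hpart (\<lambda>\<alpha>. Re (a \<alpha>)) k x"
  by (simp add: hpart_def mpow_cvec del: of_real_prod)

text \<open>Cauchy's inequality once more, for the homogeneous part along the line through
  \<open>cvec x\<close> in direction \<open>i\<close>. On the unit circle its points have norm at
  most 2; scaling them into the ball of radius \<open>\<rho>\<close> costs the factor
  \<open>(2 / \<rho>) ^ k\<close>.\<close>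

lemma partial_hpart_bound:
  fixes F :: "complex ^ 'n::finite \<Rightarrow> complex"
  assumes an: "\<And>z. z \<in> cball 0 \<rho> \<Longrightarrow> analytic_at F z" and bd: "\<And>z. z \<in> cball 0 \<rho> \<Longrightarrow> norm (F z) \<le> B"
    and a: "has_power_series F a 0" and \<rho>: "\<rho> > 0" and x: "norm x \<le> 1"
  shows "\<bar>partial i (hpart (\<lambda>\<alpha>. Re (a \<alpha>)) k) x\<bar> \<le> (2 / \<rho>) ^ k * B"
proof -
  let ?P = "hpart (\<lambda>\<alpha>. Re (a \<alpha>)) k"
  define \<phi> where "\<phi> s = hpart a k (cvec x + s *s axis i 1)" for s
  have fd: "\<phi> field_differentiable (at s)" for s
    unfolding \<phi>_def[abs_def] by (rule analytic_line_holomorphic) (rule analytic_at_hpart)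
  have B: "norm (\<phi> s) \<le> (2 / \<rho>) ^ k * B" if "norm s = 1" for s
  proof -
    let ?z = "cvec x + s *s axis i 1" and ?t = "complex_of_real (\<rho> / 2)"
    have "norm (axis i 1 :: complex ^ 'n) = 1" by (simp add: norm_axis_1)
    then have "norm ?z \<le> 1 + 1"
      using norm_triangle_ineq[of "cvec x" "s *s axis i 1"] x that by (simp add: norm_cscale)
    moreover have "norm (?t *s ?z) = \<rho> / 2 * norm ?z" unfolding norm_cscale using \<rho> by simp
    moreover have "\<rho> / 2 * norm ?z \<le> \<rho> / 2 * 2" using \<rho> calculation(1) by (intro mult_left_mono) auto
    ultimately have "norm (?t *s ?z) \<le> \<rho>" by linarith
    from hpart_bound[OF an bd a this] have "norm (hpart a k (?t *s ?z)) \<le> B" by simp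
    moreover have "hpart a k (?t *s ?z) = ?t ^ k * \<phi> s"
      unfolding \<phi>_def using hpart_scale[of a k ?t ?z] by (simp add: vector_scalar_mult_def)
    ultimately have "(\<rho> / 2) ^ k * norm (\<phi> s) \<le> B" using \<rho> by (simp add: norm_mult norm_power)
    then show ?thesis using \<rho> by (simp add: field_simps power_divide)
  qed
  have "norm ((deriv ^^ 1) \<phi> 0) \<le> fact 1 * ((2 / \<rho>) ^ k * B) / 1 ^ 1"
  proof (rule Cauchy_inequality)
    show "\<phi> holomorphic_on ball 0 1"
      unfolding holomorphic_on_def by (auto intro!: field_differentiable_at_within fd)
    show "continuous_on (cball 0 1) \<phi>"
      by (auto intro!: continuous_at_imp_continuous_on field_differentiable_imp_continuous_at fd)
    show "norm (\<phi> t) \<le> (2 / \<rho>) ^ k * B" if "norm (0 - t) = 1" for t using that by (intro B) simp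
  qed simp
  moreover have "Re (deriv \<phi> 0) = partial i ?P x"
  proof -
    have d: "(\<phi> has_field_derivative deriv \<phi> 0) (at 0)"
      using fd[of 0] by (simp add: DERIV_deriv_iff_field_differentiable)
    have "((\<lambda>s::real. \<phi> (of_real s)) has_vector_derivative deriv \<phi> 0) (at 0)"
      using d has_vector_derivative_real_field[of \<phi> "deriv \<phi> 0" 0] by simp
    then have "((\<lambda>s::real. Re (\<phi> (of_real s))) has_vector_derivative Re (deriv \<phi> 0)) (at 0)"
      by (rule bounded_linear.has_vector_derivative[OF bounded_linear_Re])
    moreover have "Re (\<phi> (of_real s)) = ?P (x + s *\<^sub>R axis i 1)" for s
    proof -
      have "cvec x + complex_of_real s *s axis i 1 = cvec (x + s *\<^sub>R axis i 1)"
        by (simp add: cvec_def vec_eq_iff axis_def)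
      then show ?thesis unfolding \<phi>_def by (simp add: Re_hpart_cvec)
    qed
    ultimately have 1: "((\<lambda>s. ?P (x + s *\<^sub>R axis i 1)) has_real_derivative Re (deriv \<phi> 0)) (at 0)"
      by (simp add: has_real_derivative_iff_has_vector_derivative)
    have "((\<lambda>s. x + s *\<^sub>R axis i 1) has_vector_derivative axis i 1) (at 0)"
      by (auto intro!: derivative_eq_intros)
    from analytic_curve_derivative[OF analytic_at_hpart this, of "\<lambda>\<alpha>. Re (a \<alpha>)" k]
    have 2: "((\<lambda>s. ?P (x + s *\<^sub>R axis i 1)) has_real_derivative partial i ?P x) (at 0)"
      by (simp add: axis_def if_distrib cong: if_cong)
    from DERIV_unique[OF 1 2] show ?thesis .
  qed
  ultimately show ?thesis using abs_Re_le_cmod[of "deriv \<phi> 0"] by simp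
qed

section \<open>The compact-open topology\<close>

text \<open>Finitely many pieces cover \<open>K\<close>, on each of which \<open>F0\<close> varies
  by less than \<open>e / 2\<close>. Asking \<open>F\<close> to map each piece into a ball of radius
  \<open>e / 2\<close> is a finite intersection of subbasic conditions and forces uniform
  closeness.\<close>

lemma hol_topology_uniform_nbhd:
  assumes F0: "F0 \<in> hol_funs A" and K: "compact K" "K \<subseteq> A" and e: "e > 0"
  shows "\<exists>T. openin (hol_topology A) T \<and> F0 \<in> T \<and> (\<forall>F\<in>T. F \<in> hol_funs A \<and> (\<forall>z\<in>K. norm (F z - F0 z) < e))"
proof -
  have cont: "continuous_on K F0"
    using F0 K(2) by (auto simp: hol_funs_def intro!: continuous_at_imp_continuous_on analytic_at_isCont)
  \<comment> \<open>The non-strict inequality allows closed balls, whose intersections with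
    \<open>K\<close> are compact as the subbasis requires.\<close>
  have "\<exists>d>0. \<forall>w\<in>K. dist w z \<le> d \<longrightarrow> dist (F0 w) (F0 z) < e / 2" if z: "z \<in> K" for z
  proof -
    obtain d where "d > 0" "\<forall>w\<in>K. dist w z < d \<longrightarrow> dist (F0 w) (F0 z) < e / 2"
      using cont z e unfolding continuous_on_iff by (meson half_gt_zero)
    then show ?thesis by (intro exI[of _ "d / 2"]) auto
  qed
  then obtain d where d: "\<And>z. z \<in> K \<Longrightarrow> d z > 0"
    "\<And>z w. z \<in> K \<Longrightarrow> w \<in> K \<Longrightarrow> dist w z \<le> d z \<Longrightarrow> dist (F0 w) (F0 z) < e / 2" by metis
  have "K \<subseteq> (\<Union>z\<in>K. ball z (d z))" using d(1) by auto
  then obtain Z where Z: "Z \<subseteq> K" "finite Z" "K \<subseteq> (\<Union>z\<in>Z. ball z (d z))"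
    using compactE_image[OF K(1), of K "\<lambda>z. ball z (d z)"] by auto
  define N where "N z = {F. F ` (K \<inter> cball z (d z)) \<subseteq> ball (F0 z) (e / 2)} \<inter> hol_funs A" for z
  have openN: "openin (hol_topology A) (N z)" for z
  proof -
    have "compact (K \<inter> cball z (d z))" "K \<inter> cball z (d z) \<subseteq> A" "open (ball (F0 z) (e / 2))"
      using K by (auto intro: compact_Int_closed)
    then have "{F. F ` (K \<inter> cball z (d z)) \<subseteq> ball (F0 z) (e / 2)} \<in> {{F. F ` K \<subseteq> V} |K V. compact K \<and> K \<subseteq> A \<and> open V}"
      by blast
    then show ?thesis unfolding N_def hol_topology_def
      by (intro openin_subtopology_Int topology_generated_by_Basis)
  qed
  \<comment> \<open>The first factor takes care of the empty cover, which belongs to an empty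
    \<open>K\<close>.\<close>
  define T where "T = hol_funs A \<inter> (\<Inter>z\<in>Z. N z)"
  have "openin (hol_topology A) T"
  proof (cases "Z = {}")
    case True
    then show ?thesis using openin_topspace[of "hol_topology A"] by (simp add: T_def topspace_hol_topology)
  next
    case False
    then have "T = (\<Inter>z\<in>Z. N z)" by (auto simp: T_def N_def)
    then show ?thesis using Z(2) False openN by (auto intro: openin_INT)
  qed
  moreover have "F0 \<in> T"
    using F0 Z(1) d by (auto simp: T_def N_def dist_commute)
  moreover have "F \<in> hol_funs A \<and> (\<forall>w\<in>K. norm (F w - F0 w) < e)" if F: "F \<in> T" for F
  proof (intro conjI ballI)
    show "F \<in> hol_funs A" using F by (simp add: T_def)
    fix w assume w: "w \<in> K"
    then obtain z where z: "z \<in> Z" "dist z w < d z" using Z(3) by auto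
    then have "F \<in> N z" using F unfolding T_def by blast
    moreover have "w \<in> K \<inter> cball z (d z)" using w z(2) by simp
    ultimately have "F w \<in> ball (F0 z) (e / 2)" unfolding N_def by blast
    then have "dist (F0 z) (F w) < e / 2" by simp
    moreover have "dist (F0 w) (F0 z) < e / 2" using d(2)[of z w] z Z(1) w by (auto simp: dist_commute)
    ultimately have "dist (F w) (F0 w) < e" using dist_triangle_half_r[of "F0 z" "F w" e "F0 w"] by (simp add: dist_commute)
    then show "norm (F w - F0 w) < e" by (simp add: dist_norm)
  qed
  ultimately show ?thesis by blast
qed

section \<open>Nondegenerate homogeneous parts\<close>

lemma analytic_atI: "has_power_series f a y \<Longrightarrow> analytic_at f y"
  unfolding analytic_at_def by blast

lemma partial_eqI:
  fixes f :: "real ^ 'n::finite \<Rightarrow> real"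
  assumes "analytic_at f y" "((\<lambda>s. f (y + s *\<^sub>R axis i 1)) has_real_derivative D) (at 0)"
  shows "partial i f y = D"
proof -
  have "((\<lambda>s. y + s *\<^sub>R axis i 1) has_vector_derivative axis i 1) (at 0)"
    by (auto intro!: derivative_eq_intros)
  from analytic_curve_derivative[OF _ this, of f] assms(1)
  have "((\<lambda>s. f (y + s *\<^sub>R axis i 1)) has_real_derivative partial i f y) (at 0)"
    by (simp add: axis_def if_distrib cong: if_cong)
  from DERIV_unique[OF this assms(2)] show ?thesis .
qed

text \<open>Written as a sum over \<open>i\<close> so that it also gives the right coefficient when
  the multi-indices coincide, which happens for \<open>k = 0\<close>.\<close>

definition diag_coeff :: "('n \<Rightarrow> 'k::real_normed_field) \<Rightarrow> nat \<Rightarrow> ('n::finite \<Rightarrow> nat) \<Rightarrow> 'k" where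
  "diag_coeff v k \<alpha> = (\<Sum>i\<in>UNIV. if \<alpha> = (\<lambda>j. if j = i then k else 0) then v i else 0)"

lemma hpart_diag:
  fixes v :: "'n::finite \<Rightarrow> 'k::real_normed_field"
  shows "hpart (diag_coeff v k) k x = (\<Sum>i\<in>UNIV. v i * x $ i ^ k)"
proof -
  have "hpart (diag_coeff v k) k x = (\<Sum>\<alpha>\<in>{\<alpha>. mdeg \<alpha> = k}. \<Sum>i\<in>UNIV.
      if \<alpha> = (\<lambda>j. if j = i then k else 0) then v i * mpow x \<alpha> else 0)"
    unfolding hpart_def diag_coeff_def sum_distrib_right by (intro sum.cong refl) auto
  also have "\<dots> = (\<Sum>i\<in>UNIV. \<Sum>\<alpha>\<in>{\<alpha>. mdeg \<alpha> = k}.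
      if \<alpha> = (\<lambda>j. if j = i then k else 0) then v i * mpow x \<alpha> else 0)" by (rule sum.swap)
  also have "\<dots> = (\<Sum>i\<in>UNIV. v i * x $ i ^ k)"
  proof (rule sum.cong[OF refl])
    fix i :: 'n
    have "mdeg (\<lambda>j. if j = i then k else 0) = k" by (simp add: mdeg_def)
    moreover have "mpow x (\<lambda>j. if j = i then k else 0) = x $ i ^ k"
      by (simp add: if_distrib[of "power _"] cong: if_cong)
    ultimately show "(\<Sum>\<alpha>\<in>{\<alpha>. mdeg \<alpha> = k}. if \<alpha> = (\<lambda>j. if j = i then k else 0) then v i * mpow x \<alpha> else 0) = v i * x $ i ^ k"
      by (subst sum.delta[OF finite_mdeg_eq]) simp
  qed
  finally show ?thesis .
qed

lemma diag_coeff_eq_0: "mdeg \<alpha> \<noteq> k \<Longrightarrow> diag_coeff v k \<alpha> = 0"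
  unfolding diag_coeff_def by (intro sum.neutral ballI) (auto simp: mdeg_def)

lemma has_power_series_diag: "has_power_series (\<lambda>x. \<Sum>i\<in>UNIV. v i * x $ i ^ k) (diag_coeff v k) 0"
proof -
  have "(\<lambda>\<alpha>. if mdeg \<alpha> = k then diag_coeff v k \<alpha> else 0) = diag_coeff v k"
    by (auto simp: diag_coeff_eq_0)
  moreover have "hpart (diag_coeff v k) k = (\<lambda>x. \<Sum>i\<in>UNIV. v i * x $ i ^ k)" by (rule ext) (rule hpart_diag)
  ultimately show ?thesis using has_power_series_hpart[of "diag_coeff v k" k] by (simp only:)
qed

lemma hpart_add: "hpart (\<lambda>\<alpha>. a \<alpha> + b \<alpha>) k x = hpart a k x + hpart b k x"
  by (simp add: hpart_def distrib_right sum.distrib)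

lemma partial_hpart_diag:
  fixes a :: "('n::finite \<Rightarrow> nat) \<Rightarrow> real"
  shows "partial i (hpart (\<lambda>\<alpha>. a \<alpha> + diag_coeff v (Suc k) \<alpha>) (Suc k)) x =
    partial i (hpart a (Suc k)) x + real (Suc k) * v i * x $ i ^ k"
proof (rule partial_eqI[OF analytic_at_hpart])
  have "((\<lambda>s. x + s *\<^sub>R axis i 1) has_vector_derivative axis i 1) (at 0)"
    by (auto intro!: derivative_eq_intros)
  from analytic_curve_derivative[OF analytic_at_hpart this, of a "Suc k"]
  have 1: "((\<lambda>s. hpart a (Suc k) (x + s *\<^sub>R axis i 1)) has_real_derivative partial i (hpart a (Suc k)) x) (at 0)"
    by (simp add: axis_def if_distrib cong: if_cong)
  have "((\<lambda>s. v j * (x $ j + s * (if j = i then 1 else 0)) ^ Suc k) has_real_derivative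
      (if j = i then real (Suc k) * v i * x $ i ^ k else 0)) (at 0)" for j
  proof -
    have "((\<lambda>s. x $ j + s * (if j = i then 1 else 0)) has_real_derivative (if j = i then 1 else 0)) (at 0)"
      by (auto intro!: derivative_eq_intros)
    from DERIV_cmult[OF DERIV_power[OF this, of "Suc k"], of "v j"]
    show ?thesis by (cases "j = i") (simp_all add: mult_ac)
  qed
  then have 2: "((\<lambda>s. \<Sum>j\<in>UNIV. v j * (x $ j + s * (if j = i then 1 else 0)) ^ Suc k) has_real_derivative
      (\<Sum>j\<in>UNIV. if j = i then real (Suc k) * v i * x $ i ^ k else 0)) (at 0)"
    by (intro DERIV_sum)
  have "(\<lambda>s. hpart (\<lambda>\<alpha>. a \<alpha> + diag_coeff v (Suc k) \<alpha>) (Suc k) (x + s *\<^sub>R axis i 1)) =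
      (\<lambda>s. hpart a (Suc k) (x + s *\<^sub>R axis i 1) + (\<Sum>j\<in>UNIV. v j * (x $ j + s * (if j = i then 1 else 0)) ^ Suc k))"
    unfolding hpart_add hpart_diag by (rule ext) (simp add: axis_def)
  with DERIV_add[OF 1 2]
  show "((\<lambda>s. hpart (\<lambda>\<alpha>. a \<alpha> + diag_coeff v (Suc k) \<alpha>) (Suc k) (x + s *\<^sub>R axis i 1)) has_real_derivative
      partial i (hpart a (Suc k)) x + real (Suc k) * v i * x $ i ^ k) (at 0)" by simp
qed

text \<open>
  If \<open>x\<close> is a critical point with support \<open>I\<close> and \<open>x\<^sub>i = 1\<close>, the critical equations determine \<open>v\<^sub>j\<close> for
  \<open>j \<in> I\<close> from \<open>x\<close> and leave the other \<open>v\<^sub>j\<close> free. So \<open>v = \<Phi> I y\<close>, where \<open>y\<close> collects the \<open>x\<^sub>j\<close> with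
  \<open>j \<in> I\<close> and these free \<open>v\<^sub>j\<close>, and \<open>y\<close> lies on the hyperplane \<open>y\<^sub>i = 1\<close>.
\<close>

lemma degenerate_negligible:
  fixes a :: "('n::finite \<Rightarrow> nat) \<Rightarrow> real"
  shows "negligible {v :: real ^ 'n. \<not> nondegenerate (\<lambda>\<alpha>. a \<alpha> + diag_coeff (\<lambda>i. v $ i) (Suc k) \<alpha>) (Suc k)}"
proof -
  let ?H = "\<lambda>j. partial j (hpart a (Suc k))"
  define proj :: "'n set \<Rightarrow> real ^ 'n \<Rightarrow> real ^ 'n" where "proj I y = (\<chi> j. if j \<in> I then y $ j else 0)" for I y
  define \<Phi> :: "'n set \<Rightarrow> real ^ 'n \<Rightarrow> real ^ 'n" where
    "\<Phi> I y = (\<chi> j. if j \<in> I then - ?H j (proj I y) / (real (Suc k) * y $ j ^ k) else y $ j)" for I y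
  define D :: "'n set \<Rightarrow> 'n \<Rightarrow> (real ^ 'n) set" where "D I i = {y. y $ i = 1 \<and> (\<forall>j\<in>I. y $ j \<noteq> 0)}" for I i
  \<comment> \<open>A hyperplane is a null set, and a differentiable map between spaces of equal
    dimension preserves null sets. The condition in \<open>D\<close> keeps the denominators of
    \<open>\<Phi>\<close> away from zero.\<close>
  have neg: "negligible (\<Phi> I ` D I i)" for I i
  proof (rule negligible_differentiable_image_negligible)
    have "negligible {y :: real ^ 'n. y \<bullet> axis i 1 = 1}"
      by (rule negligible_standard_hyperplane) (auto simp: Basis_vec_def)
    moreover have "D I i \<subseteq> {y. y \<bullet> axis i 1 = 1}"
    proof
      fix y assume "y \<in> D I i"
      then have "y $ i = 1" unfolding D_def by blast
      then show "y \<in> {y. y \<bullet> axis i 1 = 1}" by (simp add: inner_axis)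
    qed
    ultimately show "negligible (D I i)" by (rule negligible_subset)
    show "\<Phi> I differentiable_on D I i"
      unfolding differentiable_on_def
    proof (rule ballI, rule differentiable_at_withinI)
      fix y assume y: "y \<in> D I i"
      have "linear (proj I)" by (rule linearI) (simp_all add: proj_def vec_eq_iff)
      then have "(proj I has_derivative proj I) (at y)" by (rule linear_imp_has_derivative)
      then have dp: "proj I differentiable (at y)" by (rule differentiableI)
      have dn: "(\<lambda>y :: real ^ 'n. y $ j) differentiable (at y)" for j
        by (rule differentiableI) (rule bounded_linear_imp_has_derivative[OF bounded_linear_vec_nth])
      have "(\<lambda>y. \<Phi> I y $ j) differentiable (at y)" for j
      proof (cases "j \<in> I")
        case True
        have "?H j differentiable (at (proj I y))"
          by (intro analytic_at_imp_differentiable analytic_at_partial analytic_at_hpart)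
        then have dH: "(\<lambda>y. ?H j (proj I y)) differentiable (at y)"
          using differentiable_chain_at[OF dp] by (simp add: o_def)
        have "y $ j \<noteq> 0" using y True by (simp add: D_def)
        then have "(\<lambda>y. - ?H j (proj I y) / (real (Suc k) * y $ j ^ k)) differentiable (at y)"
          by (intro differentiable_divide differentiable_minus differentiable_mult differentiable_const differentiable_power dH dn) auto
        with True show ?thesis by (simp add: \<Phi>_def)
      next
        case False
        with dn show ?thesis by (simp add: \<Phi>_def)
      qed
      then show "\<Phi> I differentiable (at y)"
        by (subst differentiable_componentwise_within) (auto simp: Basis_vec_def inner_axis)
    qed
  qed simp
  have "{v. \<not> nondegenerate (\<lambda>\<alpha>. a \<alpha> + diag_coeff (\<lambda>i. v $ i) (Suc k) \<alpha>) (Suc k)} \<subseteq> (\<Union>(I, i)\<in>UNIV. \<Phi> I ` D I i)"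
  proof
    fix v :: "real ^ 'n" assume "v \<in> {v. \<not> nondegenerate (\<lambda>\<alpha>. a \<alpha> + diag_coeff (\<lambda>i. v $ i) (Suc k) \<alpha>) (Suc k)}"
    then obtain x where x: "x \<noteq> 0" "\<And>i. ?H i x + real (Suc k) * v $ i * x $ i ^ k = 0"
      unfolding nondegenerate_def partial_hpart_diag by auto
    from x(1) obtain i where i: "x $ i \<noteq> 0" by (auto simp: vec_eq_iff)
    define I where "I = {j. x $ j \<noteq> 0}"
    define x' where "x' = inverse (x $ i) *\<^sub>R x"
    have x': "?H j x' + real (Suc k) * v $ j * x' $ j ^ k = 0" for j
    proof -
      have "?H j x' + real (Suc k) * v $ j * x' $ j ^ k = inverse (x $ i) ^ k * (?H j x + real (Suc k) * v $ j * x $ j ^ k)"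
        unfolding x'_def using i by (subst partial_hpart_scaleR) (auto simp: power_mult_distrib algebra_simps)
      then show ?thesis by (simp only: x(2) mult_zero_right)
    qed
    define y where "y = (\<chi> j. if j \<in> I then x' $ j else v $ j)"
    have pr: "proj I y = x'" using i by (auto simp: proj_def y_def x'_def I_def vec_eq_iff)
    have ne: "x' $ j \<noteq> 0" if "j \<in> I" for j using that i by (simp add: x'_def I_def)
    have "\<Phi> I y = v"
      unfolding vec_eq_iff
    proof
      fix j
      show "\<Phi> I y $ j = v $ j"
      proof (cases "j \<in> I")
        case True
        have "- ?H j x' = v $ j * (real (Suc k) * x' $ j ^ k)" using x'[of j] by (simp add: algebra_simps)
        then have "- ?H j x' / (real (Suc k) * x' $ j ^ k) = v $ j"
          using ne[OF True] by (simp add: nonzero_divide_eq_eq del: of_nat_Suc)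
        moreover have "y $ j = x' $ j" using True by (simp add: y_def)
        ultimately show ?thesis using True by (simp add: \<Phi>_def pr)
      next
        case False
        then have "y $ j = v $ j" by (simp add: y_def)
        with False show ?thesis by (simp add: \<Phi>_def)
      qed
    qed
    moreover have "y \<in> D I i" using i ne by (auto simp: D_def y_def x'_def I_def)
    ultimately have "v \<in> \<Phi> I ` D I i" by blast
    then show "v \<in> (\<Union>(I, i)\<in>UNIV. \<Phi> I ` D I i)" by blast
  qed
  \<comment> \<open>Only finitely many pairs of a support and a normalised coordinate occur.\<close>
  moreover have "negligible (\<Union>(I, i)\<in>UNIV. \<Phi> I ` D I i)"
    by (rule negligible_Union) (auto simp: neg)
  ultimately show ?thesis using negligible_subset by blast
qed

lemma nondegenerate_perturbation:
  fixes a :: "('n::finite \<Rightarrow> nat) \<Rightarrow> real"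
  assumes "open V" "0 \<in> V"
  shows "\<exists>v\<in>V. nondegenerate (\<lambda>\<alpha>. a \<alpha> + diag_coeff (\<lambda>i. v $ i) (Suc k) \<alpha>) (Suc k)"
proof (rule ccontr)
  assume "\<not> ?thesis"
  then have "V \<subseteq> {v. \<not> nondegenerate (\<lambda>\<alpha>. a \<alpha> + diag_coeff (\<lambda>i. v $ i) (Suc k) \<alpha>) (Suc k)}" by blast
  then have "negligible V" by (rule negligible_subset[OF degenerate_negligible])
  moreover have "\<not> negligible V" using assms by (intro open_not_negligible) auto
  ultimately show False by simp
qed

lemma nondegenerate_sphereI:
  fixes a :: "('n::finite \<Rightarrow> nat) \<Rightarrow> real"
  assumes "\<And>x. norm x = 1 \<Longrightarrow> \<exists>i. partial i (hpart a (Suc k)) x \<noteq> 0"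
  shows "nondegenerate a (Suc k)"
  unfolding nondegenerate_def
proof (intro allI impI)
  fix x :: "real ^ 'n" assume x: "x \<noteq> 0"
  then have "norm (x /\<^sub>R norm x) = 1" by simp
  from assms[OF this] obtain i where i: "partial i (hpart a (Suc k)) (x /\<^sub>R norm x) \<noteq> 0" by blast
  have "partial i (hpart a (Suc k)) x = norm x ^ k * partial i (hpart a (Suc k)) (x /\<^sub>R norm x)"
    using partial_hpart_scaleR[of "norm x" i a k "x /\<^sub>R norm x"] x by simp
  with i x have "partial i (hpart a (Suc k)) x \<noteq> 0" by (simp only: mult_eq_0_iff power_eq_0_iff norm_eq_zero) simp
  then show "\<exists>i. partial i (hpart a (Suc k)) x \<noteq> 0" ..
qed

section \<open>Openness\<close>

text \<open>A set of arbitrary holomorphic germs, as the direct limit topology demands; real parts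
  make the real condition meaningful there and leave the coefficients of complexified real germs
  unchanged.\<close>

definition good_germs :: "nat \<Rightarrow> (complex ^ 'n::finite \<Rightarrow> complex) set set" where
  "good_germs k = {germ 0 F |F. \<exists>a. has_power_series F a 0 \<and> nondegenerate (\<lambda>\<alpha>. Re (a \<alpha>)) k}"

lemma good_germsE:
  assumes "germ 0 F \<in> good_germs k"
  obtains a where "has_power_series F a 0" "nondegenerate (\<lambda>\<alpha>. Re (a \<alpha>)) k"
proof -
  from assms obtain F' a where F': "germ 0 F = germ 0 F'" "has_power_series F' a 0" "nondegenerate (\<lambda>\<alpha>. Re (a \<alpha>)) k"
    unfolding good_germs_def by blast
  from F'(1) have "\<forall>\<^sub>F z in nhds 0. F z = F' z" by (simp add: germ_eq_iff)
  then have "has_power_series F a 0" using F'(2) has_power_series_cong[of F F' 0 a] by simp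
  then show thesis using F'(3) by (rule that)
qed

lemma good_germsI:
  assumes "has_power_series F a 0" "nondegenerate (\<lambda>\<alpha>. Re (a \<alpha>)) k"
  shows "germ 0 F \<in> good_germs k"
  unfolding good_germs_def by (rule CollectI, rule exI[of _ F], intro conjI refl exI[of _ a] assms)

lemma direct_limit_open_good_germs: "direct_limit_open (good_germs (Suc k) :: (complex ^ 'n::finite \<Rightarrow> complex) set set)"
  unfolding direct_limit_open_def
proof (intro conjI allI impI)
  show "good_germs (Suc k) \<subseteq> (hol_germs :: (complex ^ 'n \<Rightarrow> complex) set set)"
  proof
    fix G :: "(complex ^ 'n \<Rightarrow> complex) set" assume "G \<in> good_germs (Suc k)"
    then obtain F a where F: "G = germ 0 F" "has_power_series F a 0" unfolding good_germs_def by blast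
    then have "analytic_at F 0" unfolding analytic_at_def by (intro exI)
    then show "G \<in> hol_germs" unfolding hol_germs_def F(1) by (intro imageI CollectI)
  qed
next
  fix A :: "(complex ^ 'n) set" assume A: "open A \<and> 0 \<in> A"
  obtain \<rho> where \<rho>: "\<rho> > 0" "cball 0 \<rho> \<subseteq> A" using A open_contains_cball by blast
  show "openin (hol_topology A) {F \<in> hol_funs A. germ 0 F \<in> good_germs (Suc k)}"
  proof (subst openin_subopen, rule ballI)
    fix F0 assume F0: "F0 \<in> {F \<in> hol_funs A. germ 0 F \<in> good_germs (Suc k)}"
    then obtain a where a: "has_power_series F0 a 0" "nondegenerate (\<lambda>\<alpha>. Re (a \<alpha>)) (Suc k)"
      using good_germsE by blast
    obtain c where c: "c > 0" "\<And>x. norm x = 1 \<Longrightarrow> c \<le> (\<Sum>i\<in>UNIV. (partial i (hpart (\<lambda>\<alpha>. Re (a \<alpha>)) (Suc k)) x)\<^sup>2)"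
      using nondegenerate_lower_bound[OF a(2)] by blast
    \<comment> \<open>If the gradient for \<open>F\<close> vanished at a unit vector, every partial
      derivative of the corresponding part of \<open>F0\<close> would be at most
      \<open>\<eta>\<close> there in absolute value, against the lower bound
      \<open>c\<close>.\<close>
    define \<eta> where "\<eta> = sqrt (c / (2 * real CARD('n)))"
    have \<eta>: "\<eta> > 0" "real CARD('n) * \<eta>\<^sup>2 < c" using c(1) by (auto simp: \<eta>_def field_simps)
    \<comment> \<open>The uniform distance on the ball which \<open>partial_hpart_bound\<close>
      converts into \<open>\<eta>\<close>.\<close>
    define e where "e = \<eta> / (2 / \<rho>) ^ Suc k"
    have e: "e > 0" "(2 / \<rho>) ^ Suc k * e = \<eta>" using \<eta>(1) \<rho>(1) by (auto simp: e_def)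
    obtain T where T: "openin (hol_topology A) T" "F0 \<in> T"
      "\<And>F. F \<in> T \<Longrightarrow> F \<in> hol_funs A" "\<And>F z. F \<in> T \<Longrightarrow> z \<in> cball 0 \<rho> \<Longrightarrow> norm (F z - F0 z) < e"
      using hol_topology_uniform_nbhd[of F0 A "cball 0 \<rho>" e] F0 \<rho>(2) e(1) by auto
    have an: "analytic_at F z" if "F \<in> hol_funs A" "z \<in> A" for F z using that by (simp add: hol_funs_def)
    have "germ 0 F \<in> good_germs (Suc k)" if F: "F \<in> T" for F
    proof -
      obtain b where b: "has_power_series F b 0"
        using an[OF T(3)[OF F]] A unfolding analytic_at_def by blast
      have "\<exists>i. partial i (hpart (\<lambda>\<alpha>. Re (b \<alpha>)) (Suc k)) x \<noteq> 0" if x: "norm x = 1" for x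
      proof (rule ccontr)
        assume "\<not> ?thesis"
        then have z: "partial i (hpart (\<lambda>\<alpha>. Re (b \<alpha>)) (Suc k)) x = 0" for i by simp
        have "(\<Sum>i\<in>UNIV. (partial i (hpart (\<lambda>\<alpha>. Re (a \<alpha>)) (Suc k)) x)\<^sup>2) \<le> (\<Sum>i\<in>(UNIV :: 'n set). \<eta>\<^sup>2)"
        proof (rule sum_mono)
          fix i
          have "\<bar>partial i (hpart (\<lambda>\<alpha>. Re (b \<alpha> - a \<alpha>)) (Suc k)) x\<bar> \<le> (2 / \<rho>) ^ Suc k * e"
          proof (rule partial_hpart_bound)
            show "has_power_series (\<lambda>z. F z - F0 z) (\<lambda>\<alpha>. b \<alpha> - a \<alpha>) 0" by (rule has_power_series_diff[OF b a(1)])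
            fix z :: "complex ^ 'n" assume z: "z \<in> cball 0 \<rho>"
            then show "norm (F z - F0 z) \<le> e" using T(4)[OF F z] by simp
            have "z \<in> A" using z \<rho>(2) by blast
            moreover have "F0 \<in> hol_funs A" using F0 by simp
            ultimately obtain a1 a2 where "has_power_series F a1 z" "has_power_series F0 a2 z"
              using an[OF T(3)[OF F]] an[of F0] unfolding analytic_at_def by blast
            then have "has_power_series (\<lambda>z. F z - F0 z) (\<lambda>\<alpha>. a1 \<alpha> - a2 \<alpha>) z" by (rule has_power_series_diff)
            then show "analytic_at (\<lambda>z. F z - F0 z) z" by (rule analytic_atI)
          qed (use \<rho>(1) x in auto)
          also have "hpart (\<lambda>\<alpha>. Re (b \<alpha> - a \<alpha>)) (Suc k) = (\<lambda>x. hpart (\<lambda>\<alpha>. Re (b \<alpha>)) (Suc k) x - hpart (\<lambda>\<alpha>. Re (a \<alpha>)) (Suc k) x)"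
            by (rule ext) (simp add: hpart_diff)
          also have "partial i \<dots> x = - partial i (hpart (\<lambda>\<alpha>. Re (a \<alpha>)) (Suc k)) x"
            by (subst partial_diff) (auto intro: analytic_at_hpart simp: z)
          finally have "\<bar>partial i (hpart (\<lambda>\<alpha>. Re (a \<alpha>)) (Suc k)) x\<bar> \<le> \<eta>" by (simp only: abs_minus_cancel e(2))
          then show "(partial i (hpart (\<lambda>\<alpha>. Re (a \<alpha>)) (Suc k)) x)\<^sup>2 \<le> \<eta>\<^sup>2"
            using \<eta>(1) by (simp add: abs_le_square_iff[symmetric])
        qed
        with c(2)[OF x] \<eta>(2) show False by simp
      qed
      then have "nondegenerate (\<lambda>\<alpha>. Re (b \<alpha>)) (Suc k)" by (rule nondegenerate_sphereI)
      with b show ?thesis by (rule good_germsI)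
    qed
    with T show "\<exists>T. openin (hol_topology A) T \<and> F0 \<in> T \<and> T \<subseteq> {F \<in> hol_funs A. germ 0 F \<in> good_germs (Suc k)}"
      by (intro exI[of _ T]) auto
  qed
qed

section \<open>Complexification and density\<close>

lemma eventually_cvec:
  assumes "eventually P (nhds (0 :: complex ^ 'n::finite))"
  shows "\<forall>\<^sub>F y in nhds 0. P (cvec y)"
proof -
  obtain d where d: "d > 0" "\<And>z. dist z 0 < d \<Longrightarrow> P z" using assms by (auto simp: eventually_nhds_metric)
  show ?thesis unfolding eventually_nhds_metric
  proof (intro exI[of _ d] conjI allI impI d(1))
    fix y :: "real ^ 'n" assume "dist y 0 < d"
    then show "P (cvec y)" by (intro d(2)) simp
  qed
qed

lemma power_series_eventually_eq:
  assumes "has_power_series F a y" "has_power_series G a y"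
  shows "\<forall>\<^sub>F z in nhds y. F z = G z"
proof -
  from assms obtain r s where rs: "r > 0" "s > 0"
    "\<And>h. norm h < r \<Longrightarrow> ((\<lambda>\<alpha>. a \<alpha> * mpow h \<alpha>) has_sum F (y + h)) UNIV"
    "\<And>h. norm h < s \<Longrightarrow> ((\<lambda>\<alpha>. a \<alpha> * mpow h \<alpha>) has_sum G (y + h)) UNIV"
    unfolding has_power_series_def by blast
  show ?thesis unfolding eventually_nhds_metric
  proof (rule exI[of _ "min r s"], intro conjI allI impI)
    fix z assume "dist z y < min r s"
    then have "norm (z - y) < r" "norm (z - y) < s" by (simp_all add: dist_norm)
    from has_sum_unique[OF rs(3)[OF this(1)] rs(4)[OF this(2)]] show "F z = G z" by simp
  qed (use rs in simp)
qed

text \<open>Any two holomorphic extensions agree at real points and hence have the same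
  coefficients, so the set of all extensions is a single germ.\<close>

lemma complexify_eq_germ:
  fixes \<C> :: "('a::topological_space, 'n::finite) chart set"
  assumes atlas: "analytic_structure \<C>" and c: "c \<in> \<C>" "p \<in> fst c" "snd c p = 0"
    and F: "has_power_series F b 0" "\<forall>\<^sub>F y in nhds 0. F (cvec y) = of_real (f (chart_inv c y))"
  shows "complexify c (germ p f) = germ 0 F"
proof (rule equalityI; rule subsetI)
  fix F' assume "F' \<in> germ 0 F"
  then have ev: "\<forall>\<^sub>F z in nhds 0. F' z = F z" by (simp add: germ_def)
  have "has_power_series F' b 0" using F(1) has_power_series_cong[OF ev, of b] by simp
  then have an: "analytic_at F' 0" unfolding analytic_at_def by (intro exI)
  have "\<forall>\<^sub>F y in nhds 0. F' (cvec y) = of_real (f (chart_inv c y))"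
    using eventually_cvec[OF ev] F(2) by eventually_elim simp
  then show "F' \<in> complexify c (germ p f)"
    unfolding complexify_def cvec_def using an germ_self[of f p] by blast
next
  fix F' assume "F' \<in> complexify c (germ p f)"
  then obtain f' where f': "analytic_at F' 0" "f' \<in> germ p f"
    "\<forall>\<^sub>F y in nhds 0. F' (cvec y) = of_real (f' (chart_inv c y))"
    unfolding complexify_def cvec_def by blast
  obtain b' where b': "has_power_series F' b' 0" using f'(1) unfolding analytic_at_def by (rule exE)
  have "\<forall>\<^sub>F x in nhds p. f' x = f x" using f'(2) by (simp add: germ_def)
  from eventually_chart_inv[OF atlas c(1,2) this]
  have "\<forall>\<^sub>F y in nhds 0. f' (chart_inv c y) = f (chart_inv c y)"
    unfolding c(3) by (rule eventually_mono) simp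
  with f'(3) F(2) have "\<forall>\<^sub>F y in nhds 0. F' (cvec y) - F (cvec y) = 0" by eventually_elim simp
  from complex_power_series_zero[OF has_power_series_diff[OF b' F(1)] this]
  have "b' = b" by (simp add: fun_eq_iff)
  with b' F(1) have "\<forall>\<^sub>F z in nhds 0. F' z = F z" by (intro power_series_eventually_eq) auto
  then show "F' \<in> germ 0 F" by (simp add: germ_def)
qed

text \<open>On a compact set the functions for \<open>v\<close> and \<open>v'\<close> differ by at
  most a constant times \<open>norm (v - v')\<close>, while the image under \<open>v\<close> keeps a
  positive distance from the complement of the open target. Subbasic sets therefore have open
  preimages.\<close>

lemma diag_perturbation_continuous:
  fixes F :: "complex ^ 'n::finite \<Rightarrow> complex"
  assumes A: "open A" and an: "\<And>z. z \<in> A \<Longrightarrow> analytic_at F z"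
  shows "continuous_map euclidean (hol_topology A)
    (\<lambda>v :: real ^ 'n. restrict (\<lambda>z. F z + (\<Sum>i\<in>UNIV. of_real (v $ i) * z $ i ^ k)) A)"
proof -
  let ?F = "\<lambda>v :: real ^ 'n. \<lambda>z. F z + (\<Sum>i\<in>UNIV. of_real (v $ i) * z $ i ^ k)"
  have anF: "analytic_at (?F v) z" if "z \<in> A" for v z
    by (intro analytic_at_add analytic_at_sum analytic_at_mult analytic_at_const analytic_at_power
        analytic_at_nth an that finite)
  have hol: "restrict (?F v) A \<in> hol_funs A" for v
    unfolding hol_funs_def
  proof (intro CollectI conjI ballI)
    show "restrict (?F v) A \<in> extensional A" by (rule restrict_extensional)
    fix z assume z: "z \<in> A"
    have "\<forall>\<^sub>F w in nhds z. restrict (?F v) A w = ?F v w"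
      using eventually_nhds_in_open[OF A z] by (rule eventually_mono) simp
    show "analytic_at (restrict (?F v) A) z"
      by (rule iffD2[OF analytic_at_cong_nhds[OF \<open>\<forall>\<^sub>F w in nhds z. restrict (?F v) A w = ?F v w\<close>] anF[OF z]])
  qed
  have op: "open {v. restrict (?F v) A ` K \<subseteq> V}" if K: "compact K" "K \<subseteq> A" and V: "open V" for K V
    unfolding open_contains_ball
  proof
    fix v assume "v \<in> {v. restrict (?F v) A ` K \<subseteq> V}"
    then have v: "?F v ` K \<subseteq> V" using K(2) by (auto simp: image_subset_iff)
    have "continuous_on K (?F v)"
      using K(2) anF by (auto intro!: continuous_at_imp_continuous_on analytic_at_isCont)
    then have "compact (?F v ` K)" using K(1) by (rule compact_continuous_image)
    then obtain e where e: "e > 0" "(\<Union>w\<in>?F v ` K. ball w e) \<subseteq> V"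
      using compact_subset_open_imp_ball_epsilon_subset[OF _ V v] by blast
    obtain B where B: "B > 0" "\<And>z. z \<in> K \<Longrightarrow> norm z \<le> B"
      using compact_imp_bounded[OF K(1)] bounded_pos by blast
    define d where "d = e / (real CARD('n) * B ^ k + 1)"
    have pos: "real CARD('n) * B ^ k + 1 > 0" using B(1) by (simp add: add_nonneg_pos)
    have d: "d > 0" "real CARD('n) * B ^ k * d < e"
    proof -
      show "d > 0" using e(1) pos by (simp add: d_def)
      then have "real CARD('n) * B ^ k * d < (real CARD('n) * B ^ k + 1) * d" by simp
      also have "\<dots> = e" using pos by (simp add: d_def)
      finally show "real CARD('n) * B ^ k * d < e" .
    qed
    have "v' \<in> {v. restrict (?F v) A ` K \<subseteq> V}" if v': "v' \<in> ball v d" for v'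
    proof -
      have "?F v' z \<in> V" if z: "z \<in> K" for z
      proof -
        have "?F v z - ?F v' z = (\<Sum>i\<in>UNIV. of_real ((v - v') $ i) * z $ i ^ k)"
          by (simp add: sum_subtractf[symmetric] left_diff_distrib)
        also have "norm \<dots> \<le> (\<Sum>i\<in>(UNIV :: 'n set). d * B ^ k)"
        proof (rule order.trans[OF norm_sum], rule sum_mono)
          fix i
          have "\<bar>(v - v') $ i\<bar> \<le> d"
            using component_le_norm_cart[of "v - v'" i] v' by (simp add: dist_norm)
          moreover have "norm (z $ i) ^ k \<le> B ^ k"
            using B(2)[OF z] Finite_Cartesian_Product.norm_nth_le[of z i] by (intro power_mono) auto
          ultimately show "norm (of_real ((v - v') $ i) * z $ i ^ k) \<le> d * B ^ k"
            unfolding norm_mult norm_of_real norm_power by (intro mult_mono) auto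
        qed
        also have "\<dots> < e" using d(2) by (simp add: mult_ac)
        finally have "?F v' z \<in> ball (?F v z) e" by (simp add: dist_norm)
        then show ?thesis using e(2) z by blast
      qed
      then show ?thesis using K(2) by (auto simp: image_subset_iff)
    qed
    then have "ball v d \<subseteq> {v. restrict (?F v) A ` K \<subseteq> V}" by (rule subsetI)
    with d(1) show "\<exists>e>0. ball v e \<subseteq> {v. restrict (?F v) A ` K \<subseteq> V}" by blast
  qed
  show ?thesis unfolding hol_topology_def
  proof (rule continuous_map_into_subtopology)
    show "(\<lambda>v. restrict (?F v) A) \<in> topspace euclidean \<rightarrow> hol_funs A" using hol by simp
    show "continuous_map euclidean
       (topology_generated_by {{F. F ` K \<subseteq> V} |K V. compact K \<and> K \<subseteq> A \<and> open V}) (\<lambda>v. restrict (?F v) A)"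
    proof (rule continuous_on_generated_topo)
      fix U :: "(complex ^ 'n \<Rightarrow> complex) set" assume "U \<in> {{F. F ` K \<subseteq> V} |K V. compact K \<and> K \<subseteq> A \<and> open V}"
      then obtain K V where KV: "U = {F. F ` K \<subseteq> V}" "compact K" "K \<subseteq> A" "open V" by blast
      have "(\<lambda>v. restrict (?F v) A) -` U \<inter> topspace euclidean = {v. restrict (?F v) A ` K \<subseteq> V}"
        unfolding KV(1) by auto
      then show "openin euclidean ((\<lambda>v. restrict (?F v) A) -` U \<inter> topspace euclidean)"
        using op[OF KV(2-4)] by (simp only: open_openin[symmetric])
    next
      have "(UNIV :: (complex ^ 'n \<Rightarrow> complex) set) \<in> {{F. F ` K \<subseteq> V} |K V. compact K \<and> K \<subseteq> A \<and> open V}"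
        by (intro CollectI exI[of _ "{}"] exI[of _ UNIV]) auto
      then show "(\<lambda>v. restrict (?F v) A) ` topspace euclidean \<subseteq> \<Union> {{F. F ` K \<subseteq> V} |K V. compact K \<and> K \<subseteq> A \<and> open V}"
        by blast
    qed
  qed
qed

section \<open>Openness, density and instability combined\<close>

theorem theorem1p1:
  fixes \<C> :: "('a::{t2_space, second_countable_topology}, 'n::finite) chart set"
    and g :: "'a \<Rightarrow> ('a, 'n) tvec \<Rightarrow> ('a, 'n) tvec \<Rightarrow> real"
    and p :: 'a and c :: "('a, 'n) chart"
    and \<mm> :: "('a \<Rightarrow> real) set set" and k :: nat
  assumes "analytic_structure \<C>"
    and "analytic_riemannian_metric \<C> g"
    and "c \<in> \<C>" and "p \<in> fst c" and "snd c p = 0"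
    and "maximalideal \<mm> (germ_ring \<C> p)"
    and "k \<ge> 2"
  shows "let \<T> = subtopology (germ_topology \<C> c p) (ideal_power (germ_ring \<C> p) \<mm> k) in
         \<exists>\<A>. openin \<T> \<A> \<and> \<T> closure_of \<A> = topspace \<T> \<and>
           (\<forall>A U \<mu>. open A \<and> p \<in> A \<and> (\<forall>x\<in>A. analytic_fun_at \<C> U x) \<and> germ p U \<in> \<A> \<and>
              analytic_one_form \<C> A \<mu> \<and> weak_magnetism \<C> c U \<mu> p \<longrightarrow>
              totally_unstable \<C> g A U \<mu> p)"
proof -
  note atlas = assms(1) and metric = assms(2) and c = assms(3-5) and maximal = assms(6)
  let ?R = "germ_ring \<C> p"
  define I where "I = ideal_power ?R \<mm> k"
  define \<T> where "\<T> = subtopology (germ_topology \<C> c p) I"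
  obtain k2 where k2: "k = k2 + 2" using assms(7) by (metis add.commute le_Suc_ex)
  have kS: "k = Suc (Suc k2)" by (simp add: k2)
  have openT: "openin \<T> S \<longleftrightarrow> (\<exists>W. direct_limit_open W \<and> S = complexify c -` W \<inter> carrier ?R \<inter> I)" for S
    unfolding \<T>_def openin_subtopology germ_topology_def openin_pullback_topology openin_hol_germ_topology
    by blast
  define \<A> where "\<A> = complexify c -` good_germs k \<inter> carrier ?R \<inter> I"
  have openA: "openin \<T> \<A>"
    unfolding openT \<A>_def kS by (rule exI, rule conjI, rule direct_limit_open_good_germs, rule refl)
  \<comment> \<open>Each germ of the ideal power gets a representative, its real Taylor coefficients
    and a holomorphic extension with the same coefficients.\<close>
  have rep: "\<exists>f a F. G = germ p f \<and> analytic_fun_at \<C> f p \<and> has_power_series (f \<circ> chart_inv c) a 0 \<and>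
      (\<forall>\<alpha>. mdeg \<alpha> < k \<longrightarrow> a \<alpha> = 0) \<and> has_power_series F (\<lambda>\<alpha>. complex_of_real (a \<alpha>)) 0 \<and>
      (\<forall>\<^sub>F y in nhds 0. F (cvec y) = of_real (f (chart_inv c y)))" if GI: "G \<in> I" for G
  proof -
    obtain f a where f: "G = germ p f" "analytic_fun_at \<C> f p" "has_power_series (f \<circ> chart_inv c) a 0"
      "\<forall>\<alpha>. mdeg \<alpha> < k \<longrightarrow> a \<alpha> = 0"
      using ideal_power_order[OF atlas c maximal GI[unfolded I_def]] by blast
    obtain F where F: "has_power_series F (\<lambda>\<alpha>. complex_of_real (a \<alpha>)) 0"
      "\<forall>\<^sub>F y in nhds 0. F (cvec y) = of_real ((f \<circ> chart_inv c) y)"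
      using power_series_complexification[OF f(3)] by blast
    show ?thesis
      by (rule exI[of _ f], rule exI[of _ a], rule exI[of _ F]) (use f F in \<open>simp only: o_apply simp_thms\<close>)
  qed
  have dense: "\<T> closure_of \<A> = topspace \<T>"
  proof
    show "\<T> closure_of \<A> \<subseteq> topspace \<T>" by (rule closure_of_subset_topspace)
    show "topspace \<T> \<subseteq> \<T> closure_of \<A>"
    proof
      fix G assume G: "G \<in> topspace \<T>"
      have "\<exists>H. H \<in> \<A> \<and> H \<in> S" if S: "G \<in> S" "openin \<T> S" for S
      proof -
        obtain W where W: "direct_limit_open W" "S = complexify c -` W \<inter> carrier ?R \<inter> I"
          using S(2) unfolding openT by blast
        have GI: "G \<in> I" using S(1) W(2) by blast
        obtain f a F where f: "G = germ p f" "analytic_fun_at \<C> f p" "has_power_series (f \<circ> chart_inv c) a 0"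
          and F: "has_power_series F (\<lambda>\<alpha>. complex_of_real (a \<alpha>)) 0"
            "\<forall>\<^sub>F y in nhds 0. F (cvec y) = of_real (f (chart_inv c y))"
          using rep[OF GI] by blast
        have "\<forall>\<^sub>F z in nhds 0. analytic_at F z"
          by (rule analytic_at_eventually) (unfold analytic_at_def, rule exI, rule F(1))
        \<comment> \<open>One such \<open>A\<close> is enough: openness of \<open>W\<close> in the
          direct limit means openness of its preimage in every space of holomorphic functions, in
          particular in the one over this \<open>A\<close>.\<close>
        then obtain A where A: "open A" "0 \<in> A" "\<And>z. z \<in> A \<Longrightarrow> analytic_at F z"
          unfolding eventually_nhds by blast
        define Fv where "Fv v z = F z + (\<Sum>i\<in>UNIV. of_real (v $ i) * z $ i ^ k)" for v :: "real ^ 'n" and z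
        define fv where "fv v x = f x + (\<Sum>i\<in>UNIV. v $ i * snd c x $ i ^ k)" for v :: "real ^ 'n" and x
        have psv: "has_power_series (Fv v) (\<lambda>\<alpha>. complex_of_real (a \<alpha>) + diag_coeff (\<lambda>i. complex_of_real (v $ i)) k \<alpha>) 0" for v
          unfolding Fv_def by (intro has_power_series_add F(1) has_power_series_diag)
        have cpx: "complexify c (germ p (fv v)) = germ 0 (Fv v)" for v
        proof (rule complexify_eq_germ[OF atlas c psv])
          have "\<forall>\<^sub>F y in nhds 0. y \<in> snd c ` fst c"
            using chartD(2)[OF atlas c(1)] c(2,3) by (intro eventually_nhds_in_open) (auto intro: image_eqI[of _ _ p])
          with F(2) show "\<forall>\<^sub>F y in nhds 0. Fv v (cvec y) = of_real (fv v (chart_inv c y))"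
          proof eventually_elim
            case (elim y)
            have "snd c (chart_inv c y) = y" by (rule chart_inverse(2)[OF atlas c(1) elim(2)])
            then show ?case using elim(1) by (simp add: Fv_def fv_def cvec_def)
          qed
        qed
        \<comment> \<open>Parameters whose perturbed germ stays in \<open>W\<close>. By continuity
          \<open>V\<close> is an open neighbourhood of 0, hence not a null set, and contains a
          nondegenerate perturbation.\<close>
        define V where "V = {v. restrict (Fv v) A \<in> {F \<in> hol_funs A. germ 0 F \<in> W}}"
        have grestr: "germ 0 (restrict (Fv v) A) = germ 0 (Fv v)" for v
          unfolding germ_eq_iff using eventually_nhds_in_open[OF A(1,2)] by (rule eventually_mono) simp
        have cm: "continuous_map euclidean (hol_topology A) (\<lambda>v. restrict (Fv v) A)"
          unfolding Fv_def[abs_def] by (rule diag_perturbation_continuous[OF A(1,3)])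
        have "openin (hol_topology A) {F \<in> hol_funs A. germ 0 F \<in> W}"
          using W(1) A(1,2) unfolding direct_limit_open_def by blast
        from openin_continuous_map_preimage[OF cm this] have openV: "open V"
          by (simp add: V_def open_openin[symmetric])
        have hol: "restrict (Fv v) A \<in> hol_funs A" for v
          using cm unfolding continuous_map_def topspace_hol_topology by auto
        have "germ 0 (Fv 0) \<in> W"
        proof -
          have "fv 0 = f" unfolding fv_def by simp
          then have "complexify c G = germ 0 (Fv 0)" using cpx[of 0] f(1) by simp
          then show ?thesis using S(1) W(2) by auto
        qed
        then have "0 \<in> V" using hol by (simp add: V_def grestr)
        from nondegenerate_perturbation[OF openV this, of a "Suc k2"]
        obtain v where v: "v \<in> V" "nondegenerate (\<lambda>\<alpha>. a \<alpha> + diag_coeff (\<lambda>i. v $ i) k \<alpha>) k"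
          unfolding kS by blast
        have inW: "germ 0 (Fv v) \<in> W" using v(1) by (simp add: V_def grestr)
        have "Re (complex_of_real (a \<alpha>) + diag_coeff (\<lambda>i. complex_of_real (v $ i)) k \<alpha>) = a \<alpha> + diag_coeff (\<lambda>i. v $ i) k \<alpha>" for \<alpha>
          by (simp add: diag_coeff_def if_distrib[of Re] cong: if_cong)
        then have good: "germ 0 (Fv v) \<in> good_germs k" using v(2) by (intro good_germsI[OF psv]) simp
        have an: "analytic_fun_at \<C> (fv v) p"
          unfolding fv_def[abs_def]
          by (intro analytic_fun_at_add f(2) analytic_fun_at_sum analytic_fun_at_mult analytic_fun_at_const
              analytic_fun_at_power analytic_fun_at_coord[OF atlas c maximal] finite)
        have "germ p (\<lambda>x. \<Sum>i\<in>UNIV. v $ i * snd c x $ i ^ k) \<in> I"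
          unfolding I_def kS by (rule ideal_power_coord_sum[OF atlas c maximal])
        then have "germ p (fv v) \<in> I"
          using ideal_power_add[OF atlas c maximal, of f "Suc k2"] GI
          unfolding I_def kS f(1) fv_def[abs_def] by blast
        then have "germ p (fv v) \<in> \<A> \<and> germ p (fv v) \<in> S"
          using good inW germ_in_carrier[OF an] cpx[of v] by (simp add: \<A>_def W(2))
        then show ?thesis by blast
      qed
      then show "G \<in> \<T> closure_of \<A>" unfolding in_closure_of using G by blast
    qed
  qed
  have unstable: "totally_unstable \<C> g A U \<mu> p"
    if H: "open A" "p \<in> A" "\<forall>x\<in>A. analytic_fun_at \<C> U x" "germ p U \<in> \<A>"
      "analytic_one_form \<C> A \<mu>" "weak_magnetism \<C> c U \<mu> p" for A U \<mu>
  proof -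
    have "germ p U \<in> I" using H(4) by (simp add: \<A>_def)
    from rep[OF this] obtain f a F where f: "germ p U = germ p f" "has_power_series (f \<circ> chart_inv c) a 0"
      "\<forall>\<alpha>. mdeg \<alpha> < k \<longrightarrow> a \<alpha> = 0"
      and F: "has_power_series F (\<lambda>\<alpha>. complex_of_real (a \<alpha>)) 0"
        "\<forall>\<^sub>F y in nhds 0. F (cvec y) = of_real (f (chart_inv c y))" by blast
    have "complexify c (germ p U) = germ 0 F" unfolding f(1) by (rule complexify_eq_germ[OF atlas c F])
    then have "germ 0 F \<in> good_germs k" using H(4) by (simp add: \<A>_def)
    then obtain b where b: "has_power_series F b 0" "nondegenerate (\<lambda>\<alpha>. Re (b \<alpha>)) k" by (rule good_germsE)
    \<comment> \<open>The series of the extension is unique, so the coefficients witnessing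
      membership in \<open>good_germs\<close> are the real Taylor coefficients
      \<open>a\<close>.\<close>
    have "b = (\<lambda>\<alpha>. complex_of_real (a \<alpha>))"
      using complex_power_series_zero[OF has_power_series_diff[OF b(1) F(1)]] by (simp add: fun_eq_iff)
    with b(2) have nd: "nondegenerate a k" by simp
    have "\<forall>\<^sub>F y in nhds 0. (U \<circ> chart_inv c) y = (f \<circ> chart_inv c) y"
      using germ_pullback[OF atlas c maximal f(1)] by simp
    then have "has_power_series (U \<circ> chart_inv c) a 0" using f(2) has_power_series_cong by blast
    then show ?thesis
    proof (rule total_instability[OF atlas metric c H(1,2,3,5,6)])
      show "a \<alpha> = 0" if "mdeg \<alpha> < k2 + 2" for \<alpha> using f(3) that by (simp add: k2)
      show "nondegenerate a (k2 + 2)" using nd by (simp add: k2)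
    qed
  qed
  show ?thesis
    unfolding Let_def I_def[symmetric] \<T>_def[symmetric]
    by (rule exI[of _ \<A>], intro conjI openA dense allI impI, elim conjE, rule unstable)
qed

end
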